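(* Let $\overline{\mathbb E}\subset\mathbb C^3$ be the closure of the tetrablock. There exist $n\in\mathbb N$ and matrices $A_1,A_2,A_3\in M_n(\mathbb C)$ such that the commuting tuple $(T_1,T_2,T_3)$ of operators on $\mathbb C^{2n}$ given by $$T_j=\begin{pmatrix}0&A_j\\0&0\end{pmatrix},\qquad j=1,2,3,$$ has $\overline{\mathbb E}$ as a spectral set but not as a complete spectral set. Consequently, rational dilation fails on the tetrablock; that is, there is a commuting triple of bounded Hilbert space operators which has $\overline{\mathbb E}$ as a spectral set but which does not admit a normal $\partial\overline{\mathbb E}$-dilation.
   Context: The tetrablock is $\mathbb E=\{(x_1,x_2,x_3)\in\mathbb C^3: 1-x_1z-x_2w+x_3zw\neq0\text{ for all }z,w\in\overline{\mathbb D}\}$, where $\overline{\mathbb D}$ is the closed unit disc in $\mathbb{C}$; $\overline{\mathbb E}$ is its closure, which is compact. For a commuting tuple $\mathbf T=(T_1,\dots,T_m)$ of bounded operators on a complex Hilbert space $\mathcal H$, the joint spectrum $\mathrm{sp}(\mathbf T)$ is the set of all $w\in\mathbb C^m$ such that $p(w)$ belongs to the spectrum of $p(\mathbf T)$ for every polynomial $p\in\mathbb C[z_1,\dots,z_m]$. For a compact set $\Omega\subseteq\mathbb C^m$, $\mathrm{Rat}(\Omega)$ is the algebra of rational functions $p/q$ with $p,q\in\mathbb C[z_1,\dots,z_m]$ and $q(w)\ne0$ for every $w\in\Omega$. If $\mathrm{sp}(\mathbf T)\subseteq\Omega$ and $f=p/q\in\mathrm{Rat}(\Omega)$, then $q(\mathbf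 T)$ is invertible and $f(\mathbf T):=p(\mathbf T)q(\mathbf T)^{-1}$. For a matrix $F=(f_{ij})\in M_k(\mathrm{Rat}(\Omega))$, put $F(\mathbf T)=(f_{ij}(\mathbf T))_{i,j}$, an operator on $\mathcal H^k$, and $\|F\|_{M_k(\mathrm{Rat}(\Omega))}=\sup_{w\in\Omega}\|F(w)\|_{\mathrm{op}}$, where $\|\cdot\|_{\mathrm{op}}$ is the operator norm with respect to Euclidean norms. $\Omega$ is a spectral set for $\mathbf T$ if $\mathrm{sp}(\mathbf T)\subseteq\Omega$ and $\|f(\mathbf T)\|\le\sup_{w\in\Omega}|f(w)|$ for all $f\in\mathrm{Rat}(\Omega)$. $\Omega$ is a complete spectral set for $\mathbf T$ if $\mathrm{sp}(\mathbf T)\subseteq\Omega$ and $\|F(\mathbf T)\|\le\|F\|_{M_k(\mathrm{Rat}(\Omega))}$ for all $k\ge1$ and all $F\in M_k(\mathrm{Rat}(\Omega))$. Let $\partial\Omega$ denote the Shilov boundary of the algebra $\mathrm{Rat}(\Omega)$. A tuple $\mathbf T$ having $\Omega$ as a spectral set has a rational dilation (normal $\partial\Omega$-dilation) if there exist a Hilbert space $\mathcal K$, an isometry $V:\mathcal H\to\mathcal K$ and a commuting tuple $\mathbf N=(N_1,\dots,N_m)$ of normal operators on $\mathcal K$ with $\mathrm{sp}(\mathbf N)\subseteq\partial\Omega$ such that $f(\mathbf T)=V^*f(\mathbf N)V$ for every $f\in\mathrm{Rat}(\Omega)$. *)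

theory Defs
  imports
    "HOL-Analysis.Elementary_Topology"
    "HOL-Library.Poly_Mapping"
    "Jordan_Normal_Form.VS_Connect"
begin

section \<open>Complex Hilbert spaces and bounded operators\<close>

text \<open>
  Hilbert spaces are records with an explicit carrier, extending the module records of HOL-Algebra.
  This allows the dimension of a space such as \<open>\<complex>\<^sup>n\<close> to be a bound variable of a formula. The fields
  \<^const>\<open>monoid.mult\<close> and \<^const>\<open>monoid.one\<close>, inherited from the ring record, play no role.
  Inner products are linear in the first argument.
\<close>

record 'a hilbert = "(complex, 'a) module" +
  cinner :: "'a \<Rightarrow> 'a \<Rightarrow> complex"

type_synonym cvec = "complex vec"

definition hnorm :: "'a hilbert \<Rightarrow> 'a \<Rightarrow> real" where
  "hnorm H x = sqrt (Re (cinner H x x))"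

locale hilbert_space = module "class_ring :: complex ring" H for H :: "'a hilbert" (structure) +
  assumes cinner_add_left:
    "\<lbrakk>x \<in> carrier H; y \<in> carrier H; z \<in> carrier H\<rbrakk>
      \<Longrightarrow> cinner H (x \<oplus> y) z = cinner H x z + cinner H y z"
    and cinner_smult_left:
    "\<lbrakk>x \<in> carrier H; y \<in> carrier H\<rbrakk> \<Longrightarrow> cinner H (c \<odot> x) y = c * cinner H x y"
    and cinner_commute:
    "\<lbrakk>x \<in> carrier H; y \<in> carrier H\<rbrakk> \<Longrightarrow> cinner H x y = cnj (cinner H y x)"
    and cinner_ge_zero: "x \<in> carrier H \<Longrightarrow> 0 \<le> Re (cinner H x x)"
    and cinner_eq_zero: "\<lbrakk>x \<in> carrier H; cinner H x x = 0\<rbrakk> \<Longrightarrow> x = \<zero>"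
    and complete:
    "\<lbrakk>\<And>i. s i \<in> carrier H;
      \<And>e. e > 0 \<Longrightarrow> \<exists>M. \<forall>i\<ge>M. \<forall>j\<ge>M. hnorm H (s i \<ominus> s j) < e\<rbrakk>
      \<Longrightarrow> \<exists>x\<in>carrier H. (\<lambda>i. hnorm H (s i \<ominus> x)) \<longlonglongrightarrow> 0"

definition cspace :: "nat \<Rightarrow> cvec hilbert" where
  "cspace n = \<lparr>carrier = carrier_vec n, mult = undefined, one = undefined,
     zero = 0\<^sub>v n, add = (+), smult = (\<cdot>\<^sub>v), cinner = (\<lambda>v w. v \<bullet>c w)\<rparr>"

text \<open>The Hilbert space \<open>H\<^sup>k\<close>.\<close>

definition hpow :: "nat \<Rightarrow> 'a hilbert \<Rightarrow> 'a vec hilbert" where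
  "hpow k H = \<lparr>carrier = {v. dim_vec v = k \<and> (\<forall>i<k. v $ i \<in> carrier H)},
     mult = undefined, one = undefined,
     zero = vec k (\<lambda>_. \<zero>\<^bsub>H\<^esub>),
     add = (\<lambda>v w. vec k (\<lambda>i. v $ i \<oplus>\<^bsub>H\<^esub> w $ i)),
     smult = (\<lambda>c v. vec k (\<lambda>i. c \<odot>\<^bsub>H\<^esub> v $ i)),
     cinner = (\<lambda>v w. \<Sum>i<k. cinner H (v $ i) (w $ i))\<rparr>"

text \<open>Operators are functions of which only the values on the carrier matter.\<close>

definition bounded_op :: "'a hilbert \<Rightarrow> 'b hilbert \<Rightarrow> ('a \<Rightarrow> 'b) \<Rightarrow> bool" where
  "bounded_op H K S \<longleftrightarrow>
     (\<forall>x\<in>carrier H. S x \<in> carrier K) \<and>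
     (\<forall>x\<in>carrier H. \<forall>y\<in>carrier H. S (x \<oplus>\<^bsub>H\<^esub> y) = S x \<oplus>\<^bsub>K\<^esub> S y) \<and>
     (\<forall>c. \<forall>x\<in>carrier H. S (c \<odot>\<^bsub>H\<^esub> x) = c \<odot>\<^bsub>K\<^esub> S x) \<and>
     (\<exists>C. \<forall>x\<in>carrier H. hnorm K (S x) \<le> C * hnorm H x)"

definition op_norm :: "'a hilbert \<Rightarrow> 'b hilbert \<Rightarrow> ('a \<Rightarrow> 'b) \<Rightarrow> real" where
  "op_norm H K S = (SUP x\<in>{x \<in> carrier H. hnorm H x \<le> 1}. hnorm K (S x))"

definition invertible_op :: "'a hilbert \<Rightarrow> ('a \<Rightarrow> 'a) \<Rightarrow> bool" where
  "invertible_op H S \<longleftrightarrow>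
     (\<exists>R. bounded_op H H R \<and> (\<forall>x\<in>carrier H. R (S x) = x \<and> S (R x) = x))"

definition op_spectrum :: "'a hilbert \<Rightarrow> ('a \<Rightarrow> 'a) \<Rightarrow> complex set" where
  "op_spectrum H S = {c. \<not> invertible_op H (\<lambda>x. S x \<ominus>\<^bsub>H\<^esub> c \<odot>\<^bsub>H\<^esub> x)}"

definition is_adjoint :: "'a hilbert \<Rightarrow> 'b hilbert \<Rightarrow> ('a \<Rightarrow> 'b) \<Rightarrow> ('b \<Rightarrow> 'a) \<Rightarrow> bool" where
  "is_adjoint H K S S' \<longleftrightarrow> bounded_op K H S' \<and>
     (\<forall>x\<in>carrier H. \<forall>y\<in>carrier K. cinner K (S x) y = cinner H x (S' y))"

definition isometry_op :: "'a hilbert \<Rightarrow> 'b hilbert \<Rightarrow> ('a \<Rightarrow> 'b) \<Rightarrow> bool" where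
  "isometry_op H K V \<longleftrightarrow> bounded_op H K V \<and> (\<forall>x\<in>carrier H. hnorm K (V x) = hnorm H x)"

definition normal_op :: "'a hilbert \<Rightarrow> ('a \<Rightarrow> 'a) \<Rightarrow> bool" where
  "normal_op H S \<longleftrightarrow> bounded_op H H S \<and>
     (\<exists>S'. is_adjoint H H S S' \<and> (\<forall>x\<in>carrier H. S (S' x) = S' (S x)))"

section \<open>Triples of operators and rational functions in three variables\<close>

type_synonym point = "complex \<times> complex \<times> complex"

type_synonym 'a op_triple = "('a \<Rightarrow> 'a) \<times> ('a \<Rightarrow> 'a) \<times> ('a \<Rightarrow> 'a)"

fun commuting_triple :: "'a hilbert \<Rightarrow> 'a op_triple \<Rightarrow> bool" where
  "commuting_triple H (T1, T2, T3) \<longleftrightarrow>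
     bounded_op H H T1 \<and> bounded_op H H T2 \<and> bounded_op H H T3 \<and>
     (\<forall>x\<in>carrier H. T1 (T2 x) = T2 (T1 x) \<and> T1 (T3 x) = T3 (T1 x) \<and> T2 (T3 x) = T3 (T2 x))"

text \<open>
  The polynomial ring \<open>\<complex>[z\<^sub>1, z\<^sub>2, z\<^sub>3]\<close> is the monoid ring of finitely supported coefficient
  functions on exponent triples.
\<close>

type_synonym cpoly3 = "(nat \<times> nat \<times> nat) \<Rightarrow>\<^sub>0 complex"

fun peval :: "cpoly3 \<Rightarrow> point \<Rightarrow> complex" where
  "peval p (w1, w2, w3) =
     (\<Sum>(a, b, c)\<in>Poly_Mapping.keys p. Poly_Mapping.lookup p (a, b, c) * w1 ^ a * w2 ^ b * w3 ^ c)"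

fun peval_op :: "'a hilbert \<Rightarrow> cpoly3 \<Rightarrow> 'a op_triple \<Rightarrow> 'a \<Rightarrow> 'a" where
  "peval_op H p (T1, T2, T3) x =
     finsum H (\<lambda>(a, b, c). Poly_Mapping.lookup p (a, b, c) \<odot>\<^bsub>H\<^esub> (T1 ^^ a) ((T2 ^^ b) ((T3 ^^ c) x)))
       (Poly_Mapping.keys p)"

definition joint_spectrum :: "'a hilbert \<Rightarrow> 'a op_triple \<Rightarrow> point set" where
  "joint_spectrum H T = {w. \<forall>p. peval p w \<in> op_spectrum H (peval_op H p T)}"

text \<open>
  A rational function is represented by a pair consisting of numerator and denominator. Everything
  below depends only on the quotient, not on the representation.
\<close>

type_synonym cratfun3 = "cpoly3 \<times> cpoly3"

definition Rat :: "point set \<Rightarrow> cratfun3 set" where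
  "Rat \<Omega> = {(p, q). \<forall>w\<in>\<Omega>. peval q w \<noteq> 0}"

fun reval :: "cratfun3 \<Rightarrow> point \<Rightarrow> complex" where
  "reval (p, q) w = peval p w / peval q w"

text \<open>
  The operator \<open>p(T) q(T)\<^sup>-\<^sup>1\<close>; if the joint spectrum of the triple lies in \<open>\<Omega>\<close> and \<open>(p, q) \<in> Rat \<Omega>\<close>,
  then \<open>q(T)\<close> is invertible and \<^const>\<open>inv_into\<close> yields its inverse.
\<close>

fun reval_op :: "'a hilbert \<Rightarrow> cratfun3 \<Rightarrow> 'a op_triple \<Rightarrow> 'a \<Rightarrow> 'a" where
  "reval_op H (p, q) T x = peval_op H p T (inv_into (carrier H) (peval_op H q T) x)"

definition Rat_mat :: "nat \<Rightarrow> point set \<Rightarrow> cratfun3 mat set" where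
  "Rat_mat k \<Omega> = {F \<in> carrier_mat k k. \<forall>i<k. \<forall>j<k. F $$ (i, j) \<in> Rat \<Omega>}"

definition mat_reval :: "cratfun3 mat \<Rightarrow> point \<Rightarrow> complex mat" where
  "mat_reval F w = map_mat (\<lambda>f. reval f w) F"

definition mat_reval_op :: "'a hilbert \<Rightarrow> cratfun3 mat \<Rightarrow> 'a op_triple \<Rightarrow> 'a vec \<Rightarrow> 'a vec" where
  "mat_reval_op H F T v =
     vec (dim_row F) (\<lambda>i. finsum H (\<lambda>j. reval_op H (F $$ (i, j)) T (v $ j)) {..<dim_col F})"

section \<open>Spectral sets and rational dilation\<close>

text \<open>These notions are meant for nonempty compact \<open>\<Omega>\<close>, for which all suprema are finite.\<close>

definition spectral_set :: "point set \<Rightarrow> 'a hilbert \<Rightarrow> 'a op_triple \<Rightarrow> bool" where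
  "spectral_set \<Omega> H T \<longleftrightarrow> joint_spectrum H T \<subseteq> \<Omega> \<and>
     (\<forall>f\<in>Rat \<Omega>. op_norm H H (reval_op H f T) \<le> (SUP w\<in>\<Omega>. cmod (reval f w)))"

definition complete_spectral_set :: "point set \<Rightarrow> 'a hilbert \<Rightarrow> 'a op_triple \<Rightarrow> bool" where
  "complete_spectral_set \<Omega> H T \<longleftrightarrow> joint_spectrum H T \<subseteq> \<Omega> \<and>
     (\<forall>k\<ge>1. \<forall>F\<in>Rat_mat k \<Omega>.
        op_norm (hpow k H) (hpow k H) (mat_reval_op H F T)
          \<le> (SUP w\<in>\<Omega>. op_norm (cspace k) (cspace k) (\<lambda>v. mat_reval F w *\<^sub>v v)))"

text \<open>
  The Shilov boundary of \<open>Rat \<Omega>\<close> is the smallest closed subset of \<open>\<Omega>\<close> on which the modulus of every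
  element of the algebra attains its maximum over \<open>\<Omega>\<close>, i.e. the intersection of all such sets.
\<close>

definition boundary_for_Rat :: "point set \<Rightarrow> point set \<Rightarrow> bool" where
  "boundary_for_Rat \<Omega> B \<longleftrightarrow> closed B \<and> B \<subseteq> \<Omega> \<and>
     (\<forall>f\<in>Rat \<Omega>. \<exists>b\<in>B. \<forall>w\<in>\<Omega>. cmod (reval f w) \<le> cmod (reval f b))"

definition shilov_boundary :: "point set \<Rightarrow> point set" where
  "shilov_boundary \<Omega> = \<Inter>{B. boundary_for_Rat \<Omega> B}"

fun normal_triple :: "'a hilbert \<Rightarrow> 'a op_triple \<Rightarrow> bool" where
  "normal_triple H (N1, N2, N3) \<longleftrightarrow> normal_op H N1 \<and> normal_op H N2 \<and> normal_op H N3"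

definition rational_dilation ::
  "point set \<Rightarrow> 'a hilbert \<Rightarrow> 'a op_triple \<Rightarrow> 'k hilbert \<Rightarrow> ('a \<Rightarrow> 'k) \<Rightarrow> 'k op_triple \<Rightarrow> bool" where
  "rational_dilation \<Omega> H T K V N \<longleftrightarrow>
     hilbert_space K \<and> isometry_op H K V \<and>
     commuting_triple K N \<and> normal_triple K N \<and>
     joint_spectrum K N \<subseteq> shilov_boundary \<Omega> \<and>
     (\<exists>V'. is_adjoint H K V V' \<and>
        (\<forall>f\<in>Rat \<Omega>. \<forall>x\<in>carrier H. reval_op H f T x = V' (reval_op K f N (V x))))"

section \<open>The tetrablock and block nilpotent triples\<close>

definition tetrablock :: "point set" where
  "tetrablock = {(x1, x2, x3). \<forall>z w. cmod z \<le> 1 \<longrightarrow> cmod w \<le> 1 \<longrightarrow>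
     1 - x1 * z - x2 * w + x3 * z * w \<noteq> 0}"

definition nilpotent_op :: "nat \<Rightarrow> complex mat \<Rightarrow> cvec \<Rightarrow> cvec" where
  "nilpotent_op n A v = four_block_mat (0\<^sub>m n n) A (0\<^sub>m n n) (0\<^sub>m n n) *\<^sub>v v"

definition nilpotent_triple ::
  "nat \<Rightarrow> complex mat \<Rightarrow> complex mat \<Rightarrow> complex mat \<Rightarrow> cvec op_triple" where
  "nilpotent_triple n A1 A2 A3 = (nilpotent_op n A1, nilpotent_op n A2, nilpotent_op n A3)"

end

theory Submission
  imports Defs "HOL-Complex_Analysis.Conformal_Mappings"
begin

text \<open>
  The triple of the theorem is \<open>n = 2\<close> with \<open>A\<^sub>1 = (3/4) E\<^sub>1\<^sub>2\<close>, \<open>A\<^sub>2 = (3/4) E\<^sub>2\<^sub>1\<close>, \<open>A\<^sub>3 = (1/2) I\<close>. All products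
  \<open>T\<^sub>i T\<^sub>j\<close> vanish, so \<open>f(T)\<close> depends only on \<open>f(0)\<close> and the gradient \<open>\<ell>\<close> of \<open>f\<close> at the origin: it is the
  block matrix with diagonal \<open>f(0)\<close> and corner \<open>\<ell>\<^sub>1 A\<^sub>1 + \<ell>\<^sub>2 A\<^sub>2 + \<ell>\<^sub>3 A\<^sub>3\<close>.

  \<^emph>\<open>Spectral set.\<close> The tetrablock contains the discs \<open>(u\<lambda>, v\<lambda>, uv\<lambda>\<^sup>2)\<close> with \<open>|u| = |v| = 1\<close> and
  \<open>(0, 0, \<lambda>)\<close>. For \<open>|f| \<le> 1\<close> the Schwarz-Pick inequality along these discs gives
  \<open>|\<ell>\<^sub>1| + |\<ell>\<^sub>2| \<le> 1 - |f(0)|\<^sup>2\<close> and \<open>|\<ell>\<^sub>3| \<le> 1 - |f(0)|\<^sup>2\<close> (\<open>tetrablock_derivative_bounds\<close>). The constants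
  \<open>3/4\<close> and \<open>1/2\<close> are chosen such that the corner then has norm at most \<open>1 - |f(0)|\<^sup>2\<close>, which is what makes
  \<open>f(T)\<close> a contraction (\<open>block_op_contraction\<close>).

  \<^emph>\<open>Not a complete spectral set.\<close> The witness is the upper triangular matrix function with diagonal
  \<open>x\<^sub>1, x\<^sub>2\<close> and corner \<open>x\<^sub>3 - x\<^sub>1x\<^sub>2\<close>. A point \<open>x\<close> of the tetrablock defines the self-map
  \<open>w \<mapsto> (x\<^sub>1 - x\<^sub>3w) / (1 - x\<^sub>2w)\<close> of the disc, with value \<open>x\<^sub>1\<close> and derivative \<open>x\<^sub>1x\<^sub>2 - x\<^sub>3\<close> at \<open>0\<close>; hence
  \<open>|x\<^sub>3 - x\<^sub>1x\<^sub>2| \<le> 1 - |x\<^sub>1|\<^sup>2\<close>, and by symmetry the same with \<open>x\<^sub>2\<close>, which makes the matrix a contraction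
  (\<open>ex_fun_contractive\<close>). At \<open>T\<close> the second-order term \<open>x\<^sub>1x\<^sub>2\<close> disappears while the contribution of \<open>x\<^sub>3\<close>
  remains, and the norm exceeds \<open>1\<close>.

  \<^emph>\<open>No dilation.\<close> Compressing a normal dilation \<open>N\<close> cannot increase norms, so it suffices that
  \<open>\<parallel>F(N)\<parallel> \<le> sup \<parallel>F(w)\<parallel>\<close> for every matrix \<open>F\<close> of rational functions (\<open>von_neumann_inequality\<close>). In place of
  a joint spectral measure of \<open>N\<close> the proof uses joint approximate eigenvectors. Let \<open>\<mu> = \<parallel>F(N)\<parallel>\<close>. Unit
  vectors that nearly attain the norm are approximate null vectors of \<open>F(N)\<^sup>* F(N) - \<mu>\<^sup>2\<close>. They can be
  replaced by ones that are in addition approximate eigenvectors of all the \<open>N\<^sub>j\<close>, with limiting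
  eigenvalues \<open>w\<close> (\<open>triple_localize\<close>). This \<open>w\<close> lies in the joint spectrum, and on these vectors \<open>F(N)\<close>
  acts approximately like the scalar matrix \<open>F(w)\<close>, so \<open>\<mu> \<le> \<parallel>F(w)\<parallel>\<close>. The replacement needs operators that
  commute with the \<open>N\<^sub>j\<close> and with their adjoints, which is Fuglede's theorem (\<open>fuglede\<close>).
\<close>

no_notation Finite_Cartesian_Product.vec.vec_nth (infixl "$" 90)
hide_const (open) Finite_Cartesian_Product.vec Finite_Cartesian_Product.mat
hide_type (open) Finite_Cartesian_Product.vec

section \<open>Inner product spaces on a carrier\<close>

lemma lin_op_D:
  assumes "bounded_op H K S"
  shows "x \<in> carrier H \<Longrightarrow> S x \<in> carrier K"
    and "x \<in> carrier H \<Longrightarrow> y \<in> carrier H \<Longrightarrow> S (x \<oplus>\<^bsub>H\<^esub> y) = S x \<oplus>\<^bsub>K\<^esub> S y"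
    and "x \<in> carrier H \<Longrightarrow> S (c \<odot>\<^bsub>H\<^esub> x) = c \<odot>\<^bsub>K\<^esub> S x"
  using assms by (auto simp: bounded_op_def)

text \<open>
  Completeness enters only where an inverse operator is constructed. Separating it off allows
  \<open>H\<^sup>k\<close> to be treated like \<open>H\<close> after checking only its algebraic structure.
\<close>
locale pre_hilbert = module "class_ring :: complex ring" H for H :: "'a hilbert" (structure) +
  assumes ip_add_left:
    "\<lbrakk>x \<in> carrier H; y \<in> carrier H; z \<in> carrier H\<rbrakk>
      \<Longrightarrow> cinner H (x \<oplus> y) z = cinner H x z + cinner H y z"
    and ip_smult_left:
    "\<lbrakk>x \<in> carrier H; y \<in> carrier H\<rbrakk> \<Longrightarrow> cinner H (c \<odot> x) y = c * cinner H x y"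
    and ip_commute:
    "\<lbrakk>x \<in> carrier H; y \<in> carrier H\<rbrakk> \<Longrightarrow> cinner H x y = cnj (cinner H y x)"
    and ip_ge_zero: "x \<in> carrier H \<Longrightarrow> 0 \<le> Re (cinner H x x)"
    and ip_eq_zero: "\<lbrakk>x \<in> carrier H; cinner H x x = 0\<rbrakk> \<Longrightarrow> x = \<zero>"

sublocale hilbert_space \<subseteq> pre_hilbert
  by unfold_locales
    (fact cinner_add_left cinner_smult_left cinner_commute cinner_ge_zero cinner_eq_zero)+

context pre_hilbert
begin

abbreviation ip where "ip \<equiv> cinner H"
abbreviation nm where "nm \<equiv> hnorm H"
abbreviation bop where "bop \<equiv> bounded_op H H"

lemma smc [simp, intro]: "x \<in> carrier H \<Longrightarrow> c \<odot> x \<in> carrier H"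
  using smult_closed[of c x] by simp

lemma ip_add_right:
  "\<lbrakk>x \<in> carrier H; y \<in> carrier H; z \<in> carrier H\<rbrakk> \<Longrightarrow> ip z (x \<oplus> y) = ip z x + ip z y"
  using ip_commute[of z "x \<oplus> y"] ip_commute[of z x] ip_commute[of z y] by (simp add: ip_add_left)

lemma ip_smult_right:
  "\<lbrakk>x \<in> carrier H; z \<in> carrier H\<rbrakk> \<Longrightarrow> ip z (c \<odot> x) = cnj c * ip z x"
  using ip_commute[of z "c \<odot> x"] ip_commute[of z x] by (simp add: ip_smult_left)

lemma ip_zero_left: "z \<in> carrier H \<Longrightarrow> ip \<zero> z = 0"
  using ip_add_left[of \<zero> \<zero> z] by simp

lemma ip_zero_right: "z \<in> carrier H \<Longrightarrow> ip z \<zero> = 0"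
  using ip_add_right[of \<zero> \<zero> z] by simp

lemma ip_minus_left:
  assumes "x \<in> carrier H" "y \<in> carrier H" "z \<in> carrier H"
  shows "ip (x \<ominus> y) z = ip x z - ip y z"
proof -
  have "ip (\<ominus> y \<oplus> y) z = 0" using assms by (simp add: l_neg ip_zero_left)
  then have "ip (\<ominus> y) z = - ip y z" using assms by (simp add: ip_add_left add_eq_0_iff2)
  then show ?thesis using assms by (simp add: a_minus_def ip_add_left)
qed

lemma ip_minus_right:
  "\<lbrakk>x \<in> carrier H; y \<in> carrier H; z \<in> carrier H\<rbrakk> \<Longrightarrow> ip z (x \<ominus> y) = ip z x - ip z y"
  using ip_commute[of z "x \<ominus> y"] ip_commute[of z x] ip_commute[of z y] by (simp add: ip_minus_left)

lemma ip_self: "x \<in> carrier H \<Longrightarrow> ip x x = of_real ((nm x)\<^sup>2)"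
  using ip_commute[of x x] ip_ge_zero[of x]
  by (auto simp: hnorm_def complex_eq_iff)

lemma nm_sq: "x \<in> carrier H \<Longrightarrow> (nm x)\<^sup>2 = Re (ip x x)"
  by (simp add: ip_self)

lemma nm_nonneg [simp]: "nm x \<ge> 0" if "x \<in> carrier H"
  using ip_ge_zero[OF that] by (simp add: hnorm_def)

lemma nm_zero [simp]: "nm \<zero> = 0"
  by (simp add: hnorm_def ip_zero_left)

lemma nm_eq_0: "x \<in> carrier H \<Longrightarrow> nm x = 0 \<longleftrightarrow> x = \<zero>"
  using ip_eq_zero[of x] by (auto simp: ip_self)

lemma minus_eq_zero: "\<lbrakk>x \<in> carrier H; y \<in> carrier H; x \<ominus> y = \<zero>\<rbrakk> \<Longrightarrow> x = y"
  by (metis a_minus_def minus_equality minus_minus a_comm a_inv_closed)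

text \<open>
  This reduces vector identities to identities between complex numbers, where the simplifier has no
  carrier conditions to discharge; most vector computations below are done in this way.
\<close>
lemma ip_ext:
  assumes "x \<in> carrier H" "y \<in> carrier H" "\<And>z. z \<in> carrier H \<Longrightarrow> ip x z = ip y z"
  shows "x = y"
proof (rule minus_eq_zero)
  have "ip (x \<ominus> y) (x \<ominus> y) = 0" using assms by (simp add: ip_minus_left)
  then show "x \<ominus> y = \<zero>" using assms by (intro ip_eq_zero) auto
qed (use assms in auto)

lemmas ip_simps = ip_add_left ip_add_right ip_smult_left ip_smult_right ip_minus_left ip_minus_right
  ip_zero_left ip_zero_right

lemma cauchy_schwarz:
  assumes x: "x \<in> carrier H" and y: "y \<in> carrier H"
  shows "cmod (ip x y) \<le> nm x * nm y"
proof (cases "nm y = 0")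
  case True
  then show ?thesis using nm_eq_0[OF y] x by (simp add: ip_zero_right)
next
  case False
  define t where "t = ip x y / of_real ((nm y)\<^sup>2)"
  have yy: "ip y y = of_real ((nm y)\<^sup>2)" using ip_self y by auto
  have yx: "ip y x = cnj (ip x y)" by (rule ip_commute[OF y x])
  have "0 \<le> Re (ip (x \<ominus> t \<odot> y) (x \<ominus> t \<odot> y))" using x y by (intro ip_ge_zero) auto
  also have "ip (x \<ominus> t \<odot> y) (x \<ominus> t \<odot> y) = ip x x - ip x y * cnj (ip x y) / of_real ((nm y)\<^sup>2)"
    using x y False by (simp add: ip_simps yy yx t_def field_simps power2_eq_square)
  also have "\<dots> = of_real ((nm x)\<^sup>2 - (cmod (ip x y))\<^sup>2 / (nm y)\<^sup>2)"
    using x by (simp add: ip_self complex_norm_square [symmetric] del: of_real_power)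
  finally have "(cmod (ip x y))\<^sup>2 \<le> (nm x * nm y)\<^sup>2"
    using False y nm_nonneg[OF y] by (simp add: divide_le_eq field_simps power_mult_distrib)
  then show ?thesis by (rule power2_le_imp_le) (use x y in auto)
qed

lemma nm_triangle:
  assumes x: "x \<in> carrier H" and y: "y \<in> carrier H"
  shows "nm (x \<oplus> y) \<le> nm x + nm y"
proof (rule power2_le_imp_le)
  have "(nm (x \<oplus> y))\<^sup>2 = (nm x)\<^sup>2 + (nm y)\<^sup>2 + 2 * Re (ip x y)"
    using x y ip_commute[of y x] by (simp add: nm_sq ip_simps)
  also have "Re (ip x y) \<le> nm x * nm y"
    using cauchy_schwarz[OF x y] complex_Re_le_cmod order_trans by blast
  finally show "(nm (x \<oplus> y))\<^sup>2 \<le> (nm x + nm y)\<^sup>2" by (simp add: power2_sum)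
qed (use assms in auto)

lemma nm_smult:
  assumes x: "x \<in> carrier H"
  shows "nm (c \<odot> x) = cmod c * nm x"
proof (rule power2_eq_imp_eq)
  have "ip (c \<odot> x) (c \<odot> x) = of_real ((cmod c * nm x)\<^sup>2)"
    using x by (simp only: ip_simps smc) (simp add: ip_self power_mult_distrib mult.commute flip: complex_norm_square)
  then show "(nm (c \<odot> x))\<^sup>2 = (cmod c * nm x)\<^sup>2"
    using x by (simp add: nm_sq del: of_real_mult of_real_power)
qed (use x in auto)

lemma nm_minus_sym: "\<lbrakk>x \<in> carrier H; y \<in> carrier H\<rbrakk> \<Longrightarrow> nm (x \<ominus> y) = nm (y \<ominus> x)"
  by (rule power2_eq_imp_eq) (auto simp: nm_sq ip_simps)

lemma minus_smult: "\<lbrakk>x \<in> carrier H; y \<in> carrier H\<rbrakk> \<Longrightarrow> x \<ominus> y = x \<oplus> (-1) \<odot> y"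
  by (rule ip_ext) (auto simp: ip_simps)

lemma nm_triangle3:
  assumes "x \<in> carrier H" "y \<in> carrier H" "z \<in> carrier H"
  shows "nm (x \<ominus> z) \<le> nm (x \<ominus> y) + nm (y \<ominus> z)"
proof -
  have "x \<ominus> z = (x \<ominus> y) \<oplus> (y \<ominus> z)" using assms by (intro ip_ext) (auto simp: ip_simps)
  then show ?thesis using assms nm_triangle[of "x \<ominus> y" "y \<ominus> z"] by simp
qed

lemma nm_le_add_minus:
  assumes "x \<in> carrier H" "y \<in> carrier H"
  shows "nm x \<le> nm (x \<ominus> y) + nm y"
proof -
  have "x = (x \<ominus> y) \<oplus> y" using assms by (intro ip_ext) (auto simp: ip_simps)
  then show ?thesis using assms nm_triangle[of "x \<ominus> y" "y"] by simp
qed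

end

section \<open>Bounded operators and adjoints\<close>

context pre_hilbert
begin

lemma bop_cl: "bop X \<Longrightarrow> x \<in> carrier H \<Longrightarrow> X x \<in> carrier H"
  by (simp add: bounded_op_def)

lemma bop_add: "bop X \<Longrightarrow> x \<in> carrier H \<Longrightarrow> y \<in> carrier H \<Longrightarrow> X (x \<oplus> y) = X x \<oplus> X y"
  by (simp add: bounded_op_def)

lemma bop_smult: "bop X \<Longrightarrow> x \<in> carrier H \<Longrightarrow> X (c \<odot> x) = c \<odot> X x"
  by (simp add: bounded_op_def)

lemma bop_minus:
  "bop X \<Longrightarrow> x \<in> carrier H \<Longrightarrow> y \<in> carrier H \<Longrightarrow> X (x \<ominus> y) = X x \<ominus> X y"
  by (simp add: minus_smult bop_add bop_smult bop_cl)

lemma zero_smult: "x \<in> carrier H \<Longrightarrow> 0 \<odot> x = \<zero>"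
  by (rule ip_ext) (auto simp: ip_simps)

lemma bop_zero: "bop X \<Longrightarrow> X \<zero> = \<zero>"
  using bop_smult[of X \<zero> 0] by (simp add: zero_smult bop_cl)

lemma bop_bound:
  assumes "bop X"
  obtains C where "C > 0" "\<And>x. x \<in> carrier H \<Longrightarrow> nm (X x) \<le> C * nm x"
proof -
  obtain C where C: "\<forall>x\<in>carrier H. nm (X x) \<le> C * nm x" using assms by (auto simp: bounded_op_def)
  show ?thesis
  proof (rule that[of "max C 1"])
    fix x assume x: "x \<in> carrier H"
    then show "nm (X x) \<le> max C 1 * nm x"
      using C by (intro order_trans[OF C[rule_format, OF x]] mult_right_mono) auto
  qed simp
qed

lemma bopI:
  assumes "\<And>x. x \<in> carrier H \<Longrightarrow> X x \<in> carrier H"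
    "\<And>x y. x \<in> carrier H \<Longrightarrow> y \<in> carrier H \<Longrightarrow> X (x \<oplus> y) = X x \<oplus> X y"
    "\<And>c x. x \<in> carrier H \<Longrightarrow> X (c \<odot> x) = c \<odot> X x"
    "\<And>x. x \<in> carrier H \<Longrightarrow> nm (X x) \<le> C * nm x"
  shows "bop X"
  unfolding bounded_op_def by (intro conjI ballI allI exI[of _ C] assms)

lemma bop_id: "bop (\<lambda>x. x)"
  by (rule bopI[where C=1]) auto

lemma bop_comp:
  assumes X: "bop X" and Y: "bop Y"
  shows "bop (\<lambda>x. X (Y x))"
proof -
  obtain C where C: "C > 0" "\<And>x. x \<in> carrier H \<Longrightarrow> nm (X x) \<le> C * nm x" using X bop_bound by blast
  obtain D where D: "D > 0" "\<And>x. x \<in> carrier H \<Longrightarrow> nm (Y x) \<le> D * nm x" using Y bop_bound by blast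
  show ?thesis
  proof (rule bopI[where C="C*D"])
    fix x assume x: "x \<in> carrier H"
    have "nm (X (Y x)) \<le> C * nm (Y x)" using x Y by (intro C) (auto intro: bop_cl)
    also have "\<dots> \<le> C * (D * nm x)" using C D x by simp
    finally show "nm (X (Y x)) \<le> C * D * nm x" by simp
  qed (use X Y in \<open>auto simp: bop_cl bop_add bop_smult\<close>)
qed

lemma bop_smult_op:
  assumes X: "bop X"
  shows "bop (\<lambda>x. c \<odot> X x)"
proof -
  obtain C where C: "C > 0" "\<And>x. x \<in> carrier H \<Longrightarrow> nm (X x) \<le> C * nm x" using X bop_bound by blast
  show ?thesis
  proof (rule bopI[where C="cmod c * C"])
    fix x assume x: "x \<in> carrier H"
    show "nm (c \<odot> X x) \<le> cmod c * C * nm x"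
      using C(2)[OF x] x X by (simp add: nm_smult bop_cl mult.assoc mult_left_mono)
  qed (use X in \<open>auto simp: bop_cl bop_add bop_smult ip_simps algebra_simps intro!: ip_ext\<close>)
qed

lemma bop_add_op:
  assumes X: "bop X" and Y: "bop Y"
  shows "bop (\<lambda>x. X x \<oplus> Y x)"
proof -
  obtain C where C: "C > 0" "\<And>x. x \<in> carrier H \<Longrightarrow> nm (X x) \<le> C * nm x" using X bop_bound by blast
  obtain D where D: "D > 0" "\<And>x. x \<in> carrier H \<Longrightarrow> nm (Y x) \<le> D * nm x" using Y bop_bound by blast
  show ?thesis
  proof (rule bopI[where C="C+D"])
    fix x assume x: "x \<in> carrier H"
    have "nm (X x \<oplus> Y x) \<le> nm (X x) + nm (Y x)" using X Y x by (intro nm_triangle) (auto intro: bop_cl)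
    also have "\<dots> \<le> (C + D) * nm x" using C(2)[OF x] D(2)[OF x] by (simp add: algebra_simps)
    finally show "nm (X x \<oplus> Y x) \<le> (C + D) * nm x" .
  qed (use X Y in \<open>auto simp: bop_cl bop_add bop_smult ip_simps algebra_simps intro!: ip_ext\<close>)
qed

lemma bop_cong:
  assumes "bop X" "\<And>x. x \<in> carrier H \<Longrightarrow> Y x = X x"
  shows "bop Y"
  using assms by (auto simp: bounded_op_def)

lemma bop_minus_op: "bop X \<Longrightarrow> bop Y \<Longrightarrow> bop (\<lambda>x. X x \<ominus> Y x)"
  by (rule bop_cong[where X="\<lambda>x. X x \<oplus> (-1) \<odot> Y x"])
    (auto simp: minus_smult bop_cl intro: bop_add_op bop_smult_op)

lemma bop_shift: "bop X \<Longrightarrow> bop (\<lambda>x. X x \<ominus> c \<odot> x)"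
  by (intro bop_minus_op bop_smult_op bop_id)

lemma bop_funpow: "bop X \<Longrightarrow> bop (X ^^ n)"
proof (induction n)
  case 0
  then show ?case using bop_id by (simp add: id_def)
next
  case (Suc n)
  then show ?case using bop_comp[of X "X ^^ n"] by (simp add: o_def)
qed

lemma bop_zero_op: "bop (\<lambda>x. \<zero>)"
  by (rule bopI[where C=0]) (auto intro!: ip_ext simp: ip_simps)

lemma bop_finsum:
  assumes "finite A" "\<And>i. i \<in> A \<Longrightarrow> bop (X i)"
  shows "bop (\<lambda>x. finsum H (\<lambda>i. X i x) A)"
  using assms
proof (induction A rule: finite_induct)
  case empty
  then show ?case using bop_zero_op by simp
next
  case (insert i A)
  then have "bop (\<lambda>x. X i x \<oplus> finsum H (\<lambda>i. X i x) A)" by (intro bop_add_op) auto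
  then show ?case
    by (rule bop_cong) (use insert in \<open>auto simp: bop_cl intro!: finsum_insert\<close>)
qed

lemma ip_finsum_left:
  assumes "finite A" "\<And>i. i \<in> A \<Longrightarrow> f i \<in> carrier H" "z \<in> carrier H"
  shows "ip (finsum H f A) z = (\<Sum>i\<in>A. ip (f i) z)"
  using assms
proof (induction A rule: finite_induct)
  case empty
  then show ?case by (simp add: ip_zero_left)
next
  case (insert i A)
  then have "finsum H f (insert i A) = f i \<oplus> finsum H f A" "finsum H f A \<in> carrier H"
    by (auto intro!: finsum_insert finsum_closed)
  then show ?case using insert by (simp add: ip_add_left)
qed

lemma ip_finsum_right:
  assumes "finite A" "\<And>i. i \<in> A \<Longrightarrow> f i \<in> carrier H" "z \<in> carrier H"
  shows "ip z (finsum H f A) = (\<Sum>i\<in>A. ip z (f i))"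
proof -
  have "finsum H f A \<in> carrier H" using assms by (auto intro!: finsum_closed)
  then have "ip z (finsum H f A) = cnj (ip (finsum H f A) z)" using assms(3) by (intro ip_commute)
  also have "\<dots> = (\<Sum>i\<in>A. cnj (ip (f i) z))" using assms by (simp add: ip_finsum_left)
  also have "\<dots> = (\<Sum>i\<in>A. ip z (f i))" using assms by (intro sum.cong refl ip_commute[symmetric]) auto
  finally show ?thesis .
qed

lemma bop_of_finsum:
  assumes X: "bop X" and "finite A" "\<And>i. i \<in> A \<Longrightarrow> f i \<in> carrier H"
  shows "X (finsum H f A) = finsum H (\<lambda>i. X (f i)) A"
  using assms(2,3)
proof (induction A rule: finite_induct)
  case empty
  then show ?case by (simp add: bop_zero X)
next
  case (insert i A)
  then have "finsum H f (insert i A) = f i \<oplus> finsum H f A" "finsum H f A \<in> carrier H"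
    "finsum H (\<lambda>i. X (f i)) (insert i A) = X (f i) \<oplus> finsum H (\<lambda>i. X (f i)) A"
    by (auto intro!: finsum_insert finsum_closed simp: bop_cl X)
  then show ?case using insert by (simp add: bop_add X)
qed

text \<open>
  The adjoint is an explicit second operator. All adjoints that occur are built from those of the given
  normal operators, so no representation theorem is required to produce them.
\<close>
definition adj :: "('a \<Rightarrow> 'a) \<Rightarrow> ('a \<Rightarrow> 'a) \<Rightarrow> bool" where
  "adj X X' \<longleftrightarrow> bop X \<and> bop X' \<and> (\<forall>x\<in>carrier H. \<forall>y\<in>carrier H. ip (X x) y = ip x (X' y))"

lemma adjD: "adj X X' \<Longrightarrow> bop X" "adj X X' \<Longrightarrow> bop X'"
  "adj X X' \<Longrightarrow> x \<in> carrier H \<Longrightarrow> y \<in> carrier H \<Longrightarrow> ip (X x) y = ip x (X' y)"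
  by (auto simp: adj_def)

lemma adjD': "adj X X' \<Longrightarrow> x \<in> carrier H \<Longrightarrow> y \<in> carrier H \<Longrightarrow> ip x (X y) = ip (X' x) y"
  using ip_commute[of x "X y"] ip_commute[of "X' x" y] adjD(3)[of X X' y x]
  by (auto simp: bop_cl adjD)

lemma adj_sym: "adj X X' \<Longrightarrow> adj X' X"
  unfolding adj_def using adjD'[of X X'] by (auto simp: adj_def)

lemma adj_comp: "adj X X' \<Longrightarrow> adj Y Y' \<Longrightarrow> adj (\<lambda>x. X (Y x)) (\<lambda>x. Y' (X' x))"
  by (auto simp: adj_def bop_comp bop_cl)

lemma adj_id: "adj (\<lambda>x. x) (\<lambda>x. x)"
  by (auto simp: adj_def bop_id)

lemma adj_smult: "adj X X' \<Longrightarrow> adj (\<lambda>x. c \<odot> X x) (\<lambda>x. cnj c \<odot> X' x)"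
  by (auto simp: adj_def bop_smult_op bop_cl ip_simps)

lemma adj_add: "adj X X' \<Longrightarrow> adj Y Y' \<Longrightarrow> adj (\<lambda>x. X x \<oplus> Y x) (\<lambda>x. X' x \<oplus> Y' x)"
  by (auto simp: adj_def bop_add_op bop_cl ip_simps)

lemma adj_funpow: "adj X X' \<Longrightarrow> adj (X ^^ n) (X' ^^ n)"
proof (induction n)
  case 0
  then show ?case using adj_id by (simp add: id_def)
next
  case (Suc n)
  have "adj (\<lambda>x. X ((X ^^ n) x)) (\<lambda>x. (X' ^^ n) (X' x))" by (rule adj_comp) (use Suc in auto)
  then show ?case by (simp add: o_def funpow_swap1)
qed

lemma adj_finsum:
  assumes "finite A" "\<And>i. i \<in> A \<Longrightarrow> adj (X i) (X' i)"
  shows "adj (\<lambda>x. finsum H (\<lambda>i. X i x) A) (\<lambda>x. finsum H (\<lambda>i. X' i x) A)"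
  using assms by (auto simp: adj_def bop_finsum ip_finsum_left ip_finsum_right bop_cl intro!: sum.cong)

definition com :: "('a \<Rightarrow> 'a) \<Rightarrow> ('a \<Rightarrow> 'a) \<Rightarrow> bool" where
  "com X Y \<longleftrightarrow> (\<forall>x\<in>carrier H. X (Y x) = Y (X x))"

lemma comD: "com X Y \<Longrightarrow> x \<in> carrier H \<Longrightarrow> X (Y x) = Y (X x)"
  by (simp add: com_def)

lemma com_sym: "com X Y \<Longrightarrow> com Y X"
  by (simp add: com_def)

lemma com_refl: "com X X"
  by (simp add: com_def)

lemma com_id: "com X (\<lambda>x. x)" by (simp add: com_def)

lemma com_comp: "bop X \<Longrightarrow> bop Y \<Longrightarrow> bop Z \<Longrightarrow> com X Y \<Longrightarrow> com X Z \<Longrightarrow> com X (\<lambda>x. Y (Z x))"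
  by (simp add: com_def bop_cl)

lemma com_smult: "bop X \<Longrightarrow> bop Y \<Longrightarrow> com X Y \<Longrightarrow> com X (\<lambda>x. c \<odot> Y x)"
  by (simp add: com_def bop_cl bop_smult)

lemma com_add: "bop X \<Longrightarrow> bop Y \<Longrightarrow> bop Z \<Longrightarrow> com X Y \<Longrightarrow> com X Z \<Longrightarrow> com X (\<lambda>x. Y x \<oplus> Z x)"
  by (simp add: com_def bop_cl bop_add)

lemma com_minus: "bop X \<Longrightarrow> bop Y \<Longrightarrow> bop Z \<Longrightarrow> com X Y \<Longrightarrow> com X Z \<Longrightarrow> com X (\<lambda>x. Y x \<ominus> Z x)"
  by (simp add: com_def bop_cl bop_minus)

lemma com_shift: "bop X \<Longrightarrow> bop Y \<Longrightarrow> com X Y \<Longrightarrow> com X (\<lambda>x. Y x \<ominus> c \<odot> x)"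
  using com_minus[OF _ _ bop_smult_op[OF bop_id] _ com_smult[OF _ bop_id com_id]] by blast

lemma com_funpow: "bop X \<Longrightarrow> bop Y \<Longrightarrow> com X Y \<Longrightarrow> com X (Y ^^ n)"
proof (induction n)
  case 0
  then show ?case using com_id by (simp add: id_def)
next
  case (Suc n)
  have "com X (\<lambda>x. Y ((Y ^^ n) x))" by (rule com_comp) (use Suc in \<open>auto intro: bop_funpow\<close>)
  then show ?case by (simp add: o_def)
qed

lemma com_finsum:
  assumes "bop X" "finite A" "\<And>i. i \<in> A \<Longrightarrow> bop (Y i)" "\<And>i. i \<in> A \<Longrightarrow> com X (Y i)"
  shows "com X (\<lambda>x. finsum H (\<lambda>i. Y i x) A)"
  unfolding com_def
proof
  fix x assume x: "x \<in> carrier H"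
  then have "X (finsum H (\<lambda>i. Y i x) A) = finsum H (\<lambda>i. X (Y i x)) A"
    using assms by (intro bop_of_finsum) (auto intro: bop_cl)
  also have "\<dots> = finsum H (\<lambda>i. Y i (X x)) A"
    using assms x by (intro finsum_cong') (auto simp: comD[OF assms(4)] bop_cl)
  finally show "X (finsum H (\<lambda>i. Y i x) A) = finsum H (\<lambda>i. Y i (X x)) A" .
qed

text \<open>
  Taking adjoints reverses products and therefore preserves commutation.
\<close>
lemma com_adj:
  assumes "adj X X'" "adj Y Y'" "com X Y"
  shows "com X' Y'"
  unfolding com_def
proof
  fix x assume x: "x \<in> carrier H"
  show "X' (Y' x) = Y' (X' x)"
  proof (rule ip_ext)
    fix z assume z: "z \<in> carrier H"
    have b: "bop X" "bop X'" "bop Y" "bop Y'" using assms by (auto dest: adjD)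
    have "ip (X' (Y' x)) z = ip x (Y (X z))"
      using assms x z b by (simp add: adjD'[symmetric] bop_cl)
    also have "\<dots> = ip x (X (Y z))" by (simp add: comD[OF assms(3) z])
    also have "\<dots> = ip (Y' (X' x)) z" using assms x z b by (simp add: adjD' bop_cl)
    finally show "ip (X' (Y' x)) z = ip (Y' (X' x)) z" .
  qed (use assms x in \<open>auto simp: bop_cl adjD(2)\<close>)
qed

definition normal_pair :: "('a \<Rightarrow> 'a) \<Rightarrow> ('a \<Rightarrow> 'a) \<Rightarrow> bool" where
  "normal_pair X X' \<longleftrightarrow> adj X X' \<and> com X X'"

lemma normal_pair_eq: assumes "normal_pair X X'" "x \<in> carrier H" shows "nm (X' x) = nm (X x)"
proof -
  have a: "adj X X'" "com X X'" "bop X" "bop X'" using assms by (auto simp: normal_pair_def dest: adjD)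
  have "ip (X' x) (X' x) = ip x (X (X' x))" using a assms by (simp add: adjD' bop_cl)
  also have "\<dots> = ip x (X' (X x))" by (simp add: comD[OF a(2) assms(2)])
  also have "\<dots> = ip (X x) (X x)" using a assms by (simp add: adjD bop_cl)
  finally have "(nm (X' x))\<^sup>2 = (nm (X x))\<^sup>2" using a assms by (simp add: nm_sq bop_cl)
  then show ?thesis by (rule power2_eq_imp_eq) (use a assms(2) in \<open>auto simp: bop_cl\<close>)
qed

lemma normal_pair_sym: "normal_pair X X' \<Longrightarrow> normal_pair X' X"
  by (auto simp: normal_pair_def adj_sym com_sym)

end

section \<open>Fuglede's theorem\<close>

context pre_hilbert
begin

lemma funpow_bound:
  assumes X: "bop X" and C: "\<And>x. x \<in> carrier H \<Longrightarrow> nm (X x) \<le> C * nm x" "C \<ge> 0"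
    and x: "x \<in> carrier H"
  shows "nm ((X ^^ m) x) \<le> C ^ m * nm x"
proof (induction m)
  case (Suc m)
  have "nm (X ((X ^^ m) x)) \<le> C * nm ((X ^^ m) x)" using X x by (intro C bop_cl[OF bop_funpow])
  also have "\<dots> \<le> C * (C ^ m * nm x)" using Suc C by (intro mult_left_mono)
  finally show ?case by simp
qed auto

text \<open>
  If one application of \<open>X\<close> moves vectors by a relative error \<open>d\<close>, then \<open>m\<close> applications move them by
  \<open>(1 + d)\<^sup>m - 1\<close>. With \<open>d\<close> of order \<open>1 / m\<^sup>2\<close> this tends to \<open>0\<close>.
\<close>
lemma funpow_near_identity:
  assumes X: "bop X" and d: "\<And>x. x \<in> carrier H \<Longrightarrow> nm (x \<ominus> X x) \<le> d * nm x" "d \<ge> 0"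
    and x: "x \<in> carrier H"
  shows "nm ((X ^^ m) x) \<le> (1 + d) ^ m * nm x" "nm (x \<ominus> (X ^^ m) x) \<le> ((1 + d) ^ m - 1) * nm x"
proof -
  have c: "(X ^^ m) x \<in> carrier H" for m using X x by (intro bop_cl[OF bop_funpow])
  show *: "nm ((X ^^ m) x) \<le> (1 + d) ^ m * nm x" for m
  proof (rule funpow_bound[OF X])
    fix y assume y: "y \<in> carrier H"
    have "nm (X y) \<le> nm (X y \<ominus> y) + nm y" using y X by (intro nm_le_add_minus) (simp_all add: bop_cl)
    also have "nm (X y \<ominus> y) = nm (y \<ominus> X y)" using y X by (intro nm_minus_sym) (simp_all add: bop_cl)
    finally show "nm (X y) \<le> (1 + d) * nm y" using d(1)[OF y] by (simp add: algebra_simps)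
  qed (use d x in auto)
  show "nm (x \<ominus> (X ^^ m) x) \<le> ((1 + d) ^ m - 1) * nm x"
  proof (induction m)
    case 0
    then show ?case using x by (simp add: a_minus_def r_neg)
  next
    case (Suc m)
    have "nm (x \<ominus> X ((X ^^ m) x)) \<le> nm (x \<ominus> (X ^^ m) x) + nm ((X ^^ m) x \<ominus> X ((X ^^ m) x))"
      using x X c by (intro nm_triangle3) (auto simp: bop_cl)
    also have "\<dots> \<le> ((1 + d) ^ m - 1) * nm x + d * ((1 + d) ^ m * nm x)"
      by (intro add_mono Suc order_trans[OF d(1)[OF c]] mult_left_mono * d(2))
    finally show ?case by (simp add: algebra_simps)
  qed
qed

lemma funpow_comp:
  assumes "bop X" "bop Y" "com X Y" "x \<in> carrier H"
  shows "(X ^^ m) ((Y ^^ m) x) = ((\<lambda>x. X (Y x)) ^^ m) x"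
proof (induction m)
  case (Suc m)
  have *: "(X ^^ m) (Y z) = Y ((X ^^ m) z)" if "z \<in> carrier H" for z
    using com_funpow[of Y X m] assms that by (simp add: com_def)
  have "(Y ^^ m) x \<in> carrier H" using assms by (intro bop_cl[OF bop_funpow])
  then show ?case using Suc by (simp add: *)
qed auto

text \<open>
  For large \<open>m\<close> the power \<open>(1 + (c / m) N)\<^sup>m\<close> is a substitute for \<open>exp (c N)\<close> that is a polynomial in \<open>N\<close>.
  Rosenblum's proof of Fuglede's theorem goes through with it, without convergent operator series.
\<close>
definition shear :: "('a \<Rightarrow> 'a) \<Rightarrow> complex \<Rightarrow> 'a \<Rightarrow> 'a" where
  "shear N c x = x \<oplus> c \<odot> N x"

lemma shear_alt: "shear N c = (\<lambda>x. x \<oplus> c \<odot> N x)"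
  by (auto simp: shear_def)

lemma bop_shear: "bop N \<Longrightarrow> bop (shear N c)"
  unfolding shear_alt by (rule bop_add_op[OF bop_id bop_smult_op])

lemma adj_shear: "adj N N' \<Longrightarrow> adj (shear N c) (shear N' (cnj c))"
  unfolding shear_alt by (rule adj_add[OF adj_id adj_smult])

lemma com_shear: "bop X \<Longrightarrow> bop N \<Longrightarrow> com X N \<Longrightarrow> com X (shear N c)"
  unfolding shear_alt by (rule com_add[OF _ bop_id bop_smult_op com_id com_smult])

lemma com_shear2:
  assumes "bop M" "bop N" "com M N" shows "com (shear M c) (shear N d)"
  using assms by (metis bop_shear com_shear com_sym)

lemma shear_0: "bop N \<Longrightarrow> x \<in> carrier H \<Longrightarrow> shear N 0 x = x"
  by (simp add: shear_def zero_smult bop_cl)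

lemma shear_0_funpow: "bop N \<Longrightarrow> x \<in> carrier H \<Longrightarrow> (shear N 0 ^^ k) x = x"
  by (induction k) (auto simp: shear_0)

lemma normal_pair_shear_funpow:
  assumes "normal_pair N N'" shows "normal_pair (shear N c ^^ m) (shear N' (cnj c) ^^ m)"
proof -
  have a: "adj N N'" "bop N" "bop N'" "com N N'" using assms by (auto simp: normal_pair_def dest: adjD)
  have "com (shear N c) (shear N' (cnj c))" using a by (intro com_shear2)
  then have "com (shear N c ^^ m) (shear N' (cnj c) ^^ m)"
    using a by (meson bop_funpow bop_shear com_funpow com_sym)
  with a show ?thesis by (auto simp: normal_pair_def intro: adj_funpow adj_shear)
qed

text \<open>
  The function \<open>\<lambda> \<mapsto> \<langle>S (1 - \<lambda>tN')\<^sup>k x, (1 + cnj(\<lambda>t)N)\<^sup>j y\<rangle>\<close> is a polynomial. For \<open>k = j = m\<close> and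
  \<open>t = 1 / m\<close>, and with \<open>N'\<close> the adjoint of \<open>N\<close>, its derivative at \<open>0\<close> is the matrix entry of the commutator \<open>N'S - SN'\<close>. The recursion in \<open>k\<close>
  and \<open>j\<close> peels off one factor at a time.
\<close>
lemma shear_pairing_derivative:
  fixes t :: complex
  assumes N: "bop N" and N': "bop N'" and S: "bop S"
  shows "x \<in> carrier H \<Longrightarrow> y \<in> carrier H \<Longrightarrow>
    \<exists>f'. (\<forall>l. ((\<lambda>l. ip (S ((shear N' (- (l * t)) ^^ k) x)) ((shear N (cnj (l * t)) ^^ j) y))
                 has_field_derivative f' l) (at l)) \<and>
      f' 0 = t * (of_nat j * ip (S x) (N y) - of_nat k * ip (S (N' x)) y)"
proof (induction k arbitrary: x)
  case 0
  then show ?case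
  proof (induction j arbitrary: y)
    case 0
    then show ?case by (auto intro!: exI[of _ "\<lambda>_. 0"])
  next
    case (Suc j)
    define P where "P = (\<lambda>y l. ip (S ((shear N' (- (l * t)) ^^ 0) x)) ((shear N (cnj (l * t)) ^^ j) y))"
    have Ny: "N y \<in> carrier H" using N Suc.prems by (simp add: bop_cl)
    obtain f1 where f1: "\<And>l. (P y has_field_derivative f1 l) (at l)"
        "f1 0 = t * (of_nat j * ip (S x) (N y))"
      using Suc.IH[OF Suc.prems] unfolding P_def by auto
    obtain f2 where f2: "\<And>l. (P (N y) has_field_derivative f2 l) (at l)"
      using Suc.IH[OF Suc.prems(1) Ny] unfolding P_def by auto
    have eq: "(\<lambda>l. ip (S ((shear N' (- (l * t)) ^^ 0) x)) ((shear N (cnj (l * t)) ^^ Suc j) y))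
        = (\<lambda>l. P y l + l * t * P (N y) l)"
    proof
      fix l
      have b: "bop (shear N (cnj (l * t)) ^^ j)" by (intro bop_funpow bop_shear N)
      have "(shear N (cnj (l * t)) ^^ Suc j) y = (shear N (cnj (l * t)) ^^ j) (shear N (cnj (l * t)) y)"
        by (simp add: funpow_swap1)
      also have "\<dots> = (shear N (cnj (l * t)) ^^ j) y \<oplus> cnj (l * t) \<odot> (shear N (cnj (l * t)) ^^ j) (N y)"
        using Suc.prems Ny by (simp only: shear_def[of N "cnj (l * t)" y] bop_add[OF b] bop_smult[OF b] smc)
      finally show "ip (S ((shear N' (- (l * t)) ^^ 0) x)) ((shear N (cnj (l * t)) ^^ Suc j) y)
          = P y l + l * t * P (N y) l"
        using Suc.prems Ny
        by (simp only: ip_simps smc bop_cl[OF b] bop_cl[OF S] funpow_0 P_def complex_cnj_cnj)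
    qed
    have P0: "P (N y) 0 = ip (S x) (N y)" using Ny by (simp add: P_def shear_0_funpow N)
    have "((\<lambda>l. P y l + l * t * P (N y) l) has_field_derivative
        (f1 l + (t * P (N y) l + l * t * f2 l))) (at l)" for l
      by (auto intro!: derivative_eq_intros f1(1) f2)
    then show ?case
      unfolding eq
      by (intro exI[of _ "\<lambda>l. f1 l + (t * P (N y) l + l * t * f2 l)"])
        (auto simp: f1(2) P0 algebra_simps)
  qed
next
  case (Suc k)
  define P where "P = (\<lambda>x l. ip (S ((shear N' (- (l * t)) ^^ k) x)) ((shear N (cnj (l * t)) ^^ j) y))"
  have Nx: "N' x \<in> carrier H" using N' Suc.prems by (simp add: bop_cl)
  obtain f1 where f1: "\<And>l. (P x has_field_derivative f1 l) (at l)"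
      "f1 0 = t * (of_nat j * ip (S x) (N y) - of_nat k * ip (S (N' x)) y)"
    using Suc.IH[OF Suc.prems] unfolding P_def by auto
  obtain f2 where f2: "\<And>l. (P (N' x) has_field_derivative f2 l) (at l)"
    using Suc.IH[OF Nx Suc.prems(2)] unfolding P_def by auto
  have eq: "(\<lambda>l. ip (S ((shear N' (- (l * t)) ^^ Suc k) x)) ((shear N (cnj (l * t)) ^^ j) y))
      = (\<lambda>l. P x l - l * t * P (N' x) l)"
  proof
    fix l
    have b: "bop (shear N' (- (l * t)) ^^ k)" by (intro bop_funpow bop_shear N')
    have b2: "(shear N (cnj (l * t)) ^^ j) y \<in> carrier H"
      by (rule bop_cl[OF bop_funpow[OF bop_shear[OF N]] Suc.prems(2)])
    have "(shear N' (- (l * t)) ^^ Suc k) x = (shear N' (- (l * t)) ^^ k) (shear N' (- (l * t)) x)"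
      by (simp add: funpow_swap1)
    also have "\<dots> = (shear N' (- (l * t)) ^^ k) x \<oplus> (- (l * t)) \<odot> (shear N' (- (l * t)) ^^ k) (N' x)"
      using Suc.prems Nx by (simp only: shear_def[of N' "- (l * t)" x] bop_add[OF b] bop_smult[OF b] smc)
    finally show "ip (S ((shear N' (- (l * t)) ^^ Suc k) x)) ((shear N (cnj (l * t)) ^^ j) y)
        = P x l - l * t * P (N' x) l"
      using Suc.prems Nx b2
      by (simp only: bop_add[OF S] bop_smult[OF S] ip_simps smc bop_cl[OF b] bop_cl[OF S] P_def)
        (simp only: mult_minus_left add_uminus_conv_diff)
  qed
  have P0: "P (N' x) 0 = ip (S (N' x)) y" using Nx Suc.prems by (simp add: P_def shear_0_funpow N N')
  have "((\<lambda>l. P x l - l * t * P (N' x) l) has_field_derivative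
      (f1 l - (t * P (N' x) l + l * t * f2 l))) (at l)" for l
    by (auto intro!: derivative_eq_intros f1(1) f2)
  then show ?case
    unfolding eq
    by (intro exI[of _ "\<lambda>l. f1 l - (t * P (N' x) l + l * t * f2 l)"])
      (auto simp: f1(2) P0 algebra_simps)
qed

text \<open>
  The factor \<open>(1 - \<mu>N)\<^sup>m (1 + \<mu>N)\<^sup>m\<close> is close to the identity and can be inserted between \<open>S\<close> and
  \<open>(1 - cnj(\<mu>)N')\<^sup>m\<close>. Because \<open>S\<close> commutes with \<open>N\<close>, half of it moves to the other side of the pairing.
  Both arguments are then hit by \<open>(1 - cnj(\<mu>)N')\<^sup>m (1 + \<mu>N)\<^sup>m\<close>, which is nearly isometric as \<open>N\<close> is normal: it
  plays the part of the unitary \<open>exp (\<mu>N - cnj(\<mu>)N')\<close>.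
\<close>
lemma shear_pairing_bound:
  fixes \<mu> :: complex
  assumes NN: "normal_pair N N'" and S: "bop S" and SN: "com S N"
    and k: "\<And>x. x \<in> carrier H \<Longrightarrow> nm (N x) \<le> \<kappa> * nm x" "\<kappa> \<ge> 0"
    and Cs: "\<And>x. x \<in> carrier H \<Longrightarrow> nm (S x) \<le> Cs * nm x" "Cs \<ge> 0"
    and x: "x \<in> carrier H" and y: "y \<in> carrier H"
  defines "d \<equiv> (cmod \<mu> * \<kappa>)\<^sup>2"
  shows "cmod (ip (S ((shear N' (- cnj \<mu>) ^^ m) x)) ((shear N \<mu> ^^ m) y))
    \<le> Cs * nm x * nm y * (((1 + d) ^ m)\<^sup>2 + ((1 + d) ^ m - 1) * ((1 + cmod \<mu> * \<kappa>) ^ m)\<^sup>2)"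
proof -
  have a: "adj N N'" "bop N" "bop N'" "com N N'" using NN by (auto simp: normal_pair_def dest: adjD)
  have k': "nm (N' x) \<le> \<kappa> * nm x" if "x \<in> carrier H" for x
    using k(1)[OF that] normal_pair_eq[OF NN that] by simp
  define D where "D = shear N \<mu> ^^ m"
  define E where "E = shear N (- \<mu>) ^^ m"
  define D' where "D' = shear N' (- cnj \<mu>) ^^ m"
  have b: "bop D" "bop E" "bop D'" unfolding D_def E_def D'_def using a by (auto intro!: bop_funpow bop_shear)
  have d0: "d \<ge> 0" by (simp add: d_def)
  have nE: "normal_pair E D'" unfolding E_def D'_def using normal_pair_shear_funpow[OF NN, where c="- \<mu>" and m=m] by simp
  have sb: "nm (shear M c x) \<le> (1 + cmod c * \<kappa>) * nm x"
    if "bop M" "\<And>x. x \<in> carrier H \<Longrightarrow> nm (M x) \<le> \<kappa> * nm x" "x \<in> carrier H" for M c x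
  proof -
    have "nm (shear M c x) \<le> nm x + cmod c * nm (M x)"
      unfolding shear_def using that nm_triangle[of x "c \<odot> M x"] by (simp add: bop_cl nm_smult)
    also have "\<dots> \<le> nm x + cmod c * (\<kappa> * nm x)" using that by (intro add_left_mono mult_left_mono) auto
    finally show ?thesis by (simp add: algebra_simps)
  qed
  have Db: "nm (D y) \<le> (1 + cmod \<mu> * \<kappa>) ^ m * nm y"
    unfolding D_def using a k y by (intro funpow_bound bop_shear sb) auto
  have D'b: "nm (D' x) \<le> (1 + cmod \<mu> * \<kappa>) ^ m * nm x"
    unfolding D'_def using a k y x sb[OF a(3) k', of _ "- cnj \<mu>"] by (intro funpow_bound bop_shear) auto
  let ?F = "\<lambda>z. shear N (- \<mu>) (shear N \<mu> z)"
  have bF: "bop ?F" by (rule bop_comp[OF bop_shear[OF a(2)] bop_shear[OF a(2)]])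
  have ED: "E (D z) = (?F ^^ m) z" if "z \<in> carrier H" for z
    unfolding E_def D_def using a that by (intro funpow_comp bop_shear com_shear2) (auto simp: com_refl)
  have F1: "nm (z \<ominus> ?F z) \<le> d * nm z" if z: "z \<in> carrier H" for z
  proof -
    have "z \<ominus> ?F z = (\<mu>\<^sup>2) \<odot> N (N z)"
      using z a by (intro ip_ext)
        (auto simp: shear_def ip_simps bop_cl bop_add bop_smult algebra_simps power2_eq_square)
    then have "nm (z \<ominus> ?F z) = (cmod \<mu>)\<^sup>2 * nm (N (N z))" using z a by (simp add: nm_smult bop_cl norm_power)
    also have "\<dots> \<le> (cmod \<mu>)\<^sup>2 * (\<kappa> * (\<kappa> * nm z))"
      using order_trans[OF k(1)[OF bop_cl[OF a(2) z]] mult_left_mono[OF k(1)[OF z] k(2)]]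
      by (intro mult_left_mono) auto
    finally show ?thesis by (simp add: d_def power2_eq_square algebra_simps)
  qed
  have ED1: "nm (E (D z)) \<le> (1 + d) ^ m * nm z" if "z \<in> carrier H" for z
    using funpow_near_identity(1)[OF bF F1 d0 that, of m] ED[OF that] by simp
  have ED2: "nm (z \<ominus> E (D z)) \<le> ((1 + d) ^ m - 1) * nm z" if "z \<in> carrier H" for z
    using funpow_near_identity(2)[OF bF F1 d0 that, of m] ED[OF that] by simp
  have cDD': "com D D'" unfolding D_def D'_def
    using a by (meson bop_funpow bop_shear com_funpow com_sym com_shear2)
  have cSE: "com S E" unfolding E_def using a S SN by (intro com_funpow com_shear bop_shear)
  have D'D: "nm (D' (D z)) \<le> (1 + d) ^ m * nm z" if "z \<in> carrier H" for z
    using normal_pair_eq[OF nE bop_cl[OF b(1) that]] ED1[OF that] by simp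
  have DD'x: "nm (D (D' x)) \<le> (1 + d) ^ m * nm x"
    using D'D[OF x] comD[OF cDD' x] by simp
  have cl: "D' x \<in> carrier H" "D y \<in> carrier H" "D (D' x) \<in> carrier H" "E (D (D' x)) \<in> carrier H"
    "D' (D y) \<in> carrier H" "S (D (D' x)) \<in> carrier H"
    using b S x y by (auto simp: bop_cl)
  have "D' x = (D' x \<ominus> E (D (D' x))) \<oplus> E (D (D' x))" using cl by (intro ip_ext) (auto simp: ip_simps)
  then have "ip (S (D' x)) (D y) = ip (S ((D' x \<ominus> E (D (D' x))) \<oplus> E (D (D' x)))) (D y)" by simp
  also have "\<dots> = ip (S (D' x \<ominus> E (D (D' x)))) (D y) + ip (S (E (D (D' x)))) (D y)"
    using cl S by (simp add: bop_add bop_cl ip_simps)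
  also have "ip (S (E (D (D' x)))) (D y) = ip (S (D (D' x))) (D' (D y))"
    using comD[OF cSE cl(3)] adjD(3)[of E D' "S (D (D' x))" "D y"] nE cl by (simp add: normal_pair_def)
  finally have "cmod (ip (S (D' x)) (D y))
      \<le> cmod (ip (S (D' x \<ominus> E (D (D' x)))) (D y)) + cmod (ip (S (D (D' x))) (D' (D y)))"
    by (simp add: norm_triangle_ineq)
  also have "\<dots> \<le> nm (S (D' x \<ominus> E (D (D' x)))) * nm (D y) + nm (S (D (D' x))) * nm (D' (D y))"
    using cl S by (intro add_mono cauchy_schwarz) (auto simp: bop_cl)
  also have "\<dots> \<le> (Cs * (((1 + d) ^ m - 1) * ((1 + cmod \<mu> * \<kappa>) ^ m * nm x))) * ((1 + cmod \<mu> * \<kappa>) ^ m * nm y)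
      + (Cs * ((1 + d) ^ m * nm x)) * ((1 + d) ^ m * nm y)"
    using cl S x y d0 Cs k
    by (intro add_mono mult_mono Db D'b D'D order_trans[OF Cs(1)] DD'x order_trans[OF ED2]) auto
  also have "\<dots> = Cs * nm x * nm y * (((1 + d) ^ m)\<^sup>2 + ((1 + d) ^ m - 1) * ((1 + cmod \<mu> * \<kappa>) ^ m)\<^sup>2)"
    by (simp add: algebra_simps power2_eq_square)
  finally show ?thesis unfolding D_def D'_def .
qed

text \<open>
  The pairing of the previous lemmas stays bounded on a circle of radius \<open>R\<close>, uniformly in \<open>R\<close> once \<open>m\<close> is
  large enough. Cauchy's inequality bounds its derivative at \<open>0\<close> by a multiple of \<open>1 / R\<close>, and this
  derivative, a matrix entry of the commutator, depends neither on \<open>m\<close> nor on \<open>R\<close>.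
\<close>
theorem fuglede:
  assumes NN: "normal_pair N N'" and S: "bop S" and SN: "com S N"
  shows "com S N'"
  unfolding com_def
proof
  fix x assume x: "x \<in> carrier H"
  have a: "adj N N'" "bop N" "bop N'" "com N N'" using NN by (auto simp: normal_pair_def dest: adjD)
  obtain \<kappa> where k: "\<kappa> > 0" "\<And>x. x \<in> carrier H \<Longrightarrow> nm (N x) \<le> \<kappa> * nm x"
    using a(2) bop_bound by blast
  obtain Cs where Cs: "Cs > 0" "\<And>x. x \<in> carrier H \<Longrightarrow> nm (S x) \<le> Cs * nm x"
    using S bop_bound by blast
  show "S (N' x) = N' (S x)"
  proof (rule ip_ext)
    fix y assume y: "y \<in> carrier H"
    define \<Delta> where "\<Delta> = ip (S x) (N y) - ip (S (N' x)) y"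
    have bound: "cmod \<Delta> * R \<le> 2 * Cs * nm x * nm y" if R: "R > 0" for R
    proof -
      \<comment> \<open>The bound for the pairing on the circle of radius \<open>R\<close>; it tends to \<open>1\<close> as \<open>m\<close> grows.\<close>
      define h where "h = (\<lambda>m::nat. (exp (R\<^sup>2 * \<kappa>\<^sup>2 / real m))\<^sup>2 + (exp (R\<^sup>2 * \<kappa>\<^sup>2 / real m) - 1) * (exp (R * \<kappa>))\<^sup>2)"
      have "h \<longlonglongrightarrow> (exp 0)\<^sup>2 + (exp 0 - 1) * (exp (R * \<kappa>))\<^sup>2"
        unfolding h_def
        by (intro tendsto_intros tendsto_divide_0[OF tendsto_const] filterlim_real_sequentially
             filterlim_at_top_imp_at_infinity)
      then have "eventually (\<lambda>m. h m < 2) sequentially" by (intro order_tendstoD(2)) auto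
      then have "eventually (\<lambda>m. h m < 2 \<and> m > 0) sequentially"
        using eventually_gt_at_top[of 0] by (rule eventually_conj)
      then obtain m where m: "h m < 2" "m > 0" by (auto simp: eventually_sequentially)
      define g where "g = (\<lambda>l. ip (S ((shear N' (- (l * (1 / of_nat m))) ^^ m) x))
         ((shear N (cnj (l * (1 / of_nat m))) ^^ m) y))"
      obtain g' where g': "\<And>l. (g has_field_derivative g' l) (at l)" "g' 0 = \<Delta>"
        using shear_pairing_derivative[OF a(2,3) S x y, where t="1 / of_nat m" and k=m and j=m] m
        unfolding g_def \<Delta>_def
        by (metis (no_types, lifting) divide_self_if left_diff_distrib' mult.assoc mult.left_neutral
            of_nat_eq_0_iff order_less_irrefl right_diff_distrib' times_divide_eq_left)
      have "g holomorphic_on A" for A using g'(1)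
        by (meson DERIV_subset field_differentiable_def holomorphic_onI field_differentiable_at_within)
      moreover have "cmod (g l) \<le> Cs * nm x * nm y * 2" if l: "cmod (0 - l) = R" for l
      proof -
        define \<mu> where "\<mu> = cnj (l * (1 / of_nat m))"
        have cm: "cmod \<mu> = R / m" using l m by (simp add: \<mu>_def norm_divide)
        define d where "d = (cmod \<mu> * \<kappa>)\<^sup>2"
        have e1: "(1 + d) ^ m \<le> exp (R\<^sup>2 * \<kappa>\<^sup>2 / real m)"
        proof -
          have "(1 + d) ^ m \<le> exp d ^ m" by (intro power_mono exp_ge_add_one_self) (simp add: d_def)
          also have "\<dots> = exp (R\<^sup>2 * \<kappa>\<^sup>2 / real m)"
            using m by (simp add: d_def cm exp_of_nat_mult [symmetric] power2_eq_square field_simps)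
          finally show ?thesis .
        qed
        have e2: "(1 + cmod \<mu> * \<kappa>) ^ m \<le> exp (R * \<kappa>)"
        proof -
          have "(1 + cmod \<mu> * \<kappa>) ^ m \<le> exp (cmod \<mu> * \<kappa>) ^ m"
            using k by (intro power_mono exp_ge_add_one_self) simp
          also have "\<dots> = exp (R * \<kappa>)"
            using m by (simp add: cm exp_of_nat_mult [symmetric] field_simps)
          finally show ?thesis .
        qed
        have d1: "1 \<le> (1 + d) ^ m" by (intro one_le_power) (simp add: d_def)
        have p0: "0 \<le> (1 + cmod \<mu> * \<kappa>) ^ m" using k by simp
        have "cmod (g l) \<le> Cs * nm x * nm y * (((1 + d) ^ m)\<^sup>2 + ((1 + d) ^ m - 1) * ((1 + cmod \<mu> * \<kappa>) ^ m)\<^sup>2)"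
          using shear_pairing_bound[OF NN S SN k(2) _ Cs(2) _ x y, where \<mu>=\<mu> and m=m] k Cs
          unfolding g_def d_def \<mu>_def by simp
        also have "\<dots> \<le> Cs * nm x * nm y * h m"
          unfolding h_def using Cs x y d1 e1 e2 p0
          by (intro mult_left_mono add_mono mult_mono power_mono) auto
        also have "\<dots> \<le> Cs * nm x * nm y * 2" using m Cs x y by (intro mult_left_mono) auto
        finally show ?thesis .
      qed
      ultimately have "norm ((deriv ^^ 1) g 0) \<le> fact 1 * (Cs * nm x * nm y * 2) / R ^ 1"
        by (intro Cauchy_inequality) (use R in \<open>auto intro: holomorphic_on_imp_continuous_on\<close>)
      moreover have "deriv g 0 = \<Delta>" using g' DERIV_imp_deriv by metis
      ultimately show ?thesis using R by (simp add: field_simps)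
    qed
    have "\<Delta> = 0"
    proof (rule ccontr)
      assume n: "\<Delta> \<noteq> 0"
      define R where "R = (2 * Cs * nm x * nm y + 1) / cmod \<Delta>"
      have "2 * Cs * nm x * nm y \<ge> 0" using Cs x y by simp
      then have "R > 0" using n by (simp add: R_def)
      from bound[OF this] show False using n by (simp add: R_def)
    qed
    then show "ip (S (N' x)) y = ip (N' (S x)) y"
      using a x y S by (simp add: \<Delta>_def adjD'[OF a(1), symmetric] bop_cl)
  qed (use a x S in \<open>auto simp: bop_cl\<close>)
qed

end

section \<open>Joint approximate eigenvectors\<close>

context pre_hilbert
begin

text \<open>
  The operators in \<open>Ys\<close> have common approximate null vectors. For \<open>Ys = {N\<^sub>1 - w\<^sub>1, ..., N\<^sub>r - w\<^sub>r}\<close> this says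
  that \<open>w\<close> is a joint approximate eigenvalue of \<open>N\<^sub>1, ..., N\<^sub>r\<close>.
\<close>
definition approx_kernel :: "('a \<Rightarrow> 'a) set \<Rightarrow> bool" where
  "approx_kernel Ys \<longleftrightarrow> (\<forall>e>0. \<exists>x\<in>carrier H. nm x = 1 \<and> (\<forall>Y\<in>Ys. nm (Y x) \<le> e))"

lemma approx_kernel_insertE:
  assumes "approx_kernel (insert Z Ys)" "e > 0"
  obtains x where "x \<in> carrier H" "nm x = 1" "nm (Z x) \<le> e" "\<And>Y. Y \<in> Ys \<Longrightarrow> nm (Y x) \<le> e"
  using assms(1)[unfolded approx_kernel_def, rule_format, OF assms(2)] by (metis insertCI)

lemma approx_kernel_insertI:
  assumes "\<And>e. e > 0 \<Longrightarrow> \<exists>x\<in>carrier H. nm x = 1 \<and> nm (Z x) \<le> e \<and> (\<forall>Y\<in>Ys. nm (Y x) \<le> e)"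
  shows "approx_kernel (insert Z Ys)"
  using assms unfolding approx_kernel_def by simp

lemma approx_kernel_iff_sum:
  assumes fin: "finite Ys" and b: "\<And>Y. Y \<in> Ys \<Longrightarrow> bop Y"
  shows "approx_kernel Ys \<longleftrightarrow> (\<forall>e>0. \<exists>x\<in>carrier H. nm x = 1 \<and> (\<Sum>Y\<in>Ys. (nm (Y x))\<^sup>2) \<le> e)"
proof
  assume j: "approx_kernel Ys"
  show "\<forall>e>0. \<exists>x\<in>carrier H. nm x = 1 \<and> (\<Sum>Y\<in>Ys. (nm (Y x))\<^sup>2) \<le> e"
  proof (intro allI impI)
    fix e :: real assume e: "e > 0"
    define e' where "e' = sqrt (e / (card Ys + 1))"
    have "e' > 0" using e by (simp add: e'_def)
    then obtain x where x: "x \<in> carrier H" "nm x = 1" "\<And>Y. Y \<in> Ys \<Longrightarrow> nm (Y x) \<le> e'"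
      using j by (auto simp: approx_kernel_def)
    have "(\<Sum>Y\<in>Ys. (nm (Y x))\<^sup>2) \<le> (\<Sum>Y\<in>Ys. e'\<^sup>2)"
      using x b by (intro sum_mono power_mono) (auto simp: bop_cl)
    also have "\<dots> \<le> e" using e by (simp add: e'_def field_simps)
    finally show "\<exists>x\<in>carrier H. nm x = 1 \<and> (\<Sum>Y\<in>Ys. (nm (Y x))\<^sup>2) \<le> e" using x by blast
  qed
next
  assume s: "\<forall>e>0. \<exists>x\<in>carrier H. nm x = 1 \<and> (\<Sum>Y\<in>Ys. (nm (Y x))\<^sup>2) \<le> e"
  show "approx_kernel Ys"
    unfolding approx_kernel_def
  proof (intro allI impI)
    fix e :: real assume e: "e > 0"
    then have "e\<^sup>2 > 0" by simp
    with s obtain x where x: "x \<in> carrier H" "nm x = 1" "(\<Sum>Y\<in>Ys. (nm (Y x))\<^sup>2) \<le> e\<^sup>2" by blast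
    have "nm (Y x) \<le> e" if Y: "Y \<in> Ys" for Y
    proof (rule power2_le_imp_le)
      have "(nm (Y x))\<^sup>2 \<le> (\<Sum>Y\<in>Ys. (nm (Y x))\<^sup>2)" using Y fin by (intro member_le_sum) auto
      then show "(nm (Y x))\<^sup>2 \<le> e\<^sup>2" using x(3) by simp
    qed (use e in simp)
    then show "\<exists>x\<in>carrier H. nm x = 1 \<and> (\<forall>Y\<in>Ys. nm (Y x) \<le> e)" using x by blast
  qed
qed

lemma normalize_vector:
  assumes "x \<in> carrier H" "nm x > 0"
  obtains y where "y \<in> carrier H" "nm y = 1" "\<And>Y. bop Y \<Longrightarrow> nm (Y y) = nm (Y x) / nm x"
proof (rule that[of "complex_of_real (1 / nm x) \<odot> x"])
  fix Y assume "bop Y"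
  then show "nm (Y (complex_of_real (1 / nm x) \<odot> x)) = nm (Y x) / nm x"
    using assms by (simp add: bop_smult nm_smult bop_cl norm_divide)
qed (use assms in \<open>auto simp: nm_smult norm_divide\<close>)

text \<open>
  On approximate common null vectors of \<open>Ys\<close> the operator \<open>A\<close> has a well-defined asymptotic norm \<open>\<alpha>\<close>. Vectors that
  nearly attain it are approximate eigenvectors of \<open>A\<^sup>2\<close> for \<open>\<alpha>\<^sup>2\<close>, exactly as for the norm of a self-adjoint
  operator on the whole space: \<open>\<parallel>A\<^sup>2x - \<alpha>\<^sup>2x\<parallel>\<^sup>2 = \<parallel>A\<^sup>2x\<parallel>\<^sup>2 - 2\<alpha>\<^sup>2\<parallel>Ax\<parallel>\<^sup>2 + \<alpha>\<^sup>4\<close> is small because \<open>\<parallel>A\<^sup>2x\<parallel>\<close> is at most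
  about \<open>\<alpha>\<parallel>Ax\<parallel>\<close>. For the last estimate \<open>Ax\<close> must again be nearly annihilated by \<open>Ys\<close>, which is why \<open>A\<close> has to
  commute with \<open>Ys\<close>.
\<close>
lemma approximate_square_eigenvalue:
  assumes fin: "finite Ys" and b: "\<And>Y. Y \<in> Ys \<Longrightarrow> bop Y" and c: "\<And>Y. Y \<in> Ys \<Longrightarrow> com A Y"
    and A: "adj A A" and js: "approx_kernel Ys"
  obtains \<alpha> :: real where "\<alpha> \<ge> 0"
    "approx_kernel (insert (\<lambda>x. A (A x) \<ominus> complex_of_real (\<alpha>\<^sup>2) \<odot> x) Ys)"
proof -
  have bA: "bop A" using A adjD by blast
  obtain C where C: "C > 0" "\<And>x. x \<in> carrier H \<Longrightarrow> nm (A x) \<le> C * nm x" using bop_bound[OF bA] by blast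
  define r where "r = (\<lambda>x. \<Sum>Y\<in>Ys. (nm (Y x))\<^sup>2)"
  have r0: "r x \<ge> 0" for x by (simp add: r_def sum_nonneg)
  have rA: "r (A x) \<le> C\<^sup>2 * r x" if x: "x \<in> carrier H" for x
  proof -
    have "nm (Y (A x)) \<le> C * nm (Y x)" if Y: "Y \<in> Ys" for Y
      using comD[OF c[OF Y] x] C(2)[OF bop_cl[OF b[OF Y] x]] by simp
    then have "r (A x) \<le> (\<Sum>Y\<in>Ys. (C * nm (Y x))\<^sup>2)"
      unfolding r_def using bA b x by (intro sum_mono power_mono) (auto simp: bop_cl)
    then show ?thesis by (simp add: r_def power_mult_distrib sum_distrib_left)
  qed
  have js': "\<exists>x\<in>carrier H. nm x = 1 \<and> r x \<le> e" if "e > 0" for e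
    using js that approx_kernel_iff_sum[OF fin b] unfolding r_def by blast
  \<comment> \<open>The asymptotic square norm of \<open>A\<close> on approximate null vectors is the infimum of all \<open>g\<close> with \<open>A\<^sup>2 \<le> g + k r\<close> for some \<open>k\<close>.\<close>
  define G where "G = {g. \<exists>k\<ge>0. \<forall>x\<in>carrier H. (nm (A x))\<^sup>2 \<le> g * (nm x)\<^sup>2 + k * r x}"
  have CG: "C\<^sup>2 \<in> G"
    unfolding G_def using C by (auto intro!: exI[of _ 0] simp: power_mult_distrib[symmetric] bA bop_cl)
  have Gpos: "g \<ge> 0" if g: "g \<in> G" for g
  proof (rule ccontr)
    assume n: "\<not> g \<ge> 0"
    obtain k where k: "k \<ge> 0" "\<And>x. x \<in> carrier H \<Longrightarrow> (nm (A x))\<^sup>2 \<le> g * (nm x)\<^sup>2 + k * r x"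
      using g by (auto simp: G_def)
    obtain x where x: "x \<in> carrier H" "nm x = 1" "r x \<le> (- g) / (2 * (k + 1))"
      using js'[of "(- g) / (2 * (k + 1))"] n k by (auto simp: field_simps)
    have "k * r x \<le> (k + 1) * ((- g) / (2 * (k + 1)))"
      using k x r0 by (intro mult_mono) auto
    also have "\<dots> = - g / 2" using k by (simp add: field_simps)
    finally have "(nm (A x))\<^sup>2 \<le> g / 2" using k(2)[OF x(1)] x by simp
    then show False using n zero_le_power2[of "nm (A x)"] by linarith
  qed
  define \<beta> where "\<beta> = Inf G"
  have bdd: "bdd_below G" by (rule bdd_belowI[of _ 0]) (rule Gpos)
  have \<beta>0: "\<beta> \<ge> 0" unfolding \<beta>_def using CG Gpos by (intro cInf_greatest) auto
  have \<beta>C: "\<beta> \<le> C\<^sup>2" unfolding \<beta>_def using CG bdd by (rule cInf_lower)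
  have key: "\<exists>x\<in>carrier H. nm x = 1 \<and> r x + (nm (A (A x) \<ominus> complex_of_real \<beta> \<odot> x))\<^sup>2 \<le> e" if e: "e > 0" for e
  proof -
    define q where "q = C\<^sup>2 + \<beta> + 1"
    define e1 where "e1 = e / 3 / q"
    have den: "q > 0" using \<beta>0 by (simp add: q_def add_nonneg_pos)
    have e1: "e1 > 0" using e den by (simp add: e1_def)
    have e1': "e1 * C\<^sup>2 + \<beta> * e1 \<le> e / 3"
    proof -
      have "e1 * C\<^sup>2 + \<beta> * e1 \<le> e1 * q" using e1 by (simp add: q_def algebra_simps)
      also have "\<dots> = e / 3" using den by (simp add: e1_def)
      finally show ?thesis .
    qed
    obtain g where g: "g \<in> G" "g < \<beta> + e1"
      using cInf_lessD[of G "\<beta> + e1"] CG e1 by (auto simp: \<beta>_def)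
    then obtain k where k: "k \<ge> 0" "\<And>x. x \<in> carrier H \<Longrightarrow> (nm (A x))\<^sup>2 \<le> g * (nm x)\<^sup>2 + k * r x"
      by (auto simp: G_def)
    define p where "p = k * C\<^sup>2"
    have p0: "p \<ge> 0" using k by (simp add: p_def)
    define \<rho> where "\<rho> = e / 3 / (p + 1)"
    have "\<rho> > 0" "p * \<rho> \<le> e / 3" "\<rho> \<le> e / 3"
      using e p0 by (auto simp: \<rho>_def field_simps)
    then have \<rho>: "\<rho> > 0" "k * C\<^sup>2 * \<rho> \<le> e / 3" "\<rho> \<le> e / 3" by (auto simp: p_def)
    \<comment> \<open>As \<open>\<beta> - e1\<close> violates the bound for every factor of \<open>r\<close>, a large factor \<open>k'\<close> forces \<open>r x\<close> to be small.\<close>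
    define k' where "k' = (C\<^sup>2 + e1) / \<rho>"
    have k': "k' > 0" using \<rho> e1 by (simp add: k'_def add_nonneg_pos)
    have "\<beta> - e1 \<notin> G" using cInf_lower[OF _ bdd, of "\<beta> - e1"] e1 by (auto simp: \<beta>_def)
    then obtain x0 where x0: "x0 \<in> carrier H" "(nm (A x0))\<^sup>2 > (\<beta> - e1) * (nm x0)\<^sup>2 + k' * r x0"
      using k' by (auto simp: G_def not_le dest!: spec[of _ k'])
    have "nm x0 \<noteq> 0"
    proof
      assume "nm x0 = 0"
      then have "x0 = \<zero>" using nm_eq_0 x0 by blast
      then have "0 > k' * r x0" using x0 by (simp add: bop_zero bA)
      then show False using k' r0[of x0] by (simp add: mult_less_0_iff not_le[symmetric])
    qed
    then have "nm x0 > 0" using nm_nonneg[OF x0(1)] by linarith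
    then obtain x where x: "x \<in> carrier H" "nm x = 1" "\<And>Y. bop Y \<Longrightarrow> nm (Y x) = nm (Y x0) / nm x0"
      using normalize_vector[OF x0(1)] by blast
    have rx: "r x = r x0 / (nm x0)\<^sup>2"
      using x b by (simp add: r_def power_divide sum_divide_distrib)
    have lower: "(nm (A x))\<^sup>2 > (\<beta> - e1) + k' * r x"
      using divide_strict_right_mono[OF x0(2), of "(nm x0)\<^sup>2"] \<open>nm x0 > 0\<close>
      by (simp add: rx x(3)[OF bA] power_divide add_divide_distrib)
    have Ax: "(nm (A x))\<^sup>2 \<le> C\<^sup>2" using C(2)[OF x(1)] x(2) nm_nonneg[OF bop_cl[OF bA x(1)]]
      by (intro power_mono) auto
    have "k' * r x \<le> C\<^sup>2 + e1" using lower Ax \<beta>0 by linarith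
    also have "C\<^sup>2 + e1 = k' * \<rho>" using \<rho> by (simp add: k'_def)
    finally have rx': "r x \<le> \<rho>" using k' by (rule mult_left_le_imp_le)
    have AAx: "(nm (A (A x)))\<^sup>2 \<le> (\<beta> + e1) * (nm (A x))\<^sup>2 + k * (C\<^sup>2 * \<rho>)"
    proof -
      have "(nm (A (A x)))\<^sup>2 \<le> g * (nm (A x))\<^sup>2 + k * r (A x)" using x bA by (intro k) (simp add: bop_cl)
      also have "\<dots> \<le> (\<beta> + e1) * (nm (A x))\<^sup>2 + k * (C\<^sup>2 * \<rho>)"
        using g k rA[OF x(1)] rx' C
        by (intro add_mono mult_mono mult_right_mono mult_left_mono order_trans[OF rA[OF x(1)]]) (auto simp: r0)
      finally show ?thesis .
    qed
    have "(nm (A (A x) \<ominus> complex_of_real \<beta> \<odot> x))\<^sup>2 = (nm (A (A x)))\<^sup>2 - 2 * \<beta> * (nm (A x))\<^sup>2 + \<beta>\<^sup>2"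
    proof -
      have 1: "ip x (A (A x)) = of_real ((nm (A x))\<^sup>2)" "ip (A (A x)) x = of_real ((nm (A x))\<^sup>2)"
        using A bA x by (simp_all add: ip_self bop_cl adjD(3) adjD'[OF A] flip: of_real_power)
      have 2: "ip x x = 1" using x by (simp add: ip_self)
      have 3: "ip (A (A x)) (A (A x)) = of_real ((nm (A (A x)))\<^sup>2)" using x bA by (simp add: ip_self bop_cl)
      have "ip (A (A x) \<ominus> complex_of_real \<beta> \<odot> x) (A (A x) \<ominus> complex_of_real \<beta> \<odot> x)
        = of_real ((nm (A (A x)))\<^sup>2 - 2 * \<beta> * (nm (A x))\<^sup>2 + \<beta>\<^sup>2)"
        using x bA by (simp add: ip_simps bop_cl 1 2 3 power2_eq_square algebra_simps)
      then show ?thesis using x bA by (simp add: nm_sq bop_cl)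
    qed
    also have "\<dots> \<le> (\<beta> + e1) * (nm (A x))\<^sup>2 + k * (C\<^sup>2 * \<rho>) - 2 * \<beta> * (nm (A x))\<^sup>2 + \<beta>\<^sup>2"
      using AAx by simp
    also have "\<dots> = e1 * (nm (A x))\<^sup>2 - \<beta> * (nm (A x))\<^sup>2 + \<beta>\<^sup>2 + k * C\<^sup>2 * \<rho>"
      by (simp add: algebra_simps)
    also have "\<dots> \<le> e1 * C\<^sup>2 - \<beta> * (\<beta> - e1) + \<beta>\<^sup>2 + e / 3"
    proof -
      have "\<beta> - e1 \<le> (nm (A x))\<^sup>2" using lower k' r0[of x] mult_nonneg_nonneg[of k' "r x"] by linarith
      then have "\<beta> * (\<beta> - e1) \<le> \<beta> * (nm (A x))\<^sup>2" using \<beta>0 by (rule mult_left_mono)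
      moreover have "e1 * (nm (A x))\<^sup>2 \<le> e1 * C\<^sup>2" using Ax e1 by simp
      ultimately show ?thesis using \<rho> by linarith
    qed
    also have "\<dots> = e1 * C\<^sup>2 + \<beta> * e1 + e / 3" by (simp add: algebra_simps power2_eq_square)
    also have "\<dots> \<le> 2 * e / 3" using e1' by simp
    finally have "r x + (nm (A (A x) \<ominus> complex_of_real \<beta> \<odot> x))\<^sup>2 \<le> e" using rx' \<rho> by linarith
    then show ?thesis using x by blast
  qed
  show ?thesis
  proof (rule that[of "sqrt \<beta>"])
    have bZ: "bop (\<lambda>x. A (A x) \<ominus> complex_of_real \<beta> \<odot> x)"
      by (rule bop_shift[OF bop_comp[OF bA bA]])
    have "approx_kernel (insert (\<lambda>x. A (A x) \<ominus> complex_of_real \<beta> \<odot> x) Ys)"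
      unfolding approx_kernel_def
    proof (intro allI impI)
      fix e :: real assume e: "e > 0"
      then have "e\<^sup>2 > 0" by simp
      from key[OF this] obtain x where x: "x \<in> carrier H" "nm x = 1"
        "r x + (nm (A (A x) \<ominus> complex_of_real \<beta> \<odot> x))\<^sup>2 \<le> e\<^sup>2" by blast
      have "(nm (A (A x) \<ominus> complex_of_real \<beta> \<odot> x))\<^sup>2 \<le> e\<^sup>2" using x r0[of x] by linarith
      then have 1: "nm (A (A x) \<ominus> complex_of_real \<beta> \<odot> x) \<le> e" by (rule power2_le_imp_le) (use e in simp)
      have "nm (Y x) \<le> e" if Y: "Y \<in> Ys" for Y
      proof (rule power2_le_imp_le)
        have "(nm (Y x))\<^sup>2 \<le> r x" unfolding r_def using Y fin by (intro member_le_sum) auto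
        then show "(nm (Y x))\<^sup>2 \<le> e\<^sup>2" using x(3) zero_le_power2[of "nm (A (A x) \<ominus> complex_of_real \<beta> \<odot> x)"] by linarith
      qed (use e in simp)
      then show "\<exists>x\<in>carrier H. nm x = 1 \<and> (\<forall>Y\<in>insert (\<lambda>x. A (A x) \<ominus> complex_of_real \<beta> \<odot> x) Ys. nm (Y x) \<le> e)"
        using x 1 by blast
    qed
    then show "approx_kernel (insert (\<lambda>x. A (A x) \<ominus> complex_of_real ((sqrt \<beta>)\<^sup>2) \<odot> x) Ys)" using \<beta>0 by simp
  qed (use \<beta>0 in simp)
qed

text \<open>
  From \<open>(A - \<alpha>)(A + \<alpha>)x \<approx> 0\<close>: either \<open>(A + \<alpha>)x\<close> gets arbitrarily small, or it is a vector of size bounded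
  below that \<open>A - \<alpha>\<close> nearly annihilates.
\<close>
lemma self_adjoint_localize:
  assumes fin: "finite Ys" and b: "\<And>Y. Y \<in> Ys \<Longrightarrow> bop Y" and c: "\<And>Y. Y \<in> Ys \<Longrightarrow> com A Y"
    and A: "adj A A" and js: "approx_kernel Ys"
  obtains a :: real where "approx_kernel (insert (\<lambda>x. A x \<ominus> complex_of_real a \<odot> x) Ys)"
proof -
  have bA: "bop A" using A adjD by blast
  obtain \<alpha> where al: "approx_kernel (insert (\<lambda>x. A (A x) \<ominus> complex_of_real (\<alpha>\<^sup>2) \<odot> x) Ys)"
    using approximate_square_eigenvalue[OF assms] by blast
  let ?m = "complex_of_real (-\<alpha>)" and ?p = "complex_of_real \<alpha>"
  let ?M = "\<lambda>x. A x \<ominus> ?m \<odot> x" and ?P = "\<lambda>x. A x \<ominus> ?p \<odot> x"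
  have bM: "bop ?M" and bP: "bop ?P" by (rule bop_shift[OF bA])+
  show ?thesis
  proof (cases "approx_kernel (insert ?M Ys)")
    case True
    then show ?thesis by (rule that)
  next
    case False
    then obtain \<delta> where d: "\<delta> > 0" "\<And>x. x \<in> carrier H \<Longrightarrow> nm x = 1 \<Longrightarrow> \<exists>Y\<in>insert ?M Ys. nm (Y x) > \<delta>"
      unfolding approx_kernel_def by (meson not_le)
    obtain D where D: "D > 0" "\<And>x. x \<in> carrier H \<Longrightarrow> nm (?M x) \<le> D * nm x" using bop_bound[OF bM] by blast
    have "approx_kernel (insert ?P Ys)"
    proof (rule approx_kernel_insertI)
      fix e :: real assume e: "e > 0"
      \<comment> \<open>The bounds survive the application of \<open>A + \<alpha>\<close>, of norm at most \<open>D\<close>, and the division by a norm above \<open>\<delta>\<close>.\<close>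
      define e1 where "e1 = min \<delta> (min (e * \<delta>) (e * \<delta> / D))"
      have e1: "e1 > 0" "e1 \<le> \<delta>" "e1 \<le> e * \<delta>" "D * e1 \<le> e * \<delta>"
        using e d D by (auto simp: e1_def min_def field_simps)
      obtain x where x: "x \<in> carrier H" "nm x = 1"
        "nm (A (A x) \<ominus> complex_of_real (\<alpha>\<^sup>2) \<odot> x) \<le> e1" "\<And>Y. Y \<in> Ys \<Longrightarrow> nm (Y x) \<le> e1"
        using approx_kernel_insertE[OF al e1(1)] by blast
      have big: "nm (?M x) > \<delta>" using d(2)[OF x(1,2)] x(4) e1(2) by force
      define y where "y = ?M x"
      have y: "y \<in> carrier H" "nm y > \<delta>" using big x bM by (auto simp: y_def bA bop_cl)
      have Py: "nm (?P y) \<le> e1"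
      proof -
        have "?P y = A (A x) \<ominus> complex_of_real (\<alpha>\<^sup>2) \<odot> x"
          unfolding y_def using x bA
          by (intro ip_ext) (auto simp: ip_simps bop_cl bop_minus bop_smult algebra_simps power2_eq_square)
        then show ?thesis using x by simp
      qed
      have Yy: "nm (Y y) \<le> D * e1" if Y: "Y \<in> Ys" for Y
      proof -
        have "Y y = ?M (Y x)" unfolding y_def
          using x bA b[OF Y] comD[OF c[OF Y] x(1)] by (simp add: bop_minus bop_smult bop_cl)
        then have "nm (Y y) \<le> D * nm (Y x)" using D(2)[OF bop_cl[OF b[OF Y] x(1)]] by simp
        also have "\<dots> \<le> D * e1" using x(4)[OF Y] D by simp
        finally show ?thesis .
      qed
      have y0: "nm y > 0" using y d by linarith
      obtain z where z: "z \<in> carrier H" "nm z = 1" "\<And>Y. bop Y \<Longrightarrow> nm (Y z) = nm (Y y) / nm y"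
        using normalize_vector[OF y(1) y0] by blast
      have fin: "nm (Y z) \<le> e" if "nm (Y y) \<le> e * \<delta>" "bop Y" for Y
      proof -
        have "nm (Y y) \<le> e * nm y" using that(1) mult_left_mono[of \<delta> "nm y" e] y e by linarith
        then show ?thesis unfolding z(3)[OF that(2)] using y0 by (simp add: divide_le_eq)
      qed
      have "nm (?P z) \<le> e" by (rule fin[OF _ bP]) (use Py e1 in linarith)
      moreover have "nm (Y z) \<le> e" if "Y \<in> Ys" for Y
        by (rule fin[OF _ b[OF that]]) (use Yy[OF that] e1 in linarith)
      ultimately show "\<exists>x\<in>carrier H. nm x = 1 \<and> nm (?P x) \<le> e \<and> (\<forall>Y\<in>Ys. nm (Y x) \<le> e)"
        using z by blast
    qed
    then show ?thesis by (rule that)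
  qed
qed

text \<open>
  The real and imaginary parts of a normal operator are commuting self-adjoint operators, so the
  self-adjoint case applies to one after the other.
\<close>
lemma normal_localize:
  assumes fin: "finite Ys" and b: "\<And>Y. Y \<in> Ys \<Longrightarrow> bop Y"
    and c: "\<And>Y. Y \<in> Ys \<Longrightarrow> com N Y" "\<And>Y. Y \<in> Ys \<Longrightarrow> com N' Y"
    and NN: "normal_pair N N'" and js: "approx_kernel Ys"
  obtains w where "approx_kernel (insert (\<lambda>x. N x \<ominus> w \<odot> x) Ys)"
proof -
  have a: "adj N N'" "adj N' N" "bop N" "bop N'" "com N N'" "com N' N"
    using NN by (auto simp: normal_pair_def dest: adjD intro: adj_sym com_sym)
  define A where "A = (\<lambda>x. (1/2) \<odot> (N x \<oplus> N' x))"
  define B where "B = (\<lambda>x. (- \<i>/2) \<odot> (N x \<ominus> N' x))"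
  have A: "adj A A" unfolding A_def adj_def using a
    by (auto intro!: bop_smult_op bop_add_op simp: ip_simps bop_cl adjD(3)[OF a(1)] adjD(3)[OF a(2)] algebra_simps)
  have B: "adj B B" unfolding B_def adj_def using a
    by (auto intro!: bop_smult_op bop_minus_op simp: ip_simps bop_cl adjD(3)[OF a(1)] adjD(3)[OF a(2)] algebra_simps)
  have bA: "bop A" and bB: "bop B" using A B adjD by auto
  have cA: "com A Y" if "bop Y" "com N Y" "com N' Y" for Y
    using that a unfolding A_def com_def by (simp add: bop_cl bop_add bop_smult)
  have cB: "com B Y" if "bop Y" "com N Y" "com N' Y" for Y
    using that a unfolding B_def com_def by (simp add: bop_cl bop_minus bop_smult)
  have AB: "com B A"
    using cB[OF bA com_sym[OF cA] com_sym[OF cA]] a by (simp add: com_refl)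
  obtain s where s: "approx_kernel (insert (\<lambda>x. A x \<ominus> complex_of_real s \<odot> x) Ys)"
    using self_adjoint_localize[OF fin b _ A js] cA b c by blast
  define Z where "Z = (\<lambda>x. A x \<ominus> complex_of_real s \<odot> x)"
  have Z: "com B Z" "bop Z" unfolding Z_def by (rule com_shift[OF bB bA AB]) (rule bop_shift[OF bA])
  have all: "bop Y \<and> com B Y" if "Y \<in> insert Z Ys" for Y
    using that Z b c cB[of Y] by blast
  have "approx_kernel (insert Z Ys)" using s by (simp add: Z_def)
  then obtain t where t: "approx_kernel (insert (\<lambda>x. B x \<ominus> complex_of_real t \<odot> x) (insert Z Ys))"
    using self_adjoint_localize[of "insert Z Ys" B] fin all B by auto
  show ?thesis
  proof (rule that[of "Complex s t"], rule approx_kernel_insertI)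
    fix e :: real assume e: "e > 0"
    then have "min (e/2) e > 0" by simp
    then obtain x where x: "x \<in> carrier H" "nm x = 1" "nm (A x \<ominus> complex_of_real s \<odot> x) \<le> min (e/2) e"
      "nm (B x \<ominus> complex_of_real t \<odot> x) \<le> min (e/2) e" "\<And>Y. Y \<in> Ys \<Longrightarrow> nm (Y x) \<le> min (e/2) e"
      by (rule approx_kernel_insertE[OF t]) (auto simp: Z_def)
    have "N x \<ominus> Complex s t \<odot> x = (A x \<ominus> complex_of_real s \<odot> x) \<oplus> \<i> \<odot> (B x \<ominus> complex_of_real t \<odot> x)"
      using x a unfolding A_def B_def
      by (intro ip_ext) (auto simp: ip_simps bop_cl Complex_eq algebra_simps)
    then have "nm (N x \<ominus> Complex s t \<odot> x) \<le> nm (A x \<ominus> complex_of_real s \<odot> x) + nm (B x \<ominus> complex_of_real t \<odot> x)"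
      using nm_triangle[of "A x \<ominus> complex_of_real s \<odot> x" "\<i> \<odot> (B x \<ominus> complex_of_real t \<odot> x)"] x bA bB
      by (simp add: bop_cl nm_smult)
    then have "nm (N x \<ominus> Complex s t \<odot> x) \<le> e" using x by linarith
    moreover have "nm (Y x) \<le> e" if "Y \<in> Ys" for Y using x(5)[OF that] by simp
    ultimately show "\<exists>x\<in>carrier H. nm x = 1 \<and> nm (N x \<ominus> Complex s t \<odot> x) \<le> e \<and> (\<forall>Y\<in>Ys. nm (Y x) \<le> e)"
      using x by blast
  qed
qed

end

section \<open>Polynomials of commuting normal operators\<close>

context pre_hilbert
begin

text \<open>
  By Fuglede's theorem commutation with the adjoint is automatic.
\<close>
lemma normal_localize':
  assumes fin: "finite Ys" and b: "\<And>Y. Y \<in> Ys \<Longrightarrow> bop Y \<and> com N Y"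
    and NN: "normal_pair N N'" and js: "approx_kernel Ys"
  obtains w where "approx_kernel (insert (\<lambda>x. N x \<ominus> w \<odot> x) Ys)"
  using normal_localize[OF fin _ _ _ NN js] b fuglede[OF NN] com_sym by metis

lemma triple_localize:
  assumes fin: "finite Ys" and b: "\<And>Y. Y \<in> Ys \<Longrightarrow> bop Y \<and> com N1 Y \<and> com N2 Y \<and> com N3 Y"
    and n: "normal_pair N1 N1'" "normal_pair N2 N2'" "normal_pair N3 N3'"
    and c: "com N1 N2" "com N1 N3" "com N2 N3" and js: "approx_kernel Ys"
  obtains w1 w2 w3 where "approx_kernel (insert (\<lambda>x. N3 x \<ominus> w3 \<odot> x)
    (insert (\<lambda>x. N2 x \<ominus> w2 \<odot> x) (insert (\<lambda>x. N1 x \<ominus> w1 \<odot> x) Ys)))"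
proof -
  have bn: "bop N1" "bop N2" "bop N3" using n by (auto simp: normal_pair_def dest: adjD)
  obtain w1 where w1: "approx_kernel (insert (\<lambda>x. N1 x \<ominus> w1 \<odot> x) Ys)"
    using normal_localize'[OF fin _ n(1) js] b by blast
  define Z1 where "Z1 = (\<lambda>x. N1 x \<ominus> w1 \<odot> x)"
  have Z1: "bop Z1" "com N2 Z1" "com N3 Z1"
    unfolding Z1_def by (rule bop_shift[OF bn(1)] com_shift[OF bn(2,1) com_sym[OF c(1)]]
      com_shift[OF bn(3,1) com_sym[OF c(2)]])+
  have "bop Y \<and> com N2 Y" if "Y \<in> insert Z1 Ys" for Y using that Z1 b by blast
  then obtain w2 where w2: "approx_kernel (insert (\<lambda>x. N2 x \<ominus> w2 \<odot> x) (insert Z1 Ys))"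
    using normal_localize'[of "insert Z1 Ys", OF _ _ n(2)] w1[folded Z1_def] fin by blast
  define Z2 where "Z2 = (\<lambda>x. N2 x \<ominus> w2 \<odot> x)"
  have Z2: "bop Z2" "com N3 Z2"
    unfolding Z2_def by (rule bop_shift[OF bn(2)] com_shift[OF bn(3,2) com_sym[OF c(3)]])+
  have "bop Y \<and> com N3 Y" if "Y \<in> insert Z2 (insert Z1 Ys)" for Y using that Z1 Z2 b by blast
  then obtain w3 where "approx_kernel (insert (\<lambda>x. N3 x \<ominus> w3 \<odot> x) (insert Z2 (insert Z1 Ys)))"
    using normal_localize'[of "insert Z2 (insert Z1 Ys)", OF _ _ n(3)] w2[folded Z2_def] fin by blast
  then show ?thesis by (auto simp: Z1_def Z2_def intro: that)
qed

lemma approx_kernel_insert3E: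
  assumes "approx_kernel (insert A (insert B (insert C Ys)))" "e > 0"
  obtains x where "x \<in> carrier H" "nm x = 1" "nm (A x) \<le> e" "nm (B x) \<le> e" "nm (C x) \<le> e"
    "\<And>Y. Y \<in> Ys \<Longrightarrow> nm (Y x) \<le> e"
proof -
  obtain x where x: "x \<in> carrier H" "nm x = 1" "nm (A x) \<le> e"
    "\<And>Y. Y \<in> insert B (insert C Ys) \<Longrightarrow> nm (Y x) \<le> e"
    using approx_kernel_insertE[OF assms] by blast
  show ?thesis by (rule that[OF x(1-3)]) (use x(4) in auto)
qed

text \<open>
  Here \<open>\<delta> x\<close> measures how far \<open>x\<close> is from being a joint eigenvector, and \<open>X\<close> acts on \<open>x\<close> like the scalar \<open>c\<close> up to
  an error linear in \<open>\<delta> x\<close>. The notion is stable under sums, products and inverses, and so passes from the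
  coordinates to rational functions.
\<close>
definition tracks :: "('a \<Rightarrow> real) \<Rightarrow> ('a \<Rightarrow> 'a) \<Rightarrow> complex \<Rightarrow> bool" where
  "tracks \<delta> X c \<longleftrightarrow> bop X \<and> (\<exists>C\<ge>0. \<forall>x\<in>carrier H. nm (X x \<ominus> c \<odot> x) \<le> C * \<delta> x)"

lemma tracksI: "bop X \<Longrightarrow> C \<ge> 0 \<Longrightarrow> (\<And>x. x \<in> carrier H \<Longrightarrow> nm (X x \<ominus> c \<odot> x) \<le> C * \<delta> x) \<Longrightarrow> tracks \<delta> X c"
  unfolding tracks_def by metis

lemma tracksE:
  assumes "tracks \<delta> X c"
  obtains C where "C \<ge> 0" "\<And>x. x \<in> carrier H \<Longrightarrow> nm (X x \<ominus> c \<odot> x) \<le> C * \<delta> x" "bop X"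
  using assms unfolding tracks_def by metis

lemma tracks_bop: "tracks \<delta> X c \<Longrightarrow> bop X"
  by (simp add: tracks_def)

lemma minus_self: "x \<in> carrier H \<Longrightarrow> x \<ominus> x = \<zero>"
  by (rule ip_ext) (auto simp: ip_simps)

lemma one_smult: "x \<in> carrier H \<Longrightarrow> 1 \<odot> x = x"
  by (rule ip_ext) (auto simp: ip_simps)

lemma tracks_id: "tracks \<delta> (\<lambda>x. x) 1"
  by (rule tracksI[where C=0]) (auto simp: bop_id one_smult minus_self)

lemma tracks_comp:
  assumes X: "tracks \<delta> X c" and Y: "tracks \<delta> Y d"
  shows "tracks \<delta> (\<lambda>x. X (Y x)) (c * d)"
proof -
  obtain C where C: "C \<ge> 0" "\<And>x. x \<in> carrier H \<Longrightarrow> nm (X x \<ominus> c \<odot> x) \<le> C * \<delta> x" "bop X" using tracksE[OF X] by blast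
  obtain D where D: "D \<ge> 0" "\<And>x. x \<in> carrier H \<Longrightarrow> nm (Y x \<ominus> d \<odot> x) \<le> D * \<delta> x" "bop Y" using tracksE[OF Y] by blast
  obtain B where B: "B > 0" "\<And>x. x \<in> carrier H \<Longrightarrow> nm (X x) \<le> B * nm x" using bop_bound[OF C(3)] by blast
  show ?thesis
  proof (rule tracksI[where C="B * D + cmod d * C"])
    fix x assume x: "x \<in> carrier H"
    have "X (Y x) \<ominus> (c * d) \<odot> x = X (Y x \<ominus> d \<odot> x) \<oplus> d \<odot> (X x \<ominus> c \<odot> x)"
      using x C D by (intro ip_ext) (auto simp: ip_simps bop_cl bop_minus bop_smult algebra_simps)
    then have "nm (X (Y x) \<ominus> (c * d) \<odot> x) \<le> nm (X (Y x \<ominus> d \<odot> x)) + cmod d * nm (X x \<ominus> c \<odot> x)"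
      using nm_triangle[of "X (Y x \<ominus> d \<odot> x)" "d \<odot> (X x \<ominus> c \<odot> x)"] x C D by (simp add: bop_cl nm_smult)
    also have "\<dots> \<le> B * (D * \<delta> x) + cmod d * (C * \<delta> x)"
      using x C D B by (intro add_mono mult_left_mono order_trans[OF B(2)]) (auto simp: bop_cl)
    finally show "nm (X (Y x) \<ominus> (c * d) \<odot> x) \<le> (B * D + cmod d * C) * \<delta> x" by (simp add: algebra_simps)
  qed (use B C D in \<open>auto intro: bop_comp\<close>)
qed

lemma tracks_smult:
  assumes X: "tracks \<delta> X c"
  shows "tracks \<delta> (\<lambda>x. a \<odot> X x) (a * c)"
proof -
  obtain C where C: "C \<ge> 0" "\<And>x. x \<in> carrier H \<Longrightarrow> nm (X x \<ominus> c \<odot> x) \<le> C * \<delta> x" "bop X" using tracksE[OF X] by blast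
  show ?thesis
  proof (rule tracksI[where C="cmod a * C"])
    fix x assume x: "x \<in> carrier H"
    have "a \<odot> X x \<ominus> (a * c) \<odot> x = a \<odot> (X x \<ominus> c \<odot> x)"
      using x C by (intro ip_ext) (auto simp: ip_simps bop_cl algebra_simps)
    then show "nm (a \<odot> X x \<ominus> (a * c) \<odot> x) \<le> cmod a * C * \<delta> x"
      using x C by (simp add: nm_smult bop_cl mult.assoc mult_left_mono)
  qed (use C in \<open>auto intro: bop_smult_op\<close>)
qed

lemma tracks_add:
  assumes X: "tracks \<delta> X c" and Y: "tracks \<delta> Y d"
  shows "tracks \<delta> (\<lambda>x. X x \<oplus> Y x) (c + d)"
proof -
  obtain C where C: "C \<ge> 0" "\<And>x. x \<in> carrier H \<Longrightarrow> nm (X x \<ominus> c \<odot> x) \<le> C * \<delta> x" "bop X" using tracksE[OF X] by blast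
  obtain D where D: "D \<ge> 0" "\<And>x. x \<in> carrier H \<Longrightarrow> nm (Y x \<ominus> d \<odot> x) \<le> D * \<delta> x" "bop Y" using tracksE[OF Y] by blast
  show ?thesis
  proof (rule tracksI[where C="C + D"])
    fix x assume x: "x \<in> carrier H"
    have "X x \<oplus> Y x \<ominus> (c + d) \<odot> x = (X x \<ominus> c \<odot> x) \<oplus> (Y x \<ominus> d \<odot> x)"
      using x C D by (intro ip_ext) (auto simp: ip_simps bop_cl algebra_simps)
    then have "nm (X x \<oplus> Y x \<ominus> (c + d) \<odot> x) \<le> nm (X x \<ominus> c \<odot> x) + nm (Y x \<ominus> d \<odot> x)"
      using nm_triangle[of "X x \<ominus> c \<odot> x" "Y x \<ominus> d \<odot> x"] x C D by (simp add: bop_cl)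
    then show "nm (X x \<oplus> Y x \<ominus> (c + d) \<odot> x) \<le> (C + D) * \<delta> x"
      using C(2)[OF x] D(2)[OF x] by (simp add: algebra_simps)
  qed (use C D in \<open>auto intro: bop_add_op\<close>)
qed

lemma tracks_cong:
  assumes "tracks \<delta> X c" "\<And>x. x \<in> carrier H \<Longrightarrow> Y x = X x" "c = d"
  shows "tracks \<delta> Y d"
  using assms bop_cong[of X Y] by (simp add: tracks_def)

lemma tracks_zero: "tracks \<delta> (\<lambda>x. \<zero>) 0"
  by (rule tracksI[where C=0]) (auto simp: bop_zero_op zero_smult minus_self)

lemma tracks_finsum:
  assumes "finite A" "\<And>i. i \<in> A \<Longrightarrow> tracks \<delta> (X i) (c i)"
  shows "tracks \<delta> (\<lambda>x. finsum H (\<lambda>i. X i x) A) (\<Sum>i\<in>A. c i)"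
  using assms
proof (induction A rule: finite_induct)
  case empty
  then show ?case using tracks_zero by simp
next
  case (insert i A)
  then have "tracks \<delta> (\<lambda>x. X i x \<oplus> finsum H (\<lambda>i. X i x) A) (c i + (\<Sum>i\<in>A. c i))" by (intro tracks_add) auto
  moreover have "X j x \<in> carrier H" if "j \<in> insert i A" "x \<in> carrier H" for j x
    using bop_cl[OF tracks_bop[OF insert.prems[OF that(1)]] that(2)] .
  ultimately show ?case
    by (elim tracks_cong) (use insert in \<open>auto intro!: finsum_insert\<close>)
qed

lemma tracks_funpow: "tracks \<delta> X c \<Longrightarrow> tracks \<delta> (X ^^ n) (c ^ n)"
proof (induction n)
  case 0
  then show ?case using tracks_id by (simp add: id_def)
next
  case (Suc n)
  have "tracks \<delta> (\<lambda>x. X ((X ^^ n) x)) (c * c ^ n)" by (rule tracks_comp) (use Suc in auto)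
  then show ?case by (simp add: o_def)
qed

lemma tracks_inverse:
  assumes X: "tracks \<delta> X c" and R: "bop R" "\<And>x. x \<in> carrier H \<Longrightarrow> R (X x) = x" and c: "c \<noteq> 0"
  shows "tracks \<delta> R (1 / c)"
proof -
  obtain C where C: "C \<ge> 0" "\<And>x. x \<in> carrier H \<Longrightarrow> nm (X x \<ominus> c \<odot> x) \<le> C * \<delta> x" "bop X" using tracksE[OF X] by blast
  obtain B where B: "B > 0" "\<And>x. x \<in> carrier H \<Longrightarrow> nm (R x) \<le> B * nm x" using bop_bound[OF R(1)] by blast
  show ?thesis
  proof (rule tracksI[where C="B * C / cmod c"])
    fix x assume x: "x \<in> carrier H"
    have "R x \<ominus> (1 / c) \<odot> x = (- 1 / c) \<odot> R (X x \<ominus> c \<odot> x)"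
      using x C R c by (intro ip_ext) (auto simp: ip_simps bop_cl bop_minus bop_smult field_simps)
    then have "nm (R x \<ominus> (1 / c) \<odot> x) = nm (R (X x \<ominus> c \<odot> x)) / cmod c"
      using x C R by (simp add: nm_smult bop_cl norm_divide)
    also have "\<dots> \<le> B * (C * \<delta> x) / cmod c"
      using x C B by (intro divide_right_mono order_trans[OF B(2)] mult_left_mono) (auto simp: bop_cl)
    finally show "nm (R x \<ominus> (1 / c) \<odot> x) \<le> B * C / cmod c * \<delta> x" by simp
  qed (use B C R in auto)
qed

text \<open>
  The summands of \<^const>\<open>peval_op\<close> as operators in their own right, so that properties of polynomials
  of operators follow from those of monomials and sums.
\<close>
definition monomial_op :: "'a op_triple \<Rightarrow> nat \<times> nat \<times> nat \<Rightarrow> 'a \<Rightarrow> 'a" where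
  "monomial_op T m x = (case T of (T1, T2, T3) \<Rightarrow> case m of (a, b, c) \<Rightarrow> (T1 ^^ a) ((T2 ^^ b) ((T3 ^^ c) x)))"

lemma peval_op_alt:
  "peval_op H p T = (\<lambda>x. finsum H (\<lambda>m. Poly_Mapping.lookup p m \<odot> monomial_op T m x) (Poly_Mapping.keys p))"
  by (cases T) (auto simp: monomial_op_def case_prod_unfold)

lemma monomial_op_alt: "monomial_op (T1, T2, T3) (a, b, c) = (\<lambda>x. (T1 ^^ a) ((T2 ^^ b) ((T3 ^^ c) x)))"
  by (auto simp: monomial_op_def)

lemma bop_monomial_op: "bop T1 \<Longrightarrow> bop T2 \<Longrightarrow> bop T3 \<Longrightarrow> bop (monomial_op (T1, T2, T3) m)"
  by (cases m) (simp add: monomial_op_alt bop_comp[OF bop_funpow bop_comp[OF bop_funpow bop_funpow]])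

lemma adj_monomial_op:
  assumes "adj T1 T1'" "adj T2 T2'" "adj T3 T3'"
  shows "\<exists>M'. adj (monomial_op (T1, T2, T3) m) M'"
  using adj_comp[OF adj_funpow[OF assms(1)] adj_comp[OF adj_funpow[OF assms(2)] adj_funpow[OF assms(3)]]]
  by (cases m) (auto simp: monomial_op_alt)

lemma com_monomial_op:
  assumes "bop X" "bop T1" "bop T2" "bop T3" "com X T1" "com X T2" "com X T3"
  shows "com X (monomial_op (T1, T2, T3) m)"
  using assms
  by (cases m) (simp add: monomial_op_alt com_comp[OF _ bop_funpow bop_comp[OF bop_funpow bop_funpow]
      com_funpow com_comp[OF _ bop_funpow bop_funpow com_funpow com_funpow]])

lemma adj_peval_op:
  assumes "adj T1 T1'" "adj T2 T2'" "adj T3 T3'"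
  shows "\<exists>P'. adj (peval_op H p (T1, T2, T3)) P'"
proof -
  obtain M' where M': "\<And>m. adj (monomial_op (T1, T2, T3) m) (M' m)" using adj_monomial_op[OF assms] by metis
  have "adj (\<lambda>x. finsum H (\<lambda>m. Poly_Mapping.lookup p m \<odot> monomial_op (T1, T2, T3) m x) (Poly_Mapping.keys p))
     (\<lambda>x. finsum H (\<lambda>m. cnj (Poly_Mapping.lookup p m) \<odot> M' m x) (Poly_Mapping.keys p))"
    by (rule adj_finsum[OF finite_keys adj_smult[OF M']])
  then show ?thesis unfolding peval_op_alt by blast
qed

lemma com_peval_op:
  assumes "bop X" "bop T1" "bop T2" "bop T3" "com X T1" "com X T2" "com X T3"
  shows "com X (peval_op H p (T1, T2, T3))"
  unfolding peval_op_alt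
  by (rule com_finsum[OF assms(1) finite_keys bop_smult_op[OF bop_monomial_op[OF assms(2-4)]]
        com_smult[OF assms(1) bop_monomial_op[OF assms(2-4)] com_monomial_op[OF assms]]])

lemma peval_alt: "peval p w = (\<Sum>m\<in>Poly_Mapping.keys p. Poly_Mapping.lookup p m *
    (case w of (w1, w2, w3) \<Rightarrow> case m of (a, b, c) \<Rightarrow> w1 ^ a * w2 ^ b * w3 ^ c))"
  by (cases w) (auto simp: case_prod_unfold mult.assoc intro!: sum.cong)

definition gap :: "'a op_triple \<Rightarrow> point \<Rightarrow> 'a \<Rightarrow> real" where
  "gap T w x = (case T of (T1, T2, T3) \<Rightarrow> case w of (w1, w2, w3) \<Rightarrow>
     nm (T1 x \<ominus> w1 \<odot> x) + nm (T2 x \<ominus> w2 \<odot> x) + nm (T3 x \<ominus> w3 \<odot> x))"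

lemma tracks_peval_op:
  assumes b: "bop T1" "bop T2" "bop T3"
  shows "tracks (gap (T1, T2, T3) w) (peval_op H p (T1, T2, T3)) (peval p w)"
proof -
  obtain w1 w2 w3 where w: "w = (w1, w2, w3)" by (cases w) auto
  let ?g = "gap (T1, T2, T3) w"
  have g: "tracks ?g T1 w1" "tracks ?g T2 w2" "tracks ?g T3 w3"
    by (rule tracksI[where C=1], use b in \<open>auto simp: gap_def w bop_cl\<close>)+
  have "tracks ?g (monomial_op (T1, T2, T3) (a, b, c)) (w1 ^ a * (w2 ^ b * w3 ^ c))" for a b c
    unfolding monomial_op_alt by (rule tracks_comp[OF tracks_funpow[OF g(1)] tracks_comp[OF tracks_funpow[OF g(2)] tracks_funpow[OF g(3)]]])
  then have "tracks ?g (monomial_op (T1, T2, T3) m) (case m of (a, b, c) \<Rightarrow> w1 ^ a * w2 ^ b * w3 ^ c)" for m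
    by (cases m) (auto simp: mult.assoc)
  then show ?thesis
    unfolding peval_op_alt peval_alt w prod.case
    by (intro tracks_finsum tracks_smult) (auto simp: w)
qed

text \<open>
  If \<open>p(T) - p(w)\<close> has a bounded inverse, then a vector on which \<open>p(T)\<close> acts almost like \<open>p(w)\<close> must be small.
\<close>
lemma outside_joint_spectrum:
  assumes b: "bop T1" "bop T2" "bop T3" and w: "w \<notin> joint_spectrum H (T1, T2, T3)"
  obtains C where "C \<ge> 0" "\<And>x. x \<in> carrier H \<Longrightarrow> nm x \<le> C * gap (T1, T2, T3) w x"
proof -
  obtain p where p: "peval p w \<notin> op_spectrum H (peval_op H p (T1, T2, T3))"
    using w by (auto simp: joint_spectrum_def)
  let ?P = "peval_op H p (T1, T2, T3)"
  obtain R where R: "bop R" "\<And>x. x \<in> carrier H \<Longrightarrow> R (?P x \<ominus> peval p w \<odot> x) = x"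
    using p by (auto simp: op_spectrum_def invertible_op_def)
  obtain B where B: "B > 0" "\<And>x. x \<in> carrier H \<Longrightarrow> nm (R x) \<le> B * nm x" using bop_bound[OF R(1)] by blast
  obtain C where C: "C \<ge> 0" "bop ?P"
    "\<And>x. x \<in> carrier H \<Longrightarrow> nm (?P x \<ominus> peval p w \<odot> x) \<le> C * gap (T1, T2, T3) w x"
    using tracks_peval_op[OF b, of w p] by (auto elim: tracksE)
  show ?thesis
  proof (rule that[of "B * C"])
    fix x assume x: "x \<in> carrier H"
    have "nm x = nm (R (?P x \<ominus> peval p w \<odot> x))" using R x by simp
    also have "\<dots> \<le> B * (C * gap (T1, T2, T3) w x)"
      using x B C by (intro order_trans[OF B(2)] mult_left_mono) (auto simp: bop_cl simp del: peval_op.simps)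
    finally show "nm x \<le> B * C * gap (T1, T2, T3) w x" by simp
  qed (use B C in simp)
qed

end

section \<open>Inverses and rational functions of normal operators\<close>

context hilbert_space
begin

text \<open>
  The operator \<open>Q'Q\<close> is bounded below, so \<open>1 - tQ'Q\<close> is a strict contraction for a suitable \<open>t > 0\<close> and
  \<open>Q'Qx = Q'y\<close> is solved by iteration. Since \<open>Q'\<close> is injective, \<open>Qx = y\<close>.
\<close>
lemma neumann_surj:
  assumes A: "adj Q Q'"
    and d: "\<delta> > 0" "\<And>x. x \<in> carrier H \<Longrightarrow> \<delta> * nm x \<le> nm (Q x)"
    and d': "\<delta>' > 0" "\<And>x. x \<in> carrier H \<Longrightarrow> \<delta>' * nm x \<le> nm (Q' x)"
    and y: "y \<in> carrier H"
  obtains x where "x \<in> carrier H" "Q x = y"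
proof -
  have bQ: "bop Q" "bop Q'" using A adjD by auto
  define P where "P = (\<lambda>x. Q' (Q x))"
  have bP: "bop P" unfolding P_def by (rule bop_comp[OF bQ(2,1)])
  obtain C0 where C0: "C0 > 0" "\<And>x. x \<in> carrier H \<Longrightarrow> nm (P x) \<le> C0 * nm x" using bop_bound[OF bP] by blast
  define C where "C = max C0 (\<delta>\<^sup>2)"
  have Cp: "C > 0" "\<delta>\<^sup>2 \<le> C" using C0 by (auto simp: C_def)
  have C: "nm (P x) \<le> C * nm x" if "x \<in> carrier H" for x
  proof -
    have "C0 * nm x \<le> C * nm x" using that by (intro mult_right_mono) (auto simp: C_def)
    then show ?thesis using C0(2)[OF that] by linarith
  qed
  \<comment> \<open>This \<open>t\<close> minimizes the bound \<open>1 - 2t\<delta>\<^sup>2 + t\<^sup>2C\<^sup>2\<close> for the squared norm of \<open>1 - tQ'Q\<close>.\<close>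
  define t where "t = \<delta>\<^sup>2 / C\<^sup>2"
  define q where "q = sqrt (1 - (\<delta>\<^sup>2 / C)\<^sup>2)"
  have dC: "0 < \<delta>\<^sup>2 / C" "\<delta>\<^sup>2 / C \<le> 1" using Cp d by auto
  then have "(\<delta>\<^sup>2 / C)\<^sup>2 \<le> 1" by (simp add: power_le_one)
  then have q: "0 \<le> q" "q < 1" "q\<^sup>2 = 1 - (\<delta>\<^sup>2 / C)\<^sup>2" using dC unfolding q_def by auto
  define E where "E = (\<lambda>x. x \<ominus> complex_of_real t \<odot> P x)"
  have bE: "bop E" unfolding E_def by (rule bop_minus_op[OF bop_id bop_smult_op[OF bP]])
  have contr: "nm (E x) \<le> q * nm x" if x: "x \<in> carrier H" for x
  proof (rule power2_le_imp_le)
    have QP: "ip x (P x) = of_real ((nm (Q x))\<^sup>2)" "ip (P x) x = of_real ((nm (Q x))\<^sup>2)"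
      using x bQ bP by (auto simp: P_def adjD(3)[OF A, symmetric] adjD'[OF A, symmetric] bop_cl ip_self)
    have "ip (E x) (E x) = of_real ((nm x)\<^sup>2 - 2 * t * (nm (Q x))\<^sup>2 + t\<^sup>2 * (nm (P x))\<^sup>2)"
      unfolding E_def using x bP
      by (simp add: ip_simps bop_cl QP) (simp add: ip_self bop_cl power2_eq_square algebra_simps)
    then have "(nm (E x))\<^sup>2 = (nm x)\<^sup>2 - 2 * t * (nm (Q x))\<^sup>2 + t\<^sup>2 * (nm (P x))\<^sup>2"
      using x bE by (simp add: nm_sq[of "E x"] bop_cl)
    also have "\<dots> \<le> (nm x)\<^sup>2 - 2 * t * (\<delta> * nm x)\<^sup>2 + t\<^sup>2 * (C * nm x)\<^sup>2"
      using x d(1) d(2)[OF x] C[OF x] bP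
      by (intro add_mono diff_left_mono mult_left_mono power_mono diff_mono) (auto simp: t_def bop_cl)
    also have "\<dots> = (nm x)\<^sup>2 * (1 - 2 * t * \<delta>\<^sup>2 + t\<^sup>2 * C\<^sup>2)" by (simp add: power_mult_distrib algebra_simps)
    also have "1 - 2 * t * \<delta>\<^sup>2 + t\<^sup>2 * C\<^sup>2 = q\<^sup>2"
      using Cp q(3) by (simp add: t_def power_divide field_simps power2_eq_square)
    finally show "(nm (E x))\<^sup>2 \<le> (q * nm x)\<^sup>2" by (simp add: power_mult_distrib mult.commute)
  qed (use q x in auto)
  define z where "z = complex_of_real t \<odot> Q' y"
  have z: "z \<in> carrier H" using y bQ by (simp add: z_def bop_cl)
  define s where "s = rec_nat \<zero> (\<lambda>_ x. E x \<oplus> z)"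
  have s0: "s 0 = \<zero>" and sS: "s (Suc n) = E (s n) \<oplus> z" for n by (simp_all add: s_def)
  have sc: "s n \<in> carrier H" for n by (induction n) (auto simp: s0 sS z bop_cl bE)
  define B where "B = nm z / (1 - q)"
  have B0: "B \<ge> 0" using q z by (simp add: B_def)
  have sB: "nm (s n) \<le> B" for n
  proof (induction n)
    case (Suc n)
    have "nm (s (Suc n)) \<le> nm (E (s n)) + nm z" unfolding sS using sc z bE by (intro nm_triangle) (auto simp: bop_cl)
    also have "\<dots> \<le> q * B + nm z" using order_trans[OF contr[OF sc[of n]] mult_left_mono[OF Suc q(1)]] by simp
    also have "\<dots> = B" using q by (simp add: B_def field_simps)
    finally show ?case .
  qed (use B0 in \<open>simp add: s0\<close>)
  have step: "nm (s (n + k) \<ominus> s n) \<le> q ^ n * B" for n k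
  proof (induction n)
    case 0
    have "s k \<ominus> \<zero> = s k" using sc by (intro ip_ext) (auto simp: ip_simps)
    then show ?case using sB by (simp add: s0)
  next
    case (Suc n)
    have "s (Suc n + k) \<ominus> s (Suc n) = E (s (n + k) \<ominus> s n)"
      using sc z bE by (intro ip_ext) (auto simp: sS ip_simps bop_minus bop_cl)
    then have "nm (s (Suc n + k) \<ominus> s (Suc n)) \<le> q * nm (s (n + k) \<ominus> s n)"
      using contr[of "s (n + k) \<ominus> s n"] sc by simp
    also have "\<dots> \<le> q * (q ^ n * B)" using Suc q by (intro mult_left_mono)
    finally show ?case by simp
  qed
  have cauchy: "\<exists>M. \<forall>i\<ge>M. \<forall>j\<ge>M. hnorm H (s i \<ominus> s j) < e" if e: "e > 0" for e
  proof -
    have "(\<lambda>n. q ^ n * B) \<longlonglongrightarrow> 0 * B" using q by (intro tendsto_intros LIMSEQ_realpow_zero) auto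
    then have "eventually (\<lambda>n. q ^ n * B < e / 2) sequentially" using e by (intro order_tendstoD(2)) auto
    then obtain M where M: "q ^ M * B < e / 2" by (auto simp: eventually_sequentially)
    have *: "nm (s i \<ominus> s M) < e / 2" if "i \<ge> M" for i
      using step[of M "i - M"] M that by simp
    show ?thesis
    proof (intro exI[of _ M] allI impI)
      fix i j assume ij: "i \<ge> M" "j \<ge> M"
      have "nm (s i \<ominus> s j) \<le> nm (s i \<ominus> s M) + nm (s M \<ominus> s j)" using sc by (intro nm_triangle3)
      also have "nm (s M \<ominus> s j) = nm (s j \<ominus> s M)" using sc by (intro nm_minus_sym)
      finally show "nm (s i \<ominus> s j) < e" using *[OF ij(1)] *[OF ij(2)] by linarith
    qed
  qed
  obtain x where x: "x \<in> carrier H" "(\<lambda>i. nm (s i \<ominus> x)) \<longlonglongrightarrow> 0"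
    using complete[OF sc cauchy] by blast
  have "nm (E x \<oplus> z \<ominus> x) \<le> nm (s n \<ominus> x) * q + nm (s (Suc n) \<ominus> x)" for n
  proof -
    have "nm (E x \<oplus> z \<ominus> x) \<le> nm (E x \<oplus> z \<ominus> s (Suc n)) + nm (s (Suc n) \<ominus> x)"
      using x z sc bE by (intro nm_triangle3) (auto simp: bop_cl)
    also have "E x \<oplus> z \<ominus> s (Suc n) = E (x \<ominus> s n)"
      using sc x z bE by (intro ip_ext) (auto simp: sS ip_simps bop_minus bop_cl)
    also have "nm (E (x \<ominus> s n)) \<le> q * nm (x \<ominus> s n)" using sc x by (intro contr) auto
    also have "nm (x \<ominus> s n) = nm (s n \<ominus> x)" using sc x by (intro nm_minus_sym)
    finally show ?thesis by (simp add: mult.commute)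
  qed
  moreover have "(\<lambda>n. nm (s n \<ominus> x) * q + nm (s (Suc n) \<ominus> x)) \<longlonglongrightarrow> 0 * q + 0"
    using x(2) LIMSEQ_Suc[OF x(2)] by (intro tendsto_intros)
  ultimately have "nm (E x \<oplus> z \<ominus> x) \<le> 0"
    by (intro LIMSEQ_le_const[of _ _ "nm (E x \<oplus> z \<ominus> x)"]) auto
  then have "nm (E x \<oplus> z \<ominus> x) = 0" using x z bE by (intro antisym nm_nonneg) (simp_all add: bop_cl)
  moreover have "E x \<oplus> z \<ominus> x = complex_of_real t \<odot> Q' (y \<ominus> Q x)"
    using x y z bQ bP bE by (intro ip_ext) (auto simp: E_def P_def z_def ip_simps bop_minus bop_cl algebra_simps)
  ultimately have "cmod (complex_of_real t) * nm (Q' (y \<ominus> Q x)) = 0" using x y bQ by (simp add: nm_smult bop_cl)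
  then have "nm (Q' (y \<ominus> Q x)) = 0" using d(1) Cp by (simp add: t_def)
  then have "\<delta>' * nm (y \<ominus> Q x) \<le> 0" using d'(2)[of "y \<ominus> Q x"] x y bQ by (simp add: bop_cl)
  then have "nm (y \<ominus> Q x) = 0" using d'(1) x y bQ
    by (intro antisym nm_nonneg) (simp_all add: bop_cl mult_le_0_iff)
  then have "y \<ominus> Q x = \<zero>" using x y bQ nm_eq_0[of "y \<ominus> Q x"] by (simp add: bop_cl)
  then have "y = Q x" using x y bQ by (auto intro: minus_eq_zero simp: bop_cl)
  then show ?thesis using that x by blast
qed

lemma bounded_below_inverse:
  assumes A: "adj Q Q'"
    and d: "\<delta> > 0" "\<And>x. x \<in> carrier H \<Longrightarrow> \<delta> * nm x \<le> nm (Q x)"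
    and d': "\<delta>' > 0" "\<And>x. x \<in> carrier H \<Longrightarrow> \<delta>' * nm x \<le> nm (Q' x)"
  defines "R \<equiv> inv_into (carrier H) Q"
  shows "bop R" "\<And>x. x \<in> carrier H \<Longrightarrow> R (Q x) = x" "\<And>x. x \<in> carrier H \<Longrightarrow> Q (R x) = x"
proof -
  have bQ: "bop Q" "bop Q'" using A adjD by auto
  have inj: "inj_on Q (carrier H)"
  proof (rule inj_onI)
    fix x y assume xy: "x \<in> carrier H" "y \<in> carrier H" "Q x = Q y"
    have "Q (x \<ominus> y) = \<zero>" using xy bQ by (simp add: bop_minus minus_self bop_cl)
    then have "\<delta> * nm (x \<ominus> y) \<le> 0" using d(2)[of "x \<ominus> y"] xy by simp
    then have "nm (x \<ominus> y) = 0" using d(1) xy by (intro antisym nm_nonneg) (simp_all add: mult_le_0_iff)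
    then have "x \<ominus> y = \<zero>" using xy nm_eq_0[of "x \<ominus> y"] by simp
    then show "x = y" using xy by (auto intro: minus_eq_zero)
  qed
  have surj: "y \<in> Q ` carrier H" if "y \<in> carrier H" for y
    using neumann_surj[OF A d d' that] by blast
  show l: "R (Q x) = x" if "x \<in> carrier H" for x
    unfolding R_def using inj that by simp
  show r: "Q (R x) = x" if "x \<in> carrier H" for x
    unfolding R_def using surj[OF that] by (rule f_inv_into_f)
  have c: "R x \<in> carrier H" if "x \<in> carrier H" for x
    unfolding R_def using surj[OF that] by (rule inv_into_into)
  show "bop R"
  proof (rule bopI[where C="1 / \<delta>"])
    fix x y assume xy: "x \<in> carrier H" "y \<in> carrier H"
    have "R (x \<oplus> y) = R (Q (R x \<oplus> R y))" using xy c r bQ by (simp add: bop_add)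
    then show "R (x \<oplus> y) = R x \<oplus> R y" using xy c l by simp
  next
    fix a x assume x: "x \<in> carrier H"
    have "R (a \<odot> x) = R (Q (a \<odot> R x))" using x c r bQ by (simp add: bop_smult)
    then show "R (a \<odot> x) = a \<odot> R x" using x c l by simp
  next
    fix x assume x: "x \<in> carrier H"
    have "\<delta> * nm (R x) \<le> nm x" using d(2)[OF c[OF x]] r[OF x] by simp
    then show "nm (R x) \<le> 1 / \<delta> * nm x" using d(1) by (simp add: field_simps)
  qed (rule c)
qed

lemma bounded_below_inverse_adj:
  assumes A: "adj Q Q'"
    and d: "\<delta> > 0" "\<And>x. x \<in> carrier H \<Longrightarrow> \<delta> * nm x \<le> nm (Q x)"
    and d': "\<delta>' > 0" "\<And>x. x \<in> carrier H \<Longrightarrow> \<delta>' * nm x \<le> nm (Q' x)"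
  shows "adj (inv_into (carrier H) Q) (inv_into (carrier H) Q')"
proof -
  let ?R = "inv_into (carrier H) Q" and ?R' = "inv_into (carrier H) Q'"
  note R = bounded_below_inverse[OF A d d'] and R' = bounded_below_inverse[OF adj_sym[OF A] d' d]
  have "ip (?R x) y = ip x (?R' y)" if "x \<in> carrier H" "y \<in> carrier H" for x y
  proof -
    have "ip (?R x) y = ip (?R x) (Q' (?R' y))" using R'(3) that by simp
    also have "\<dots> = ip (Q (?R x)) (?R' y)" using that R(1) R'(1) by (simp add: adjD(3)[OF A] bop_cl)
    finally show ?thesis using R(3) that by simp
  qed
  then show ?thesis using R(1) R'(1) by (auto simp: adj_def)
qed

lemma joint_spectrum_mem:
  assumes b: "bop N1" "bop N2" "bop N3"
    and j: "approx_kernel (insert (\<lambda>x. N3 x \<ominus> w3 \<odot> x)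
    (insert (\<lambda>x. N2 x \<ominus> w2 \<odot> x) (insert (\<lambda>x. N1 x \<ominus> w1 \<odot> x) Ys)))"
  shows "(w1, w2, w3) \<in> joint_spectrum H (N1, N2, N3)"
proof (rule ccontr)
  assume "\<not> ?thesis"
  then obtain C where C: "C \<ge> 0" "\<And>x. x \<in> carrier H \<Longrightarrow> nm x \<le> C * gap (N1, N2, N3) (w1, w2, w3) x"
    using outside_joint_spectrum[OF b] by blast
  have "1 / (4 * (C + 1)) > 0" using C by simp
  then obtain x where x: "x \<in> carrier H" "nm x = 1"
    "nm (N1 x \<ominus> w1 \<odot> x) \<le> 1 / (4 * (C + 1))" "nm (N2 x \<ominus> w2 \<odot> x) \<le> 1 / (4 * (C + 1))"
    "nm (N3 x \<ominus> w3 \<odot> x) \<le> 1 / (4 * (C + 1))" by (rule approx_kernel_insert3E[OF j]) auto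
  have "1 \<le> C * gap (N1, N2, N3) (w1, w2, w3) x" using C(2)[OF x(1)] x by simp
  also have "\<dots> \<le> C * (3 * (1 / (4 * (C + 1))))" using x C by (intro mult_left_mono) (auto simp: gap_def)
  also have "\<dots> < 1" using C by (simp add: field_simps)
  finally show False by simp
qed

lemma not_approx_kernel_bounded_below:
  assumes "\<not> approx_kernel {Q}" "bop Q"
  obtains \<delta> where "\<delta> > 0" "\<And>x. x \<in> carrier H \<Longrightarrow> \<delta> * nm x \<le> nm (Q x)"
proof -
  obtain \<delta> where d: "\<delta> > 0" "\<And>x. x \<in> carrier H \<Longrightarrow> nm x = 1 \<Longrightarrow> nm (Q x) > \<delta>"
    using assms(1) unfolding approx_kernel_def by (auto simp: not_le)
  show ?thesis
  proof (rule that[OF d(1)])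
    fix x assume x: "x \<in> carrier H"
    show "\<delta> * nm x \<le> nm (Q x)"
    proof (cases "nm x = 0")
      case True
      then show ?thesis using x assms by (simp add: bop_cl)
    next
      case False
      then have "nm x > 0" using nm_nonneg[OF x] by linarith
      then obtain y where y: "y \<in> carrier H" "nm y = 1" "nm (Q y) = nm (Q x) / nm x"
        using normalize_vector[OF x] assms(2) by metis
      then show ?thesis using d(2)[OF y(1,2)] \<open>nm x > 0\<close> by (simp add: less_divide_eq)
    qed
  qed
qed

text \<open>
  Were \<open>q(N)\<close> or its adjoint not bounded below, localization would give a point \<open>w\<close> of the joint spectrum with
  \<open>q(w) = 0\<close>. Hence \<open>q(N)\<close> is invertible. The last claim is that \<open>f(N)\<close> acts like \<open>f(w)\<close> on joint approximate eigenvectors for \<open>w\<close>.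
\<close>
lemma Rat_calculus:
  assumes n: "normal_pair N1 N1'" "normal_pair N2 N2'" "normal_pair N3 N3'"
    and c: "com N1 N2" "com N1 N3" "com N2 N3"
    and sp: "joint_spectrum H (N1, N2, N3) \<subseteq> \<Omega>" and f: "f \<in> Rat \<Omega>"
  defines "F \<equiv> reval_op H f (N1, N2, N3)"
  shows "\<exists>F'. adj F F'" "com N1 F" "com N2 F" "com N3 F"
    "w \<in> \<Omega> \<Longrightarrow> tracks (gap (N1, N2, N3) w) F (reval f w)"
proof -
  obtain p q where pq: "f = (p, q)" by (cases f)
  have q0: "peval q w \<noteq> 0" if "w \<in> \<Omega>" for w using f that by (auto simp: pq Rat_def)
  have b: "bop N1" "bop N2" "bop N3" and a: "adj N1 N1'" "adj N2 N2'" "adj N3 N3'"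
    using n by (auto simp: normal_pair_def dest: adjD)
  have c': "com N2 N1" "com N3 N1" "com N3 N2" using c by (auto intro: com_sym)
  define P where "P = peval_op H p (N1, N2, N3)"
  define Q where "Q = peval_op H q (N1, N2, N3)"
  obtain P' where P': "adj P P'" using adj_peval_op[OF a, of p] unfolding P_def by blast
  obtain Q' where Q': "adj Q Q'" using adj_peval_op[OF a, of q] unfolding Q_def by blast
  have bPQ: "bop P" "bop Q" "bop Q'" using P' Q' adjD by auto
  have cP: "com N1 P" "com N2 P" "com N3 P"
    unfolding P_def using b c c' by (auto intro!: com_peval_op simp: com_refl simp del: peval_op.simps)
  have cQ: "com N1 Q" "com N2 Q" "com N3 Q"
    unfolding Q_def using b c c' by (auto intro!: com_peval_op simp: com_refl simp del: peval_op.simps)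
  have cQ': "com N Q'" if "normal_pair N N'" "com N Q" for N N'
  proof -
    have "com Q N'" using fuglede[OF that(1) bPQ(2)] that(2) com_sym by blast
    then show ?thesis using com_adj[OF _ Q', of N' N] that(1) com_sym normal_pair_sym[OF that(1)] by (auto simp: normal_pair_def)
  qed
  have tQ: "tracks (gap (N1, N2, N3) w) Q (peval q w)" for w unfolding Q_def by (rule tracks_peval_op[OF b])
  \<comment> \<open>Applied to \<open>Y = q(N)\<close> and to its adjoint: the estimate makes \<open>q(w)\<close> vanish at the point \<open>w\<close> found by localization.\<close>
  have loc: False if Y: "bop Y" "com N1 Y" "com N2 Y" "com N3 Y" "approx_kernel {Y}"
    and est: "\<And>x w. x \<in> carrier H \<Longrightarrow> nm x = 1 \<Longrightarrow> cmod (peval q w) \<le> nm (Y x) + nm (Q x \<ominus> peval q w \<odot> x)" for Y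
  proof -
    obtain w1 w2 w3 where w: "approx_kernel (insert (\<lambda>x. N3 x \<ominus> w3 \<odot> x)
      (insert (\<lambda>x. N2 x \<ominus> w2 \<odot> x) (insert (\<lambda>x. N1 x \<ominus> w1 \<odot> x) {Y})))"
      by (rule triple_localize[of "{Y}", OF _ _ n c Y(5)]) (use Y in auto)
    define w where "w = (w1, w2, w3)"
    have "w \<in> \<Omega>" using joint_spectrum_mem[OF b w] sp by (auto simp: w_def)
    then have pos: "cmod (peval q w) > 0" using q0 by simp
    obtain C where C: "C \<ge> 0" "\<And>x. x \<in> carrier H \<Longrightarrow> nm (Q x \<ominus> peval q w \<odot> x) \<le> C * gap (N1, N2, N3) w x"
      using tracksE[OF tQ] by blast
    define k where "k = 3 * C + 1"
    have k: "k > 0" using C by (simp add: k_def)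
    define e where "e = cmod (peval q w) / 2 / k"
    have e: "e > 0" using pos k by (simp add: e_def)
    obtain x where x: "x \<in> carrier H" "nm x = 1" "nm (Y x) \<le> e"
      "nm (N1 x \<ominus> w1 \<odot> x) \<le> e" "nm (N2 x \<ominus> w2 \<odot> x) \<le> e" "nm (N3 x \<ominus> w3 \<odot> x) \<le> e" by (rule approx_kernel_insert3E[OF w e]) auto
    have "nm (Q x \<ominus> peval q w \<odot> x) \<le> C * (3 * e)"
      using C x by (intro order_trans[OF C(2)[OF x(1)]] mult_left_mono) (auto simp: gap_def w_def)
    then have "cmod (peval q w) \<le> e + C * (3 * e)" using est[OF x(1,2), of w] x by linarith
    also have "\<dots> = k * e" by (simp add: k_def algebra_simps)
    also have "\<dots> = cmod (peval q w) / 2" using k by (simp add: e_def)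
    finally show False using pos by simp
  qed
  have nj: "\<not> approx_kernel {Q}"
  proof
    assume j: "approx_kernel {Q}"
    show False
    proof (rule loc[OF bPQ(2) cQ j])
      fix x w assume x: "x \<in> carrier H" "nm x = 1"
      have "cmod (peval q w) = nm (peval q w \<odot> x)" using x by (simp add: nm_smult)
      also have "\<dots> \<le> nm (peval q w \<odot> x \<ominus> Q x) + nm (Q x)" using x bPQ by (intro nm_le_add_minus) (auto simp: bop_cl)
      also have "nm (peval q w \<odot> x \<ominus> Q x) = nm (Q x \<ominus> peval q w \<odot> x)" using x bPQ by (intro nm_minus_sym) (auto simp: bop_cl)
      finally show "cmod (peval q w) \<le> nm (Q x) + nm (Q x \<ominus> peval q w \<odot> x)" by simp
    qed
  qed
  have nj': "\<not> approx_kernel {Q'}"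
  proof
    assume j: "approx_kernel {Q'}"
    show False
    proof (rule loc[OF bPQ(3) cQ'[OF n(1) cQ(1)] cQ'[OF n(2) cQ(2)] cQ'[OF n(3) cQ(3)] j])
      fix x w assume x: "x \<in> carrier H" "nm x = 1"
      have "peval q w = ip x (Q' x) - ip (Q x \<ominus> peval q w \<odot> x) x"
        using x bPQ by (simp add: adjD(3)[OF Q', symmetric] ip_simps bop_cl ip_self[of x])
      then have "cmod (peval q w) \<le> cmod (ip x (Q' x)) + cmod (ip (Q x \<ominus> peval q w \<odot> x) x)"
        by (metis norm_triangle_ineq4)
      also have "\<dots> \<le> nm x * nm (Q' x) + nm (Q x \<ominus> peval q w \<odot> x) * nm x"
        using x bPQ by (intro add_mono cauchy_schwarz) (auto simp: bop_cl)
      finally show "cmod (peval q w) \<le> nm (Q' x) + nm (Q x \<ominus> peval q w \<odot> x)" using x by simp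
    qed
  qed
  obtain \<delta> where d: "\<delta> > 0" "\<And>x. x \<in> carrier H \<Longrightarrow> \<delta> * nm x \<le> nm (Q x)"
    using not_approx_kernel_bounded_below[OF nj bPQ(2)] by blast
  obtain \<delta>' where d': "\<delta>' > 0" "\<And>x. x \<in> carrier H \<Longrightarrow> \<delta>' * nm x \<le> nm (Q' x)"
    using not_approx_kernel_bounded_below[OF nj' bPQ(3)] by blast
  define R where "R = inv_into (carrier H) Q"
  note R = bounded_below_inverse[OF Q' d d', folded R_def]
  have F: "F = (\<lambda>x. P (R x))"
    by (auto simp: F_def pq P_def Q_def R_def simp del: peval_op.simps)
  show "\<exists>F'. adj F F'"
    unfolding F using adj_comp[OF P' bounded_below_inverse_adj[OF Q' d d', folded R_def]] by blast
  have cR: "com N R" if "bop N" "com N Q" for N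
    unfolding com_def
  proof
    fix x assume x: "x \<in> carrier H"
    have "N (R x) = R (Q (N (R x)))" using x R that by (simp add: bop_cl)
    also have "Q (N (R x)) = N (Q (R x))" using comD[OF that(2), of "R x"] x R by (simp add: bop_cl)
    finally show "N (R x) = R (N x)" using x R by simp
  qed
  show "com N1 F" unfolding F by (rule com_comp[OF b(1) bPQ(1) R(1) cP(1) cR[OF b(1) cQ(1)]])
  show "com N2 F" unfolding F by (rule com_comp[OF b(2) bPQ(1) R(1) cP(2) cR[OF b(2) cQ(2)]])
  show "com N3 F" unfolding F by (rule com_comp[OF b(3) bPQ(1) R(1) cP(3) cR[OF b(3) cQ(3)]])
  assume w: "w \<in> \<Omega>"
  have "tracks (gap (N1, N2, N3) w) F (peval p w * (1 / peval q w))"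
    unfolding F by (rule tracks_comp[OF _ tracks_inverse[OF tQ R(1,2) q0[OF w]]]) (auto simp: P_def intro!: tracks_peval_op b simp del: peval_op.simps)
  then show "tracks (gap (N1, N2, N3) w) F (reval f w)" by (simp add: pq)
qed

end

section \<open>Matrices of operators\<close>

lemma hpow_simps:
  "carrier (hpow k H) = {v. dim_vec v = k \<and> (\<forall>i<k. v $ i \<in> carrier H)}"
  "\<zero>\<^bsub>hpow k H\<^esub> = vec k (\<lambda>_. \<zero>\<^bsub>H\<^esub>)"
  "v \<oplus>\<^bsub>hpow k H\<^esub> w = vec k (\<lambda>i. v $ i \<oplus>\<^bsub>H\<^esub> w $ i)"
  "c \<odot>\<^bsub>hpow k H\<^esub> v = vec k (\<lambda>i. c \<odot>\<^bsub>H\<^esub> v $ i)"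
  "cinner (hpow k H) v w = (\<Sum>i<k. cinner H (v $ i) (w $ i))"
  by (simp_all add: hpow_def)

context pre_hilbert
begin

lemma abelian_group_hpow: "abelian_group (hpow k H)"
proof (rule abelian_groupI)
  fix v assume v: "v \<in> carrier (hpow k H)"
  show "\<exists>y\<in>carrier (hpow k H). y \<oplus>\<^bsub>hpow k H\<^esub> v = \<zero>\<^bsub>hpow k H\<^esub>"
    by (rule bexI[of _ "vec k (\<lambda>i. \<ominus> (v $ i))"]) (use v in \<open>auto simp: hpow_simps l_neg\<close>)
qed (auto simp: hpow_simps a_assoc intro!: eq_vecI a_comm)

lemma pre_hilbert_hpow: "pre_hilbert (hpow k H)"
proof -
  interpret P: abelian_group "hpow k H" by (rule abelian_group_hpow)
  have "module (class_ring :: complex ring) (hpow k H)"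
  proof (rule moduleI)
    show "cring (class_ring :: complex ring)" by (rule R.is_cring)
    show "abelian_group (hpow k H)" by (rule abelian_group_hpow)
  qed (auto simp: hpow_simps ip_simps algebra_simps intro!: ip_ext)
  then interpret M: module "class_ring :: complex ring" "hpow k H" .
  show ?thesis
  proof unfold_locales
    fix x assume x: "x \<in> carrier (hpow k H)"
    show "0 \<le> Re (cinner (hpow k H) x x)"
      using x by (auto simp: hpow_simps intro!: sum_nonneg ip_ge_zero)
    assume "cinner (hpow k H) x x = 0"
    then have "(\<Sum>i<k. complex_of_real ((nm (x $ i))\<^sup>2)) = 0"
      using x by (simp add: hpow_simps ip_self)
    then have "(\<Sum>i<k. (nm (x $ i))\<^sup>2) = 0"
      by (simp only: of_real_sum[symmetric] of_real_eq_0_iff)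
    then have "nm (x $ i) = 0" if "i < k" for i
      using that by (simp add: sum_nonneg_eq_0_iff)
    then have "x $ i = \<zero>" if "i < k" for i
      using that x nm_eq_0[of "x $ i"] by (auto simp: hpow_simps)
    then show "x = \<zero>\<^bsub>hpow k H\<^esub>" using x by (intro eq_vecI) (auto simp: hpow_simps)
  next
    fix x y assume xy: "x \<in> carrier (hpow k H)" "y \<in> carrier (hpow k H)"
    have "cnj (cinner (hpow k H) y x) = (\<Sum>i<k. cnj (ip (y $ i) (x $ i)))" by (simp add: hpow_simps)
    also have "\<dots> = cinner (hpow k H) x y"
      unfolding hpow_simps using xy by (intro sum.cong refl ip_commute[symmetric]) (auto simp: hpow_simps)
    finally show "cinner (hpow k H) x y = cnj (cinner (hpow k H) y x)" by simp
  qed (auto simp: hpow_simps ip_simps sum.distrib sum_distrib_left)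
qed

lemma hpow_norm_sq:
  assumes "v \<in> carrier (hpow k H)"
  shows "(hnorm (hpow k H) v)\<^sup>2 = (\<Sum>i<k. (nm (v $ i))\<^sup>2)"
proof -
  interpret P: pre_hilbert "hpow k H" by (rule pre_hilbert_hpow)
  show ?thesis using assms by (simp add: P.nm_sq) (simp add: hpow_simps ip_self flip: of_real_power)
qed

lemma hpow_minus_component:
  assumes "v \<in> carrier (hpow k H)" "w \<in> carrier (hpow k H)" "i < k"
  shows "(v \<ominus>\<^bsub>hpow k H\<^esub> w) $ i = v $ i \<ominus> w $ i"
proof -
  interpret P: pre_hilbert "hpow k H" by (rule pre_hilbert_hpow)
  have "v \<ominus>\<^bsub>hpow k H\<^esub> w = v \<oplus>\<^bsub>hpow k H\<^esub> (-1) \<odot>\<^bsub>hpow k H\<^esub> w" using assms by (intro P.minus_smult)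
  then show ?thesis using assms by (simp add: hpow_simps minus_smult)
qed

lemma hpow_component_le:
  assumes "v \<in> carrier (hpow k H)" "i < k"
  shows "nm (v $ i) \<le> hnorm (hpow k H) v"
proof (rule power2_le_imp_le)
  interpret P: pre_hilbert "hpow k H" by (rule pre_hilbert_hpow)
  show "(nm (v $ i))\<^sup>2 \<le> (hnorm (hpow k H) v)\<^sup>2"
    using assms by (simp only: hpow_norm_sq) (intro member_le_sum, auto)
  show "0 \<le> hnorm (hpow k H) v" using assms by simp
qed

lemma hpow_norm_le_sum:
  assumes "v \<in> carrier (hpow k H)"
  shows "hnorm (hpow k H) v \<le> (\<Sum>i<k. nm (v $ i))"
proof (rule power2_le_imp_le)
  have n: "0 \<le> nm (v $ i)" if "i < k" for i using assms that by (auto simp: hpow_simps)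
  then show "0 \<le> (\<Sum>i<k. nm (v $ i))" by (intro sum_nonneg) auto
  have "(\<Sum>i<j. (nm (v $ i))\<^sup>2) \<le> (\<Sum>i<j. nm (v $ i))\<^sup>2" if "j \<le> k" for j
    using that
  proof (induction j)
    case (Suc j)
    have "(\<Sum>i<Suc j. (nm (v $ i))\<^sup>2) \<le> (\<Sum>i<j. nm (v $ i))\<^sup>2 + (nm (v $ j))\<^sup>2" using Suc by simp
    also have "0 \<le> nm (v $ j) * (\<Sum>i<j. nm (v $ i))"
      using Suc.prems n by (intro mult_nonneg_nonneg sum_nonneg) auto
    then have "(\<Sum>i<j. nm (v $ i))\<^sup>2 + (nm (v $ j))\<^sup>2 \<le> (\<Sum>i<Suc j. nm (v $ i))\<^sup>2"
      by (simp add: power2_sum mult.commute)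
    finally show ?case .
  qed simp
  then show "(hnorm (hpow k H) v)\<^sup>2 \<le> (\<Sum>i<k. nm (v $ i))\<^sup>2" using assms by (simp add: hpow_norm_sq)
qed

definition diag_op :: "nat \<Rightarrow> ('a \<Rightarrow> 'a) \<Rightarrow> 'a vec \<Rightarrow> 'a vec" where
  "diag_op k X v = vec k (\<lambda>i. X (v $ i))"

text \<open>
  This is the shape of \<^const>\<open>mat_reval_op\<close> with the entries as arbitrary operators, which makes room for the
  matrix of adjoints.
\<close>
definition matrix_op :: "nat \<Rightarrow> (nat \<Rightarrow> nat \<Rightarrow> 'a \<Rightarrow> 'a) \<Rightarrow> 'a vec \<Rightarrow> 'a vec" where
  "matrix_op k X v = vec k (\<lambda>i. finsum H (\<lambda>j. X i j (v $ j)) {..<k})"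

lemma matrix_op_component_closed:
  assumes "\<And>i j. i < k \<Longrightarrow> j < k \<Longrightarrow> bop (X i j)" "v \<in> carrier (hpow k H)" "i < k"
  shows "finsum H (\<lambda>j. X i j (v $ j)) {..<k} \<in> carrier H"
  using assms by (intro finsum_closed) (auto simp: hpow_simps bop_cl)

lemma finsum_add_distrib:
  assumes "finite A" "\<And>i. i \<in> A \<Longrightarrow> f i \<in> carrier H" "\<And>i. i \<in> A \<Longrightarrow> g i \<in> carrier H"
  shows "finsum H (\<lambda>i. f i \<oplus> g i) A = finsum H f A \<oplus> finsum H g A"
proof (rule ip_ext)
  have "finsum H f A \<in> carrier H" "finsum H g A \<in> carrier H" "finsum H (\<lambda>i. f i \<oplus> g i) A \<in> carrier H"
    using assms by (auto intro!: finsum_closed)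
  then show "finsum H (\<lambda>i. f i \<oplus> g i) A \<in> carrier H" "finsum H f A \<oplus> finsum H g A \<in> carrier H"
    "\<And>z. z \<in> carrier H \<Longrightarrow> ip (finsum H (\<lambda>i. f i \<oplus> g i) A) z = ip (finsum H f A \<oplus> finsum H g A) z"
    using assms by (auto simp: ip_finsum_left ip_simps sum.distrib)
qed

lemma finsum_smult_distrib:
  assumes "finite A" "\<And>i. i \<in> A \<Longrightarrow> f i \<in> carrier H"
  shows "finsum H (\<lambda>i. c \<odot> f i) A = c \<odot> finsum H f A"
  by (rule bop_of_finsum[OF bop_smult_op[OF bop_id], symmetric]) (use assms in auto)

lemma nm_finsum_le:
  assumes "finite A" "\<And>i. i \<in> A \<Longrightarrow> f i \<in> carrier H"
  shows "nm (finsum H f A) \<le> (\<Sum>i\<in>A. nm (f i))"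
  using assms
proof (induction A rule: finite_induct)
  case (insert i A)
  then have *: "finsum H f (insert i A) = f i \<oplus> finsum H f A" "finsum H f A \<in> carrier H"
    by (auto intro!: finsum_insert finsum_closed)
  then have "nm (finsum H f (insert i A)) \<le> nm (f i) + nm (finsum H f A)"
    using insert by (simp add: nm_triangle)
  then show ?case using insert by simp
qed simp

lemma bop_matrix_op:
  assumes X: "\<And>i j. i < k \<Longrightarrow> j < k \<Longrightarrow> bop (X i j)"
  shows "bounded_op (hpow k H) (hpow k H) (matrix_op k X)"
proof -
  interpret P: pre_hilbert "hpow k H" by (rule pre_hilbert_hpow)
  have "\<forall>i j. \<exists>C\<ge>0. i < k \<and> j < k \<longrightarrow> (\<forall>x\<in>carrier H. nm (X i j x) \<le> C * nm x)"
  proof (intro allI)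
    fix i j
    show "\<exists>C\<ge>0. i < k \<and> j < k \<longrightarrow> (\<forall>x\<in>carrier H. nm (X i j x) \<le> C * nm x)"
    proof (cases "i < k \<and> j < k")
      case True
      then obtain C where "C > 0" "\<And>x. x \<in> carrier H \<Longrightarrow> nm (X i j x) \<le> C * nm x"
        using X bop_bound by blast
      then show ?thesis by (intro exI[of _ C]) auto
    qed auto
  qed
  then obtain C where C: "\<And>i j. C i j \<ge> 0" "\<And>i j x. i < k \<Longrightarrow> j < k \<Longrightarrow> x \<in> carrier H \<Longrightarrow> nm (X i j x) \<le> C i j * nm x"
    by metis
  have cl: "matrix_op k X v \<in> carrier (hpow k H)" if "v \<in> carrier (hpow k H)" for v
    using matrix_op_component_closed[of k X, OF X that] by (simp add: hpow_simps matrix_op_def)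
  show ?thesis
  proof (rule P.bopI[where C="\<Sum>i<k. \<Sum>j<k. C i j"])
    fix v assume v: "v \<in> carrier (hpow k H)"
    then show "matrix_op k X v \<in> carrier (hpow k H)" by (rule cl)
    have "hnorm (hpow k H) (matrix_op k X v) \<le> (\<Sum>i<k. nm (matrix_op k X v $ i))" by (rule hpow_norm_le_sum[OF cl[OF v]])
    also have "\<dots> \<le> (\<Sum>i<k. \<Sum>j<k. C i j * hnorm (hpow k H) v)"
    proof (rule sum_mono)
      fix i assume i: "i \<in> {..<k}"
      have "nm (matrix_op k X v $ i) \<le> (\<Sum>j<k. nm (X i j (v $ j)))"
        using i v X by (auto simp: matrix_op_def hpow_simps bop_cl intro!: nm_finsum_le)
      also have "\<dots> \<le> (\<Sum>j<k. C i j * hnorm (hpow k H) v)"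
        using i v by (intro sum_mono order_trans[OF C(2)] mult_left_mono hpow_component_le C(1)) (auto simp: hpow_simps)
      finally show "nm (matrix_op k X v $ i) \<le> (\<Sum>j<k. C i j * hnorm (hpow k H) v)" .
    qed
    also have "\<dots> = (\<Sum>i<k. \<Sum>j<k. C i j) * hnorm (hpow k H) v" by (simp add: sum_distrib_right)
    finally show "hnorm (hpow k H) (matrix_op k X v) \<le> (\<Sum>i<k. \<Sum>j<k. C i j) * hnorm (hpow k H) v" .
  next
    fix v w assume vw: "v \<in> carrier (hpow k H)" "w \<in> carrier (hpow k H)"
    show "matrix_op k X (v \<oplus>\<^bsub>hpow k H\<^esub> w) = matrix_op k X v \<oplus>\<^bsub>hpow k H\<^esub> matrix_op k X w"
    proof (rule eq_vecI)
      fix i assume "i < dim_vec (matrix_op k X v \<oplus>\<^bsub>hpow k H\<^esub> matrix_op k X w)"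
      then have i: "i < k" by (simp add: hpow_simps)
      have "finsum H (\<lambda>j. X i j (v $ j \<oplus> w $ j)) {..<k} = finsum H (\<lambda>j. X i j (v $ j) \<oplus> X i j (w $ j)) {..<k}"
        using i vw X by (intro finsum_cong') (auto simp: hpow_simps bop_add bop_cl)
      also have "\<dots> = finsum H (\<lambda>j. X i j (v $ j)) {..<k} \<oplus> finsum H (\<lambda>j. X i j (w $ j)) {..<k}"
        using i vw X by (intro finsum_add_distrib) (auto simp: hpow_simps bop_cl)
      finally have *: "finsum H (\<lambda>j. X i j (v $ j \<oplus> w $ j)) {..<k}
        = finsum H (\<lambda>j. X i j (v $ j)) {..<k} \<oplus> finsum H (\<lambda>j. X i j (w $ j)) {..<k}" .
      have "finsum H (\<lambda>j. X i j ((v \<oplus>\<^bsub>hpow k H\<^esub> w) $ j)) {..<k} = finsum H (\<lambda>j. X i j (v $ j \<oplus> w $ j)) {..<k}"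
        using i vw X by (intro finsum_cong') (auto simp: hpow_simps bop_cl)
      then show "matrix_op k X (v \<oplus>\<^bsub>hpow k H\<^esub> w) $ i = (matrix_op k X v \<oplus>\<^bsub>hpow k H\<^esub> matrix_op k X w) $ i"
        using i * by (simp add: matrix_op_def hpow_simps(3))
    qed (simp add: matrix_op_def hpow_simps)
  next
    fix c v assume v: "v \<in> carrier (hpow k H)"
    show "matrix_op k X (c \<odot>\<^bsub>hpow k H\<^esub> v) = c \<odot>\<^bsub>hpow k H\<^esub> matrix_op k X v"
    proof (rule eq_vecI)
      fix i assume "i < dim_vec (c \<odot>\<^bsub>hpow k H\<^esub> matrix_op k X v)"
      then have i: "i < k" by (simp add: hpow_simps)
      have "finsum H (\<lambda>j. X i j ((c \<odot>\<^bsub>hpow k H\<^esub> v) $ j)) {..<k} = finsum H (\<lambda>j. c \<odot> X i j (v $ j)) {..<k}"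
        using i v X by (intro finsum_cong') (auto simp: hpow_simps bop_smult bop_cl)
      also have "\<dots> = c \<odot> finsum H (\<lambda>j. X i j (v $ j)) {..<k}"
        using i v X by (intro finsum_smult_distrib) (auto simp: hpow_simps bop_cl)
      finally show "matrix_op k X (c \<odot>\<^bsub>hpow k H\<^esub> v) $ i = (c \<odot>\<^bsub>hpow k H\<^esub> matrix_op k X v) $ i"
        using i by (simp add: matrix_op_def hpow_simps(4))
    qed (simp add: matrix_op_def hpow_simps)
  qed
qed

lemma adj_matrix_op:
  assumes X: "\<And>i j. i < k \<Longrightarrow> j < k \<Longrightarrow> adj (X i j) (X' i j)"
  shows "pre_hilbert.adj (hpow k H) (matrix_op k X) (matrix_op k (\<lambda>i j. X' j i))"
proof -
  interpret P: pre_hilbert "hpow k H" by (rule pre_hilbert_hpow)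
  have b: "bop (X i j)" "bop (X' i j)" if "i < k" "j < k" for i j using X[OF that] adjD by auto
  show ?thesis
    unfolding P.adj_def
  proof (intro conjI ballI bop_matrix_op b)
    fix v w assume v: "v \<in> carrier (hpow k H)" and w: "w \<in> carrier (hpow k H)"
    have "cinner (hpow k H) (matrix_op k X v) w = (\<Sum>i<k. \<Sum>j<k. ip (X i j (v $ j)) (w $ i))"
      using v w b by (auto simp: hpow_simps matrix_op_def bop_cl intro!: sum.cong ip_finsum_left)
    also have "\<dots> = (\<Sum>i<k. \<Sum>j<k. ip (v $ j) (X' i j (w $ i)))"
      using v w by (intro sum.cong refl adjD(3) X) (auto simp: hpow_simps)
    also have "\<dots> = (\<Sum>j<k. \<Sum>i<k. ip (v $ j) (X' i j (w $ i)))" by (rule sum.swap)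
    also have "\<dots> = cinner (hpow k H) v (matrix_op k (\<lambda>i j. X' j i) w)"
      using v w b by (auto simp: hpow_simps matrix_op_def bop_cl intro!: sum.cong ip_finsum_right[symmetric])
    finally show "cinner (hpow k H) (matrix_op k X v) w = cinner (hpow k H) v (matrix_op k (\<lambda>i j. X' j i) w)" .
  qed auto
qed

lemma diag_op_carrier: "bop X \<Longrightarrow> v \<in> carrier (hpow k H) \<Longrightarrow> diag_op k X v \<in> carrier (hpow k H)"
  by (simp add: diag_op_def hpow_simps bop_cl)

lemma bop_diag_op: assumes X: "bop X" shows "bounded_op (hpow k H) (hpow k H) (diag_op k X)"
proof -
  interpret P: pre_hilbert "hpow k H" by (rule pre_hilbert_hpow)
  obtain C where C: "C > 0" "\<And>x. x \<in> carrier H \<Longrightarrow> nm (X x) \<le> C * nm x" using bop_bound[OF X] by blast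
  show ?thesis
  proof (rule P.bopI[where C=C])
    fix v assume v: "v \<in> carrier (hpow k H)"
    show "hnorm (hpow k H) (diag_op k X v) \<le> C * hnorm (hpow k H) v"
    proof (rule power2_le_imp_le)
      have "(hnorm (hpow k H) (diag_op k X v))\<^sup>2 = (\<Sum>i<k. (nm (X (v $ i)))\<^sup>2)"
        using v X by (simp add: hpow_norm_sq diag_op_carrier) (simp add: diag_op_def)
      also have "\<dots> \<le> (\<Sum>i<k. (C * nm (v $ i))\<^sup>2)"
        using v X by (intro sum_mono power_mono C nm_nonneg) (auto simp: hpow_simps bop_cl)
      also have "\<dots> = (C * hnorm (hpow k H) v)\<^sup>2"
        using v by (simp add: power_mult_distrib hpow_norm_sq sum_distrib_left)
      finally show "(hnorm (hpow k H) (diag_op k X v))\<^sup>2 \<le> (C * hnorm (hpow k H) v)\<^sup>2" .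
    qed (use C v in auto)
  qed (use X in \<open>auto simp: diag_op_def hpow_simps bop_cl bop_add bop_smult\<close>)
qed

lemma normal_pair_diag_op:
  assumes "normal_pair N N'" shows "pre_hilbert.normal_pair (hpow k H) (diag_op k N) (diag_op k N')"
proof -
  interpret P: pre_hilbert "hpow k H" by (rule pre_hilbert_hpow)
  have a: "adj N N'" "com N N'" "bop N" "bop N'" using assms by (auto simp: normal_pair_def dest: adjD)
  show ?thesis unfolding P.normal_pair_def P.adj_def P.com_def
    using a by (auto intro!: bop_diag_op) (auto simp: diag_op_def hpow_simps adjD(3)[OF a(1)] comD[OF a(2)])
qed

lemma com_diag_op_matrix_op:
  assumes N: "bop N" and X: "\<And>i j. i < k \<Longrightarrow> j < k \<Longrightarrow> bop (X i j) \<and> com N (X i j)"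
  shows "pre_hilbert.com (hpow k H) (diag_op k N) (matrix_op k X)"
proof -
  interpret P: pre_hilbert "hpow k H" by (rule pre_hilbert_hpow)
  show ?thesis unfolding P.com_def
  proof
    fix v assume v: "v \<in> carrier (hpow k H)"
    show "diag_op k N (matrix_op k X v) = matrix_op k X (diag_op k N v)"
    proof (rule eq_vecI)
      fix i assume "i < dim_vec (matrix_op k X (diag_op k N v))"
      then have i: "i < k" by (simp add: matrix_op_def)
      have "N (finsum H (\<lambda>j. X i j (v $ j)) {..<k}) = finsum H (\<lambda>j. N (X i j (v $ j))) {..<k}"
        using i v X N by (intro bop_of_finsum) (auto simp: hpow_simps bop_cl)
      also have "\<dots> = finsum H (\<lambda>j. X i j (diag_op k N v $ j)) {..<k}"
        using i v X N by (intro finsum_cong') (auto simp: hpow_simps bop_cl diag_op_def com_def)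
      finally show "diag_op k N (matrix_op k X v) $ i = matrix_op k X (diag_op k N v) $ i" using i by (simp add: diag_op_def matrix_op_def)
    qed (simp add: diag_op_def matrix_op_def)
  qed
qed

lemma com_diag_op:
  assumes "com N M" shows "pre_hilbert.com (hpow k H) (diag_op k N) (diag_op k M)"
proof -
  interpret P: pre_hilbert "hpow k H" by (rule pre_hilbert_hpow)
  show ?thesis unfolding P.com_def using assms by (auto simp: diag_op_def hpow_simps com_def)
qed

end

section \<open>Von Neumann's inequality for matrices of rational functions\<close>

context pre_hilbert
begin

lemma pythagoras:
  assumes "e \<in> carrier H" "nm e = 1" "y \<in> carrier H" "ip y e = 0"
  shows "(nm (a \<odot> e \<oplus> y))\<^sup>2 = (cmod a)\<^sup>2 + (nm y)\<^sup>2"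
proof -
  have "ip e y = 0" using ip_commute[of e y] assms by simp
  moreover have "ip e e = 1" "ip y y = of_real ((nm y)\<^sup>2)" using assms by (simp_all add: ip_self)
  ultimately have "ip (a \<odot> e \<oplus> y) (a \<odot> e \<oplus> y) = of_real ((cmod a)\<^sup>2 + (nm y)\<^sup>2)"
    using assms by (simp add: ip_simps mult.commute flip: complex_norm_square)
  then show ?thesis using assms by (simp add: nm_sq[of "a \<odot> e \<oplus> y"])
qed

text \<open>
  A scalar matrix has the same norm on \<open>H\<^sup>k\<close> as on \<open>\<complex>\<^sup>k\<close>. Choose a unit vector \<open>e\<close> along one nonzero component; the
  \<open>e\<close>-coordinates of all the components form a vector of \<open>\<complex>\<^sup>k\<close>, the remainders are orthogonal to \<open>e\<close> and have
  fewer nonzero components, and Pythagoras adds the two estimates.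
\<close>
lemma matrix_amplification:
  fixes k :: nat
  assumes C: "\<And>c. (\<Sum>i<k. (cmod (\<Sum>j<k. C i j * c j))\<^sup>2) \<le> M\<^sup>2 * (\<Sum>j<k. (cmod (c j))\<^sup>2)"
    and x: "\<And>j. j < k \<Longrightarrow> x j \<in> carrier H"
  shows "(\<Sum>i<k. (nm (finsum H (\<lambda>j. C i j \<odot> x j) {..<k}))\<^sup>2) \<le> M\<^sup>2 * (\<Sum>j<k. (nm (x j))\<^sup>2)"
  using x
proof (induction "card {j \<in> {..<k}. x j \<noteq> \<zero>}" arbitrary: x rule: less_induct)
  case less
  show ?case
  proof (cases "\<exists>j<k. x j \<noteq> \<zero>")
    case False
    then have "finsum H (\<lambda>j. C i j \<odot> x j) {..<k} = finsum H (\<lambda>j. \<zero>) {..<k}" for i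
      by (intro finsum_cong') (auto intro!: ip_ext simp: ip_simps)
    then have "finsum H (\<lambda>j. C i j \<odot> x j) {..<k} = \<zero>" for i by simp
    then show ?thesis by (simp add: sum_nonneg)
  next
    case True
    then obtain j0 where j0: "j0 < k" "x j0 \<noteq> \<zero>" by blast
    then have x0: "x j0 \<in> carrier H" "nm (x j0) > 0"
      using less.prems nm_eq_0[of "x j0"] nm_nonneg[of "x j0"] by (auto simp: less_le)
    define e where "e = complex_of_real (1 / nm (x j0)) \<odot> x j0"
    have e: "e \<in> carrier H" "nm e = 1" using x0 by (auto simp: e_def nm_smult norm_divide)
    have xe: "x j0 = complex_of_real (nm (x j0)) \<odot> e"
      using x0 by (intro ip_ext) (auto simp: e_def ip_simps)
    have ee: "ip e e = 1" using e by (simp add: ip_self)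
    define x' where "x' = (\<lambda>j. x j \<ominus> ip (x j) e \<odot> e)"
    have x': "x' j \<in> carrier H" "ip (x' j) e = 0" if "j < k" for j
      using less.prems[OF that] e ee by (auto simp: x'_def ip_simps)
    have split: "x j = ip (x j) e \<odot> e \<oplus> x' j" if "j < k" for j
      using less.prems[OF that] e by (intro ip_ext) (auto simp: x'_def ip_simps)
    have norm_x: "(nm (x j))\<^sup>2 = (cmod (ip (x j) e))\<^sup>2 + (nm (x' j))\<^sup>2" if "j < k" for j
      using pythagoras[OF e x'[OF that], of "ip (x j) e"] split[OF that] by simp
    have x'0: "x' j0 = \<zero>"
    proof -
      have "ip (x j0) e = complex_of_real (nm (x j0))" using xe e ee by (metis ip_smult_left mult.right_neutral)
      then show ?thesis unfolding x'_def using xe x0 minus_self by simp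
    qed
    have "{j \<in> {..<k}. x' j \<noteq> \<zero>} \<subset> {j \<in> {..<k}. x j \<noteq> \<zero>}"
    proof
      show "{j \<in> {..<k}. x' j \<noteq> \<zero>} \<subseteq> {j \<in> {..<k}. x j \<noteq> \<zero>}"
        using e by (auto simp: x'_def ip_simps zero_smult minus_self)
      show "{j \<in> {..<k}. x' j \<noteq> \<zero>} \<noteq> {j \<in> {..<k}. x j \<noteq> \<zero>}" using j0 x'0 by blast
    qed
    then have "card {j \<in> {..<k}. x' j \<noteq> \<zero>} < card {j \<in> {..<k}. x j \<noteq> \<zero>}"
      by (rule psubset_card_mono[rotated]) simp
    from less.hyps[OF this] x'(1)
    have IH: "(\<Sum>i<k. (nm (finsum H (\<lambda>j. C i j \<odot> x' j) {..<k}))\<^sup>2) \<le> M\<^sup>2 * (\<Sum>j<k. (nm (x' j))\<^sup>2)" by auto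
    have row: "(nm (finsum H (\<lambda>j. C i j \<odot> x j) {..<k}))\<^sup>2
       = (cmod (\<Sum>j<k. C i j * ip (x j) e))\<^sup>2 + (nm (finsum H (\<lambda>j. C i j \<odot> x' j) {..<k}))\<^sup>2" for i
    proof -
      have cl: "finsum H (\<lambda>j. C i j \<odot> x j) {..<k} \<in> carrier H" "finsum H (\<lambda>j. C i j \<odot> x' j) {..<k} \<in> carrier H"
        using less.prems x' by (auto intro!: finsum_closed)
      have "finsum H (\<lambda>j. C i j \<odot> x j) {..<k}
          = (\<Sum>j<k. C i j * ip (x j) e) \<odot> e \<oplus> finsum H (\<lambda>j. C i j \<odot> x' j) {..<k}"
      proof (rule ip_ext)
        fix z assume z: "z \<in> carrier H"
        have "ip (finsum H (\<lambda>j. C i j \<odot> x j) {..<k}) z = (\<Sum>j<k. C i j * ip (x j) z)"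
          using less.prems z by (subst ip_finsum_left) (auto simp: ip_simps)
        also have "\<dots> = (\<Sum>j<k. C i j * ip (x j) e * ip e z + C i j * ip (x' j) z)"
          using less.prems z e by (intro sum.cong) (auto simp: x'_def ip_simps algebra_simps)
        also have "\<dots> = ip ((\<Sum>j<k. C i j * ip (x j) e) \<odot> e \<oplus> finsum H (\<lambda>j. C i j \<odot> x' j) {..<k}) z"
          using z e cl x' by (simp add: ip_simps sum.distrib sum_distrib_right, subst ip_finsum_left)
            (auto simp: ip_simps)
        finally show "ip (finsum H (\<lambda>j. C i j \<odot> x j) {..<k}) z
          = ip ((\<Sum>j<k. C i j * ip (x j) e) \<odot> e \<oplus> finsum H (\<lambda>j. C i j \<odot> x' j) {..<k}) z" .
      qed (use cl e in auto)
      moreover have "ip (finsum H (\<lambda>j. C i j \<odot> x' j) {..<k}) e = 0"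
        using e x' by (subst ip_finsum_left) (auto simp: ip_simps)
      ultimately show ?thesis using pythagoras[OF e cl(2)] by simp
    qed
    have "(\<Sum>i<k. (nm (finsum H (\<lambda>j. C i j \<odot> x j) {..<k}))\<^sup>2)
      \<le> M\<^sup>2 * (\<Sum>j<k. (cmod (ip (x j) e))\<^sup>2) + M\<^sup>2 * (\<Sum>j<k. (nm (x' j))\<^sup>2)"
      unfolding row sum.distrib using C IH by (intro add_mono) auto
    also have "\<dots> = M\<^sup>2 * (\<Sum>j<k. (nm (x j))\<^sup>2)"
      by (simp add: norm_x sum.distrib algebra_simps)
    finally show ?thesis .
  qed
qed

lemma adj_bound:
  assumes S: "adj S S'" and m: "\<And>v. v \<in> carrier H \<Longrightarrow> nm (S v) \<le> \<mu> * nm v" and z: "z \<in> carrier H" and "\<mu> \<ge> 0"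
  shows "nm (S' z) \<le> \<mu> * nm z"
proof -
  have b: "bop S" "bop S'" using S adjD by auto
  have "ip (S (S' z)) z = of_real ((nm (S' z))\<^sup>2)" using z b by (simp add: adjD(3)[OF S] bop_cl ip_self)
  then have "cmod (ip (S (S' z)) z) = (nm (S' z))\<^sup>2" by (metis abs_power2 norm_of_real)
  then have "nm (S' z) * nm (S' z) \<le> nm (S (S' z)) * nm z"
    using cauchy_schwarz[of "S (S' z)" z] z b by (simp add: bop_cl power2_eq_square)
  also have "\<dots> \<le> \<mu> * nm (S' z) * nm z" using z b by (intro mult_right_mono m) (auto simp: bop_cl)
  finally have *: "nm (S' z) * nm (S' z) \<le> (\<mu> * nm z) * nm (S' z)" by (simp add: mult_ac)
  show ?thesis
  proof (cases "nm (S' z) = 0")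
    case False
    then have "nm (S' z) > 0" using z b by (simp add: less_le bop_cl)
    with * show ?thesis by simp
  qed (use assms in simp)
qed

text \<open>
  With \<open>\<mu>\<close> the norm of \<open>S\<close>, unit vectors \<open>u\<close> with \<open>\<parallel>Su\<parallel>\<close> close to \<open>\<mu>\<close> satisfy \<open>S'Su \<approx> \<mu>\<^sup>2u\<close>.
\<close>
lemma norm_attained_approximately:
  assumes S: "adj S S'" and v: "v \<in> carrier H" "nm (S v) > M * nm v" and M: "M \<ge> 0"
  obtains \<mu> where "\<mu> > M" "approx_kernel {\<lambda>u. S' (S u) \<ominus> complex_of_real (\<mu>\<^sup>2) \<odot> u}"
proof -
  have b: "bop S" "bop S'" using S adjD by auto
  define A where "A = {c. c \<ge> 0 \<and> (\<forall>v\<in>carrier H. nm (S v) \<le> c * nm v)}"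
  obtain C where C: "C > 0" "\<And>x. x \<in> carrier H \<Longrightarrow> nm (S x) \<le> C * nm x" using bop_bound[OF b(1)] by blast
  have CA: "C \<in> A" using C by (simp add: A_def)
  have bdd: "bdd_below A" by (rule bdd_belowI[of _ 0]) (simp add: A_def)
  define \<mu> where "\<mu> = Inf A"
  have m0: "\<mu> \<ge> 0" unfolding \<mu>_def using CA by (intro cInf_greatest) (auto simp: A_def)
  have mS: "nm (S u) \<le> \<mu> * nm u" if u: "u \<in> carrier H" for u
  proof (cases "nm u = 0")
    case True
    then show ?thesis using C(2)[OF u] by simp
  next
    case False
    then have p: "nm u > 0" using u by (simp add: less_le)
    have "nm (S u) / nm u \<le> \<mu>" unfolding \<mu>_def
      using CA u p by (intro cInf_greatest) (auto simp: A_def divide_le_eq)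
    then show ?thesis using p by (simp add: divide_le_eq)
  qed
  have "M * nm v < \<mu> * nm v" using v mS[OF v(1)] by linarith
  then have mM: "\<mu> > M" using v by (simp add: mult_less_cancel_right)
  then have mp: "\<mu> > 0" using M by linarith
  let ?Y = "\<lambda>u. S' (S u) \<ominus> complex_of_real (\<mu>\<^sup>2) \<odot> u"
  have "approx_kernel {?Y}"
  proof (rule approx_kernel_insertI)
    fix e :: real assume e: "e > 0"
    define \<eta> where "\<eta> = min \<mu> (e\<^sup>2 / (4 * \<mu> ^ 3))"
    have eta: "\<eta> > 0" "\<eta> \<le> \<mu>" "4 * \<mu> ^ 3 * \<eta> \<le> e\<^sup>2"
      using e mp by (auto simp: \<eta>_def min_def field_simps)
    have "\<mu> - \<eta> \<notin> A" using cInf_lower[OF _ bdd, of "\<mu> - \<eta>"] eta by (auto simp: \<mu>_def)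
    then obtain u0 where u0: "u0 \<in> carrier H" "nm (S u0) > (\<mu> - \<eta>) * nm u0"
      using eta by (auto simp: A_def not_le)
    have "nm u0 \<noteq> 0"
    proof
      assume "nm u0 = 0"
      then have "nm (S u0) > 0" using u0 by simp
      then show False using mS[OF u0(1)] \<open>nm u0 = 0\<close> by simp
    qed
    then have p0: "nm u0 > 0" using u0 by (simp add: less_le)
    obtain u where u: "u \<in> carrier H" "nm u = 1" "\<And>Y. bop Y \<Longrightarrow> nm (Y u) = nm (Y u0) / nm u0"
      using normalize_vector[OF u0(1) p0] by blast
    have Su: "nm (S u) \<ge> \<mu> - \<eta>" using u0(2) p0 u(3)[OF b(1)] by (simp add: le_divide_eq)
    have Su': "nm (S u) \<le> \<mu>" using mS[OF u(1)] u by simp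
    have "ip (S' (S u)) u = of_real ((nm (S u))\<^sup>2)" "ip u (S' (S u)) = of_real ((nm (S u))\<^sup>2)"
      using u b by (auto simp: adjD(3)[OF S, symmetric] adjD'[OF S, symmetric] bop_cl ip_self)
    then have *: "ip (?Y u) (?Y u) = of_real ((nm (S' (S u)))\<^sup>2 - 2 * \<mu>\<^sup>2 * (nm (S u))\<^sup>2 + \<mu>\<^sup>2 * \<mu>\<^sup>2)"
      using u(1,2) b by (simp add: ip_simps bop_cl) (simp add: ip_self bop_cl algebra_simps)
    have "(nm (?Y u))\<^sup>2 = Re (ip (?Y u) (?Y u))" using u(1) b by (intro nm_sq) (simp add: bop_cl)
    then have "(nm (?Y u))\<^sup>2 = (nm (S' (S u)))\<^sup>2 - 2 * \<mu>\<^sup>2 * (nm (S u))\<^sup>2 + \<mu>\<^sup>2 * \<mu>\<^sup>2"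
      unfolding * by simp
    also have "\<dots> \<le> (\<mu> * nm (S u))\<^sup>2 - 2 * \<mu>\<^sup>2 * (nm (S u))\<^sup>2 + \<mu>\<^sup>2 * \<mu>\<^sup>2"
      using u(1) b adj_bound[OF S mS _ m0, of "S u"] by (intro add_mono diff_mono power_mono) (auto simp: bop_cl)
    also have "\<dots> = \<mu>\<^sup>2 * (\<mu>\<^sup>2 - (nm (S u))\<^sup>2)" by (simp add: power_mult_distrib algebra_simps)
    also have "\<dots> \<le> \<mu>\<^sup>2 * (\<mu>\<^sup>2 - (\<mu> - \<eta>)\<^sup>2)"
      using Su eta by (intro mult_left_mono diff_left_mono power_mono) auto
    also have "\<dots> \<le> \<mu>\<^sup>2 * (4 * \<mu> * \<eta>)"
      using eta by (intro mult_left_mono) (auto simp: power2_eq_square algebra_simps)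
    also have "\<dots> = 4 * \<mu> ^ 3 * \<eta>" by (simp add: power2_eq_square power3_eq_cube)
    also have "\<dots> \<le> e\<^sup>2" by (rule eta(3))
    finally have "nm (?Y u) \<le> e" by (rule power2_le_imp_le) (use e in simp)
    then show "\<exists>x\<in>carrier H. nm x = 1 \<and> nm (?Y x) \<le> e \<and> (\<forall>Y\<in>{}. nm (Y x) \<le> e)" using u by blast
  qed
  then show ?thesis using that mM by blast
qed

end

context hilbert_space
begin

text \<open>
  If the norm \<open>\<mu>\<close> of \<open>f(N)\<close> exceeded \<open>M\<close>, localization of \<open>f(N)\<^sup>* f(N) - \<mu>\<^sup>2\<close> along the diagonal operators
  \<open>N\<^sub>1, N\<^sub>2, N\<^sub>3\<close> of \<open>H\<^sup>k\<close> would produce unit vectors on which \<open>f(N)\<close> has norm almost \<open>\<mu>\<close> and is almost the scalar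
  matrix \<open>f(w)\<close>, for a point \<open>w\<close> of the joint spectrum. But \<open>f(w)\<close> has norm at most \<open>M\<close>.
\<close>
lemma von_neumann_inequality:
  fixes f :: "nat \<Rightarrow> nat \<Rightarrow> cratfun3"
  assumes n: "normal_pair N1 N1'" "normal_pair N2 N2'" "normal_pair N3 N3'"
    and c: "com N1 N2" "com N1 N3" "com N2 N3"
    and sp: "joint_spectrum H (N1, N2, N3) \<subseteq> \<Omega>"
    and f: "\<And>i j. i < k \<Longrightarrow> j < k \<Longrightarrow> f i j \<in> Rat \<Omega>" and M: "M \<ge> 0"
    and bound: "\<And>w c. w \<in> \<Omega> \<Longrightarrow>
      (\<Sum>i<k. (cmod (\<Sum>j<k. reval (f i j) w * c j))\<^sup>2) \<le> M\<^sup>2 * (\<Sum>j<k. (cmod (c j))\<^sup>2)"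
    and v: "v \<in> carrier (hpow k H)"
  shows "hnorm (hpow k H) (matrix_op k (\<lambda>i j. reval_op H (f i j) (N1, N2, N3)) v) \<le> M * hnorm (hpow k H) v"
proof (rule ccontr)
  interpret P: pre_hilbert "hpow k H" by (rule pre_hilbert_hpow)
  define X where "X = (\<lambda>i j. reval_op H (f i j) (N1, N2, N3))"
  define S where "S = matrix_op k X"
  assume "\<not> ?thesis"
  then have big: "P.nm (S v) > M * P.nm v" by (simp add: S_def X_def)
  have b: "bop N1" "bop N2" "bop N3" using n by (auto simp: normal_pair_def dest: adjD)
  note calc = Rat_calculus[OF n c sp f, folded X_def]
  have Xc: "(\<exists>X'. adj (X i j) X') \<and> com N1 (X i j) \<and> com N2 (X i j) \<and> com N3 (X i j)" if "i < k" "j < k" for i j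
    using calc(1-4)[OF that] unfolding X_def by blast
  have tX: "tracks (gap (N1, N2, N3) w) (X i j) (reval (f i j) w)" if "i < k" "j < k" "w \<in> \<Omega>" for i j w
    using calc(5)[OF that] unfolding X_def .
  have "\<forall>i j. \<exists>X'. i < k \<and> j < k \<longrightarrow> adj (X i j) X'" using Xc by blast
  then obtain X' where X': "\<And>i j. i < k \<Longrightarrow> j < k \<Longrightarrow> adj (X i j) (X' i j)" by metis
  have bX: "bop (X i j)" if "i < k" "j < k" for i j using X'[OF that] adjD by blast
  define S' where "S' = matrix_op k (\<lambda>i j. X' j i)"
  have aS: "P.adj S S'" unfolding S_def S'_def by (rule adj_matrix_op[OF X'])
  have bS: "P.bop S" "P.bop S'" using aS P.adjD by auto
  have nD: "P.normal_pair (diag_op k N1) (diag_op k N1')" "P.normal_pair (diag_op k N2) (diag_op k N2')" "P.normal_pair (diag_op k N3) (diag_op k N3')"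
    by (rule normal_pair_diag_op[OF n(1)] normal_pair_diag_op[OF n(2)] normal_pair_diag_op[OF n(3)])+
  have cD: "P.com (diag_op k N1) (diag_op k N2)" "P.com (diag_op k N1) (diag_op k N3)" "P.com (diag_op k N2) (diag_op k N3)"
    by (rule com_diag_op[OF c(1)] com_diag_op[OF c(2)] com_diag_op[OF c(3)])+
  have bD: "P.bop (diag_op k N1)" "P.bop (diag_op k N2)" "P.bop (diag_op k N3)" using b by (auto intro: bop_diag_op)
  have cS: "P.com (diag_op k N1) S" "P.com (diag_op k N2) S" "P.com (diag_op k N3) S"
    unfolding S_def using b bX Xc by (auto intro!: com_diag_op_matrix_op)
  have cS': "P.com D S'" if "P.normal_pair D D'" "P.com D S" for D D'
  proof -
    have "P.com S D'" using P.fuglede[OF that(1) bS(1)] that(2) P.com_sym by blast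
    then show ?thesis using P.com_adj[OF _ aS, of D' D] that(1) P.com_sym P.normal_pair_sym[OF that(1)] by (auto simp: P.normal_pair_def)
  qed
  obtain \<mu> where mu: "\<mu> > M" "P.approx_kernel {\<lambda>u. S' (S u) \<ominus>\<^bsub>hpow k H\<^esub> complex_of_real (\<mu>\<^sup>2) \<odot>\<^bsub>hpow k H\<^esub> u}"
    using P.norm_attained_approximately[OF aS v big M] by blast
  define Y where "Y = (\<lambda>u. S' (S u) \<ominus>\<^bsub>hpow k H\<^esub> complex_of_real (\<mu>\<^sup>2) \<odot>\<^bsub>hpow k H\<^esub> u)"
  have bSS: "P.bop (\<lambda>u. S' (S u))" by (rule P.bop_comp[OF bS(2,1)])
  have bY: "P.bop Y" unfolding Y_def by (rule P.bop_shift[OF bSS])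
  have cY: "P.com D Y" if "P.normal_pair D D'" "P.bop D" "P.com D S" for D D'
    unfolding Y_def by (rule P.com_shift[OF that(2) bSS P.com_comp[OF that(2) bS(2,1) cS'[OF that(1,3)] that(3)]])
  have "P.bop Z \<and> P.com (diag_op k N1) Z \<and> P.com (diag_op k N2) Z \<and> P.com (diag_op k N3) Z" if "Z \<in> {Y}" for Z
    using that bY cY[OF nD(1) bD(1) cS(1)] cY[OF nD(2) bD(2) cS(2)] cY[OF nD(3) bD(3) cS(3)] by simp
  then obtain w1 w2 w3 where loc: "P.approx_kernel
    (insert (\<lambda>u. diag_op k N3 u \<ominus>\<^bsub>hpow k H\<^esub> w3 \<odot>\<^bsub>hpow k H\<^esub> u)
    (insert (\<lambda>u. diag_op k N2 u \<ominus>\<^bsub>hpow k H\<^esub> w2 \<odot>\<^bsub>hpow k H\<^esub> u)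
    (insert (\<lambda>u. diag_op k N1 u \<ominus>\<^bsub>hpow k H\<^esub> w1 \<odot>\<^bsub>hpow k H\<^esub> u) {Y})))"
    by (rule P.triple_localize[OF _ _ nD cD mu(2)[folded Y_def], rotated]) auto
  define w where "w = (w1, w2, w3)"
  have comp: "N (u $ i) \<ominus> a \<odot> u $ i = (diag_op k N u \<ominus>\<^bsub>hpow k H\<^esub> a \<odot>\<^bsub>hpow k H\<^esub> u) $ i"
    if "bop N" "u \<in> carrier (hpow k H)" "i < k" for N u i a
    using hpow_minus_component[OF diag_op_carrier[OF that(1,2)] P.smc[OF that(2)] that(3)] that(3)
    by (simp add: diag_op_def hpow_simps(4))
  have pick: "\<exists>u\<in>carrier (hpow k H). P.nm u = 1 \<and> P.nm (Y u) \<le> e \<and> (\<forall>i<k. gap (N1, N2, N3) w (u $ i) \<le> 3 * e)"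
    if e: "e > 0" for e
  proof -
    obtain u where u: "u \<in> carrier (hpow k H)" "P.nm u = 1" "P.nm (Y u) \<le> e"
      "P.nm (diag_op k N1 u \<ominus>\<^bsub>hpow k H\<^esub> w1 \<odot>\<^bsub>hpow k H\<^esub> u) \<le> e"
      "P.nm (diag_op k N2 u \<ominus>\<^bsub>hpow k H\<^esub> w2 \<odot>\<^bsub>hpow k H\<^esub> u) \<le> e"
      "P.nm (diag_op k N3 u \<ominus>\<^bsub>hpow k H\<^esub> w3 \<odot>\<^bsub>hpow k H\<^esub> u) \<le> e"
      by (rule P.approx_kernel_insert3E[OF loc e]) auto
    have le: "nm (N (u $ i) \<ominus> a \<odot> u $ i) \<le> e"
      if "bop N" "P.nm (diag_op k N u \<ominus>\<^bsub>hpow k H\<^esub> a \<odot>\<^bsub>hpow k H\<^esub> u) \<le> e" "i < k" for N a i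
      unfolding comp[OF that(1) u(1) that(3)]
      using u(1) diag_op_carrier[OF that(1) u(1)] that
      by (intro order_trans[OF hpow_component_le[OF _ that(3)] that(2)] P.minus_closed) auto
    have "gap (N1, N2, N3) w (u $ i) \<le> 3 * e" if i: "i < k" for i
      using le[OF b(1) u(4) i] le[OF b(2) u(5) i] le[OF b(3) u(6) i] by (simp add: gap_def w_def)
    then show ?thesis using u by blast
  qed
  have "w \<in> joint_spectrum H (N1, N2, N3)"
  proof (rule ccontr)
    assume "\<not> ?thesis"
    then obtain C where C: "C \<ge> 0" "\<And>x. x \<in> carrier H \<Longrightarrow> nm x \<le> C * gap (N1, N2, N3) w x"
      using outside_joint_spectrum[OF b] by blast
    have "1 \<le> real k * (C * 3) * e" if e: "e > 0" for e
    proof -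
      obtain u where u: "u \<in> carrier (hpow k H)" "P.nm u = 1" "\<And>i. i < k \<Longrightarrow> gap (N1, N2, N3) w (u $ i) \<le> 3 * e"
        using pick[OF e] by blast
      have "1 \<le> (\<Sum>i<k. nm (u $ i))" using hpow_norm_le_sum[OF u(1)] u by simp
      also have "\<dots> \<le> (\<Sum>i<k. C * (3 * e))"
        using u C by (intro sum_mono order_trans[OF C(2)] mult_left_mono) (auto simp: hpow_simps)
      finally show ?thesis by (simp add: mult_ac)
    qed
    moreover define g where "g = real k * (C * 3)"
    ultimately have le: "1 \<le> g * e" if "e > 0" for e using that by simp
    have g0: "g \<ge> 0" unfolding g_def using C(1) by simp
    have "1 \<le> g * (1 / (2 * (g + 1)))" by (rule le) (use g0 in simp)
    then show False using g0 by (simp add: field_simps)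
  qed
  then have w: "w \<in> \<Omega>" using sp by blast
  have "\<forall>i j. \<exists>C\<ge>0. i < k \<and> j < k \<longrightarrow>
    (\<forall>x\<in>carrier H. nm (X i j x \<ominus> reval (f i j) w \<odot> x) \<le> C * gap (N1, N2, N3) w x)"
    using tX[OF _ _ w] unfolding tracks_def by (meson order_refl)
  then obtain C where C: "\<And>i j. C i j \<ge> 0" "\<And>i j x. i < k \<Longrightarrow> j < k \<Longrightarrow> x \<in> carrier H \<Longrightarrow>
      nm (X i j x \<ominus> reval (f i j) w \<odot> x) \<le> C i j * gap (N1, N2, N3) w x" by metis
  define K where "K = 3 * (\<Sum>i<k. \<Sum>j<k. C i j)"
  have K: "K \<ge> 0" unfolding K_def using C(1) by (intro mult_nonneg_nonneg sum_nonneg) auto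
  define W where "W = matrix_op k (\<lambda>i j x. reval (f i j) w \<odot> x)"
  have bW: "P.bop W" unfolding W_def by (rule bop_matrix_op[OF bop_smult_op[OF bop_id]])
  have key: "\<mu>\<^sup>2 - e \<le> (M + K * e)\<^sup>2" if e: "e > 0" for e
  proof -
    obtain u where u: "u \<in> carrier (hpow k H)" "P.nm u = 1" "P.nm (Y u) \<le> e"
      "\<And>i. i < k \<Longrightarrow> gap (N1, N2, N3) w (u $ i) \<le> 3 * e"
      using pick[OF e] by blast
    have ui: "u $ i \<in> carrier H" if "i < k" for i using u(1) that by (simp add: hpow_simps)
    have cl: "S u \<in> carrier (hpow k H)" "W u \<in> carrier (hpow k H)" "Y u \<in> carrier (hpow k H)"
      using u bS bW bY by (auto simp: P.bop_cl)
    have "(P.nm (W u))\<^sup>2 = (\<Sum>i<k. (nm (finsum H (\<lambda>j. reval (f i j) w \<odot> u $ j) {..<k}))\<^sup>2)"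
      using cl by (simp only: hpow_norm_sq) (simp add: W_def matrix_op_def)
    also have "\<dots> \<le> M\<^sup>2 * (\<Sum>j<k. (nm (u $ j))\<^sup>2)"
      by (rule matrix_amplification[OF bound[OF w] ui])
    also have "\<dots> = M\<^sup>2" using hpow_norm_sq[OF u(1)] u(2) by simp
    finally have Wu: "P.nm (W u) \<le> M" by (rule power2_le_imp_le) (rule M)
    have "P.nm (S u \<ominus>\<^bsub>hpow k H\<^esub> W u) \<le> (\<Sum>i<k. nm ((S u \<ominus>\<^bsub>hpow k H\<^esub> W u) $ i))"
      using cl by (intro hpow_norm_le_sum) auto
    also have "\<dots> \<le> (\<Sum>i<k. \<Sum>j<k. C i j * (3 * e))"
    proof (rule sum_mono)
      fix i assume "i \<in> {..<k}"
      then have i: "i < k" by simp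
      have "(S u \<ominus>\<^bsub>hpow k H\<^esub> W u) $ i = finsum H (\<lambda>j. X i j (u $ j)) {..<k} \<ominus> finsum H (\<lambda>j. reval (f i j) w \<odot> u $ j) {..<k}"
        using hpow_minus_component[OF cl(1,2) i] i by (simp add: S_def W_def matrix_op_def)
      also have "\<dots> = finsum H (\<lambda>j. X i j (u $ j) \<ominus> reval (f i j) w \<odot> u $ j) {..<k}"
      proof (rule ip_ext)
        have c: "X i j (u $ j) \<in> carrier H" "reval (f i j) w \<odot> u $ j \<in> carrier H" if "j \<in> {..<k}" for j
          using that i ui bX by (auto simp: bop_cl)
        have cl: "finsum H (\<lambda>j. X i j (u $ j)) {..<k} \<in> carrier H" "finsum H (\<lambda>j. reval (f i j) w \<odot> u $ j) {..<k} \<in> carrier H"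
          using c by (auto intro!: finsum_closed)
        then show "finsum H (\<lambda>j. X i j (u $ j)) {..<k} \<ominus> finsum H (\<lambda>j. reval (f i j) w \<odot> u $ j) {..<k} \<in> carrier H" by simp
        show "finsum H (\<lambda>j. X i j (u $ j) \<ominus> reval (f i j) w \<odot> u $ j) {..<k} \<in> carrier H"
          using c by (auto intro!: finsum_closed)
        fix z assume z: "z \<in> carrier H"
        have "ip (finsum H (\<lambda>j. X i j (u $ j)) {..<k}) z = (\<Sum>j<k. ip (X i j (u $ j)) z)"
          "ip (finsum H (\<lambda>j. reval (f i j) w \<odot> u $ j) {..<k}) z = (\<Sum>j<k. ip (reval (f i j) w \<odot> u $ j) z)"
          "ip (finsum H (\<lambda>j. X i j (u $ j) \<ominus> reval (f i j) w \<odot> u $ j) {..<k}) z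
            = (\<Sum>j<k. ip (X i j (u $ j) \<ominus> reval (f i j) w \<odot> u $ j) z)"
          by (rule ip_finsum_left; use c z in simp)+
        moreover have "ip (X i j (u $ j) \<ominus> reval (f i j) w \<odot> u $ j) z
            = ip (X i j (u $ j)) z - ip (reval (f i j) w \<odot> u $ j) z" if "j \<in> {..<k}" for j
          using c[OF that] z by (rule ip_minus_left)
        ultimately show "ip (finsum H (\<lambda>j. X i j (u $ j)) {..<k} \<ominus> finsum H (\<lambda>j. reval (f i j) w \<odot> u $ j) {..<k}) z
            = ip (finsum H (\<lambda>j. X i j (u $ j) \<ominus> reval (f i j) w \<odot> u $ j) {..<k}) z"
          using cl z by (simp add: ip_minus_left sum_subtractf)
      qed
      finally have "nm ((S u \<ominus>\<^bsub>hpow k H\<^esub> W u) $ i) \<le> (\<Sum>j<k. nm (X i j (u $ j) \<ominus> reval (f i j) w \<odot> u $ j))"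
        using i ui bX nm_finsum_le[of "{..<k}" "\<lambda>j. X i j (u $ j) \<ominus> reval (f i j) w \<odot> u $ j"] by (auto simp: bop_cl)
      also have "\<dots> \<le> (\<Sum>j<k. C i j * (3 * e))"
        using i ui u(4) C(1) by (intro sum_mono order_trans[OF C(2)] mult_left_mono) auto
      finally show "nm ((S u \<ominus>\<^bsub>hpow k H\<^esub> W u) $ i) \<le> (\<Sum>j<k. C i j * (3 * e))" .
    qed
    also have "\<dots> = K * e" by (simp add: K_def sum_distrib_right sum_distrib_left mult_ac)
    finally have Su: "P.nm (S u) \<le> M + K * e"
      using P.nm_le_add_minus[OF cl(1,2)] Wu by linarith
    have "cinner (hpow k H) (S' (S u)) u = of_real ((P.nm (S u))\<^sup>2)"
      using u(1) cl bS P.adjD'[OF aS, of "S u"] by (simp add: P.bop_cl P.adjD(3)[OF P.adj_sym[OF aS]] P.ip_self)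
    then have "cinner (hpow k H) (Y u) u = of_real ((P.nm (S u))\<^sup>2 - \<mu>\<^sup>2)"
      unfolding Y_def using u cl bS by (simp add: P.ip_simps P.bop_cl P.ip_self[of u])
    then have "cmod (cinner (hpow k H) (Y u) u) = \<bar>(P.nm (S u))\<^sup>2 - \<mu>\<^sup>2\<bar>" by (metis norm_of_real)
    moreover have "cmod (cinner (hpow k H) (Y u) u) \<le> P.nm (Y u) * P.nm u" using cl u by (intro P.cauchy_schwarz)
    ultimately have "\<mu>\<^sup>2 - e \<le> (P.nm (S u))\<^sup>2" using u by simp
    also have "\<dots> \<le> (M + K * e)\<^sup>2" using Su cl by (intro power_mono) auto
    finally show ?thesis .
  qed
  have "((\<lambda>e. (M + K * e)\<^sup>2 + e) \<longlongrightarrow> (M + K * 0)\<^sup>2 + 0) (at_right 0)" by (intro tendsto_intros)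
  moreover have "eventually (\<lambda>e. \<mu>\<^sup>2 \<le> (M + K * e)\<^sup>2 + e) (at_right 0)"
    using key by (auto simp: eventually_at_right_field algebra_simps intro!: exI[of _ 1])
  ultimately have "\<mu>\<^sup>2 \<le> (M + K * 0)\<^sup>2 + 0" by (intro tendsto_lowerbound) auto
  then have "\<mu>\<^sup>2 \<le> M\<^sup>2" by simp
  then have "\<mu> \<le> M" by (rule power2_le_imp_le) (rule M)
  then show False using mu by simp
qed

end

section \<open>Dilations yield complete spectral sets\<close>

lemma cspace_simps:
  "carrier (cspace k) = carrier_vec k" "\<zero>\<^bsub>cspace k\<^esub> = 0\<^sub>v k"
  "v \<oplus>\<^bsub>cspace k\<^esub> w = v + w" "c \<odot>\<^bsub>cspace k\<^esub> v = c \<cdot>\<^sub>v v"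
  "cinner (cspace k) v w = v \<bullet>c w"
  by (simp_all add: cspace_def)

lemma cinner_cspace:
  assumes "v \<in> carrier_vec k" "w \<in> carrier_vec k"
  shows "cinner (cspace k) v w = (\<Sum>i<k. v $ i * cnj (w $ i))"
  using assms by (auto simp: cspace_simps scalar_prod_def lessThan_atLeast0 intro!: sum.cong)

lemma hnorm_cspace:
  assumes "v \<in> carrier_vec k"
  shows "hnorm (cspace k) v = L2_set (\<lambda>i. cmod (v $ i)) {..<k}"
  using assms by (simp add: hnorm_def cinner_cspace L2_set_def complex_mult_cnj cmod_power2)

lemma cspace_abelian_group: "abelian_group (cspace k)"
proof (rule abelian_groupI)
  fix v assume "v \<in> carrier (cspace k)"
  then show "\<exists>y\<in>carrier (cspace k). y \<oplus>\<^bsub>cspace k\<^esub> v = \<zero>\<^bsub>cspace k\<^esub>"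
    by (intro bexI[of _ "- v"]) (auto simp: cspace_simps)
qed (auto simp: cspace_simps assoc_add_vec[of _ k] intro!: comm_add_vec[of _ k])

lemma pre_hilbert_cspace: "pre_hilbert (cspace k)"
proof -
  interpret G: abelian_group "cspace k" by (rule cspace_abelian_group)
  have "module (class_ring :: complex ring) (cspace k)"
    by (rule moduleI)
      (auto simp: cspace_simps class_cring.is_cring cspace_abelian_group add_smult_distrib_vec
        smult_add_distrib_vec[of _ k] smult_smult_assoc)
  then interpret M: module "class_ring :: complex ring" "cspace k" .
  show ?thesis
  proof unfold_locales
    fix x assume x: "x \<in> carrier (cspace k)"
    then have x': "x \<in> carrier_vec k" by (simp add: cspace_simps)
    have xx: "cinner (cspace k) x x = of_real (\<Sum>i<k. (cmod (x $ i))\<^sup>2)"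
      by (simp add: cinner_cspace[OF x' x'] complex_mult_cnj cmod_power2)
    then show "0 \<le> Re (cinner (cspace k) x x)" by (simp add: sum_nonneg)
    assume "cinner (cspace k) x x = 0"
    then have "(\<Sum>i<k. (cmod (x $ i))\<^sup>2) = 0" unfolding xx of_real_eq_0_iff .
    then have "x $ i = 0" if "i < k" for i using that by (simp add: sum_nonneg_eq_0_iff)
    then show "x = \<zero>\<^bsub>cspace k\<^esub>" using x' by (intro eq_vecI) (auto simp: cspace_simps)
  next
    fix x y assume xy: "x \<in> carrier (cspace k)" "y \<in> carrier (cspace k)"
    then show "cinner (cspace k) x y = cnj (cinner (cspace k) y x)"
      by (simp add: cinner_cspace cspace_simps(1) mult.commute)
  next
    fix x y z assume "x \<in> carrier (cspace k)" "y \<in> carrier (cspace k)" "z \<in> carrier (cspace k)"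
    then have c: "x \<in> carrier_vec k" "y \<in> carrier_vec k" "z \<in> carrier_vec k" "x + y \<in> carrier_vec k"
      by (auto simp: cspace_simps)
    show "cinner (cspace k) (x \<oplus>\<^bsub>cspace k\<^esub> y) z = cinner (cspace k) x z + cinner (cspace k) y z"
      using c by (simp only: cinner_cspace cspace_simps(3)) (simp add: algebra_simps sum.distrib)
  next
    fix x y c assume "x \<in> carrier (cspace k)" "y \<in> carrier (cspace k)"
    then have c: "x \<in> carrier_vec k" "y \<in> carrier_vec k" "c \<cdot>\<^sub>v x \<in> carrier_vec k" by (auto simp: cspace_simps)
    show "cinner (cspace k) (c \<odot>\<^bsub>cspace k\<^esub> x) y = c * cinner (cspace k) x y"
      using c by (simp only: cinner_cspace cspace_simps(4)) (simp add: sum_distrib_left mult.assoc)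
  qed
qed

lemma cspace_minus_component:
  assumes "v \<in> carrier_vec k" "w \<in> carrier_vec k" "i < k"
  shows "(v \<ominus>\<^bsub>cspace k\<^esub> w) $ i = v $ i - w $ i"
proof -
  interpret pre_hilbert "cspace k" by (rule pre_hilbert_cspace)
  show ?thesis using assms minus_smult[of v w] by (simp add: cspace_simps)
qed

lemma hilbert_space_cspace: "hilbert_space (cspace k)"
proof -
  interpret P: pre_hilbert "cspace k" by (rule pre_hilbert_cspace)
  show ?thesis
  proof unfold_locales
    fix s :: "nat \<Rightarrow> cvec"
    assume s: "\<And>i. s i \<in> carrier (cspace k)"
      and cauchy: "\<And>e. e > 0 \<Longrightarrow> \<exists>M. \<forall>i\<ge>M. \<forall>j\<ge>M. hnorm (cspace k) (s i \<ominus>\<^bsub>cspace k\<^esub> s j) < e"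
    have sv: "s i \<in> carrier_vec k" for i using s[of i] by (simp add: cspace_simps)
    have d: "s i \<ominus>\<^bsub>cspace k\<^esub> y \<in> carrier_vec k" if "y \<in> carrier_vec k" for i y
      using P.minus_closed[OF s, of y i] that by (simp add: cspace_simps)
    have "Cauchy (\<lambda>i. s i $ l)" if l: "l < k" for l
    proof (rule metric_CauchyI)
      fix e :: real assume "e > 0"
      then obtain M where M: "\<forall>i\<ge>M. \<forall>j\<ge>M. hnorm (cspace k) (s i \<ominus>\<^bsub>cspace k\<^esub> s j) < e" using cauchy by blast
      show "\<exists>M. \<forall>m\<ge>M. \<forall>n\<ge>M. dist (s m $ l) (s n $ l) < e"
      proof (intro exI[of _ M] allI impI)
        fix m n assume mn: "M \<le> m" "M \<le> n"
        have "dist (s m $ l) (s n $ l) = cmod ((s m \<ominus>\<^bsub>cspace k\<^esub> s n) $ l)"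
          by (simp add: cspace_minus_component[OF sv sv l] dist_norm)
        also have "\<dots> \<le> hnorm (cspace k) (s m \<ominus>\<^bsub>cspace k\<^esub> s n)"
          unfolding hnorm_cspace[OF d[OF sv]] using l by (intro member_le_L2_set) auto
        finally show "dist (s m $ l) (s n $ l) < e" using M mn by fastforce
      qed
    qed
    then have "\<exists>a. (\<lambda>i. s i $ l) \<longlonglongrightarrow> a" if "l < k" for l
      using that by (auto simp: Cauchy_convergent_iff convergent_def)
    then obtain a where a: "\<And>l. l < k \<Longrightarrow> (\<lambda>i. s i $ l) \<longlonglongrightarrow> a l" by metis
    have x: "vec k a \<in> carrier_vec k" by simp
    have "(\<lambda>i. \<Sum>l<k. cmod (s i $ l - a l)) \<longlonglongrightarrow> (\<Sum>l<k. cmod (a l - a l))"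
      using a by (intro tendsto_intros) auto
    then have lim: "(\<lambda>i. \<Sum>l<k. cmod (s i $ l - a l)) \<longlonglongrightarrow> 0" by simp
    have "(\<lambda>i. hnorm (cspace k) (s i \<ominus>\<^bsub>cspace k\<^esub> vec k a)) \<longlonglongrightarrow> 0"
    proof (rule tendsto_sandwich[OF _ _ tendsto_const lim])
      show "\<forall>\<^sub>F i in sequentially. 0 \<le> hnorm (cspace k) (s i \<ominus>\<^bsub>cspace k\<^esub> vec k a)"
        using d[OF x] by (auto simp: hnorm_cspace)
      show "\<forall>\<^sub>F i in sequentially. hnorm (cspace k) (s i \<ominus>\<^bsub>cspace k\<^esub> vec k a) \<le> (\<Sum>l<k. cmod (s i $ l - a l))"
      proof (intro always_eventually allI)
        fix i
        have "hnorm (cspace k) (s i \<ominus>\<^bsub>cspace k\<^esub> vec k a)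
            \<le> (\<Sum>l<k. cmod ((s i \<ominus>\<^bsub>cspace k\<^esub> vec k a) $ l))"
          unfolding hnorm_cspace[OF d[OF x]] by (rule L2_set_le_sum) simp
        also have "\<dots> = (\<Sum>l<k. cmod (s i $ l - a l))"
          by (intro sum.cong) (auto simp: cspace_minus_component[OF sv x])
        finally show "hnorm (cspace k) (s i \<ominus>\<^bsub>cspace k\<^esub> vec k a) \<le> (\<Sum>l<k. cmod (s i $ l - a l))" .
      qed
    qed
    then show "\<exists>x\<in>carrier (cspace k). (\<lambda>i. hnorm (cspace k) (s i \<ominus>\<^bsub>cspace k\<^esub> x)) \<longlonglongrightarrow> 0"
      using x by (auto simp: cspace_simps)
  qed (fact P.ip_add_left P.ip_smult_left P.ip_commute P.ip_ge_zero P.ip_eq_zero)+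
qed

text \<open>
  The supremum defining \<^const>\<open>op_norm\<close> is meaningful only for bounded sets; \<open>C\<close> provides the bound.
\<close>
lemma op_norm_bounds:
  assumes "pre_hilbert H" "pre_hilbert K"
    and S: "\<And>x. x \<in> carrier H \<Longrightarrow> S x \<in> carrier K"
    "\<And>c x. x \<in> carrier H \<Longrightarrow> S (c \<odot>\<^bsub>H\<^esub> x) = c \<odot>\<^bsub>K\<^esub> S x"
    and C: "\<And>x. x \<in> carrier H \<Longrightarrow> hnorm K (S x) \<le> C * hnorm H x" "C \<ge> 0"
  shows "op_norm H K S \<le> C" "x \<in> carrier H \<Longrightarrow> hnorm K (S x) \<le> op_norm H K S * hnorm H x"
proof -
  interpret H: pre_hilbert H by fact
  interpret K: pre_hilbert K by fact
  have le: "hnorm K (S x) \<le> C" if "x \<in> carrier H" "hnorm H x \<le> 1" for x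
    using order_trans[OF C(1)[OF that(1)] mult_left_mono[OF that(2) C(2)]] by simp
  show "op_norm H K S \<le> C"
    unfolding op_norm_def by (rule cSUP_least) (use le in \<open>auto intro!: exI[of _ "\<zero>\<^bsub>H\<^esub>"]\<close>)
  have bdd: "bdd_above ((\<lambda>x. hnorm K (S x)) ` {x \<in> carrier H. hnorm H x \<le> 1})"
    by (rule bdd_aboveI[of _ C]) (use le in auto)
  assume x: "x \<in> carrier H"
  show "hnorm K (S x) \<le> op_norm H K S * hnorm H x"
  proof (cases "hnorm H x = 0")
    case True
    then show ?thesis using C(1)[OF x] by simp
  next
    case False
    then have p: "hnorm H x > 0" using x by (simp add: less_le)
    define y where "y = complex_of_real (1 / hnorm H x) \<odot>\<^bsub>H\<^esub> x"
    have "hnorm K (S y) \<le> op_norm H K S"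
      unfolding op_norm_def using x p by (intro cSUP_upper[OF _ bdd]) (auto simp: y_def H.nm_smult norm_divide)
    moreover have "hnorm K (S y) = hnorm K (S x) / hnorm H x"
      using x p by (simp add: y_def S K.nm_smult norm_divide)
    ultimately show ?thesis using p by (simp add: divide_le_eq)
  qed
qed

lemma mat_op_norm_bounds:
  assumes G: "G \<in> carrier_mat k k"
  shows "op_norm (cspace k) (cspace k) (\<lambda>v. G *\<^sub>v v) \<le> (\<Sum>i<k. \<Sum>j<k. cmod (G $$ (i, j)))"
    "v \<in> carrier_vec k \<Longrightarrow> hnorm (cspace k) (G *\<^sub>v v) \<le> op_norm (cspace k) (cspace k) (\<lambda>v. G *\<^sub>v v) * hnorm (cspace k) v"
proof -
  have b: "hnorm (cspace k) (G *\<^sub>v v) \<le> (\<Sum>i<k. \<Sum>j<k. cmod (G $$ (i, j))) * hnorm (cspace k) v"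
    if v: "v \<in> carrier_vec k" for v
  proof -
    have Gv: "G *\<^sub>v v \<in> carrier_vec k" using G v by simp
    have "hnorm (cspace k) (G *\<^sub>v v) \<le> (\<Sum>i<k. cmod ((G *\<^sub>v v) $ i))"
      unfolding hnorm_cspace[OF Gv] by (rule L2_set_le_sum) simp
    also have "\<dots> \<le> (\<Sum>i<k. \<Sum>j<k. cmod (G $$ (i, j)) * hnorm (cspace k) v)"
    proof (rule sum_mono)
      fix i assume i: "i \<in> {..<k}"
      have "(G *\<^sub>v v) $ i = (\<Sum>j<k. G $$ (i, j) * v $ j)"
        using i G v by (simp add: scalar_prod_def lessThan_atLeast0)
      then have "cmod ((G *\<^sub>v v) $ i) \<le> (\<Sum>j<k. cmod (G $$ (i, j)) * cmod (v $ j))"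
        by (simp add: sum_norm_le norm_mult)
      also have "\<dots> \<le> (\<Sum>j<k. cmod (G $$ (i, j)) * hnorm (cspace k) v)"
        unfolding hnorm_cspace[OF v] by (intro sum_mono mult_left_mono member_le_L2_set) auto
      finally show "cmod ((G *\<^sub>v v) $ i) \<le> (\<Sum>j<k. cmod (G $$ (i, j)) * hnorm (cspace k) v)" .
    qed
    also have "\<dots> = (\<Sum>i<k. \<Sum>j<k. cmod (G $$ (i, j))) * hnorm (cspace k) v" by (simp add: sum_distrib_right)
    finally show ?thesis .
  qed
  note * = op_norm_bounds[OF pre_hilbert_cspace pre_hilbert_cspace, of k "\<lambda>v. G *\<^sub>v v" k "\<Sum>i<k. \<Sum>j<k. cmod (G $$ (i, j))"]
  show "op_norm (cspace k) (cspace k) (\<lambda>v. G *\<^sub>v v) \<le> (\<Sum>i<k. \<Sum>j<k. cmod (G $$ (i, j)))"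
    by (rule *(1)) (use G b in \<open>auto simp: cspace_simps mult_mat_vec intro!: sum_nonneg\<close>)
  show "hnorm (cspace k) (G *\<^sub>v v) \<le> op_norm (cspace k) (cspace k) (\<lambda>v. G *\<^sub>v v) * hnorm (cspace k) v"
    if "v \<in> carrier_vec k"
    by (rule *(2)) (use G b that in \<open>auto simp: cspace_simps mult_mat_vec intro!: sum_nonneg\<close>)
qed

lemma peval_eq_sum: "peval p w = (\<Sum>m\<in>Poly_Mapping.keys p. Poly_Mapping.lookup p m *
    (fst w ^ fst m * fst (snd w) ^ fst (snd m) * snd (snd w) ^ snd (snd m)))"
  by (cases w) (auto simp: case_prod_unfold mult.assoc intro!: sum.cong)

lemma continuous_peval: "continuous_on A (peval p)"
  unfolding peval_eq_sum by (intro continuous_intros)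

lemma continuous_reval: "f \<in> Rat \<Omega> \<Longrightarrow> continuous_on \<Omega> (reval f)"
  by (cases f) (auto simp: Rat_def intro!: continuous_intros continuous_peval)

lemma bounded_reval:
  assumes "compact \<Omega>" "f \<in> Rat \<Omega>"
  obtains B where "\<And>w. w \<in> \<Omega> \<Longrightarrow> cmod (reval f w) \<le> B"
  using compact_imp_bounded[OF compact_continuous_image[OF continuous_reval[OF assms(2)] assms(1)]]
  by (auto simp: bounded_iff)

text \<open>
  \<open>\<Omega>\<close> itself is one of the closed sets on which all maxima are attained. The part of the Shilov boundary in
  a dilation is thereby reduced to a joint spectrum in \<open>\<Omega>\<close>.
\<close>
lemma shilov_boundary_subset:
  assumes "compact \<Omega>" "\<Omega> \<noteq> {}"
  shows "shilov_boundary \<Omega> \<subseteq> \<Omega>"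
proof -
  have "\<exists>b\<in>\<Omega>. \<forall>w\<in>\<Omega>. cmod (reval f w) \<le> cmod (reval f b)" if "f \<in> Rat \<Omega>" for f
    using continuous_attains_sup[OF assms continuous_on_norm[OF continuous_reval[OF that]]] .
  then have "boundary_for_Rat \<Omega> \<Omega>" using assms by (auto simp: boundary_for_Rat_def compact_imp_closed)
  then show ?thesis unfolding shilov_boundary_def by blast
qed

lemma linear_finsum:
  assumes "pre_hilbert H" "pre_hilbert K" and S: "bounded_op H K S"
    and "finite A" "\<And>i. i \<in> A \<Longrightarrow> f i \<in> carrier H"
  shows "S (finsum H f A) = finsum K (\<lambda>i. S (f i)) A"
proof -
  interpret H: pre_hilbert H by fact
  interpret K: pre_hilbert K by fact
  have S0: "S \<zero>\<^bsub>H\<^esub> = \<zero>\<^bsub>K\<^esub>"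
    using lin_op_D(3)[OF S, of "\<zero>\<^bsub>H\<^esub>" 0] lin_op_D(1)[OF S, of "\<zero>\<^bsub>H\<^esub>"] by (simp add: H.zero_smult K.zero_smult)
  show ?thesis using assms(4,5)
  proof (induction A rule: finite_induct)
    case empty
    then show ?case by (simp add: S0)
  next
    case (insert i A)
    then have "finsum H f (insert i A) = f i \<oplus>\<^bsub>H\<^esub> finsum H f A" "finsum H f A \<in> carrier H"
      by (auto intro!: H.finsum_insert H.finsum_closed)
    moreover have "finsum K (\<lambda>i. S (f i)) (insert i A) = S (f i) \<oplus>\<^bsub>K\<^esub> finsum K (\<lambda>i. S (f i)) A"
      using insert lin_op_D(1)[OF S] by (auto intro!: K.finsum_insert)
    ultimately show ?case using insert by (simp add: lin_op_D(2)[OF S])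
  qed
qed

text \<open>
  \<open>F(T)\<close> is the compression of \<open>F(N)\<close> by the contractions \<open>V\<close> and \<open>V'\<close>, applied in each component, and
  von Neumann's inequality bounds the norm of \<open>F(N)\<close>.
\<close>
theorem rational_dilation_imp_complete_spectral_set:
  fixes H :: "'a hilbert" and K :: "'k hilbert"
  assumes H: "pre_hilbert H" and om: "compact \<Omega>" "\<Omega> \<noteq> {}" and sp: "joint_spectrum H T \<subseteq> \<Omega>"
    and dil: "rational_dilation \<Omega> H T K V N"
  shows "complete_spectral_set \<Omega> H T"
  unfolding complete_spectral_set_def
proof (intro conjI sp allI impI ballI)
  fix k :: nat and F assume "k \<ge> 1" and F: "F \<in> Rat_mat k \<Omega>"
  interpret H: pre_hilbert H by fact
  interpret K: hilbert_space K using dil by (simp add: rational_dilation_def)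
  interpret Hk: pre_hilbert "hpow k H" by (rule H.pre_hilbert_hpow)
  interpret Kk: pre_hilbert "hpow k K" by (rule K.pre_hilbert_hpow)
  obtain N1 N2 N3 where N: "N = (N1, N2, N3)" by (cases N) auto
  obtain V' where V': "is_adjoint H K V V'"
    "\<And>f x. f \<in> Rat \<Omega> \<Longrightarrow> x \<in> carrier H \<Longrightarrow> reval_op H f T x = V' (reval_op K f N (V x))"
    using dil by (auto simp: rational_dilation_def)
  have V: "bounded_op H K V" "\<And>x. x \<in> carrier H \<Longrightarrow> K.nm (V x) = H.nm x"
    using dil by (auto simp: rational_dilation_def isometry_op_def)
  have bV': "bounded_op K H V'" using V' by (simp add: is_adjoint_def)
  have contr: "H.nm (V' y) \<le> K.nm y" if y: "y \<in> carrier K" for y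
  proof -
    have c: "V' y \<in> carrier H" "V (V' y) \<in> carrier K" using y lin_op_D(1)[OF bV'] lin_op_D(1)[OF V(1)] by auto
    have "cinner K (V (V' y)) y = of_real ((H.nm (V' y))\<^sup>2)"
      using V'(1) c y by (simp add: is_adjoint_def H.ip_self)
    then have "cmod (cinner K (V (V' y)) y) = (H.nm (V' y))\<^sup>2" by (metis abs_power2 norm_of_real)
    then have "H.nm (V' y) * H.nm (V' y) \<le> K.nm y * H.nm (V' y)"
      using K.cauchy_schwarz[OF c(2) y] V(2)[OF c(1)] by (simp add: power2_eq_square mult.commute)
    then show ?thesis using c y by (cases "H.nm (V' y) = 0") (auto simp: less_le mult_le_cancel_right)
  qed
  obtain N1' N2' N3' where n: "K.normal_pair N1 N1'" "K.normal_pair N2 N2'" "K.normal_pair N3 N3'"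
    using dil unfolding rational_dilation_def N normal_triple.simps normal_op_def is_adjoint_def
    by (auto simp: K.normal_pair_def K.adj_def K.com_def)
  have c: "K.com N1 N2" "K.com N1 N3" "K.com N2 N3"
    using dil by (auto simp: rational_dilation_def N K.com_def)
  have spN: "joint_spectrum K (N1, N2, N3) \<subseteq> \<Omega>"
    using dil shilov_boundary_subset[OF om] by (auto simp: rational_dilation_def N)
  define f where "f = (\<lambda>i j. F $$ (i, j))"
  have Fc: "F \<in> carrier_mat k k" and f: "\<And>i j. i < k \<Longrightarrow> j < k \<Longrightarrow> f i j \<in> Rat \<Omega>"
    using F by (auto simp: Rat_mat_def f_def)
  have Gc: "mat_reval F w \<in> carrier_mat k k" for w using Fc by (simp add: mat_reval_def)
  have Gij: "mat_reval F w $$ (i, j) = reval (f i j) w" if "i < k" "j < k" for i j w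
    using Fc that by (simp add: mat_reval_def f_def)
  let ?on = "\<lambda>w. op_norm (cspace k) (cspace k) (\<lambda>v. mat_reval F w *\<^sub>v v)"
  define M where "M = (SUP w\<in>\<Omega>. ?on w)"
  have "\<forall>i j. \<exists>B. i < k \<and> j < k \<longrightarrow> (\<forall>w\<in>\<Omega>. cmod (reval (f i j) w) \<le> B)"
    using bounded_reval[OF om(1) f] by metis
  then obtain B where B: "\<And>i j w. i < k \<Longrightarrow> j < k \<Longrightarrow> w \<in> \<Omega> \<Longrightarrow> cmod (reval (f i j) w) \<le> B i j" by metis
  have bdd: "bdd_above (?on ` \<Omega>)"
  proof (rule bdd_aboveI2)
    fix w assume w: "w \<in> \<Omega>"
    show "?on w \<le> (\<Sum>i<k. \<Sum>j<k. B i j)"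
      using w by (intro order_trans[OF mat_op_norm_bounds(1)[OF Gc]] sum_mono) (auto simp: Gij B)
  qed
  have bound: "(\<Sum>i<k. (cmod (\<Sum>j<k. reval (f i j) w * c j))\<^sup>2) \<le> M\<^sup>2 * (\<Sum>j<k. (cmod (c j))\<^sup>2)" and M0: "M \<ge> 0"
    if w: "w \<in> \<Omega>" for w c
  proof -
    have vc: "vec k c \<in> carrier_vec k" by simp
    have Gv: "mat_reval F w *\<^sub>v vec k c \<in> carrier_vec k" using Gc[of w] by simp
    have "0 \<le> ?on w"
    proof -
      have "hnorm (cspace k) (mat_reval F w *\<^sub>v (vec k (\<lambda>i. 1))) \<le> ?on w * hnorm (cspace k) (vec k (\<lambda>i. 1))"
        by (rule mat_op_norm_bounds(2)[OF Gc]) simp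
      moreover have "hnorm (cspace k) (vec k (\<lambda>i. 1)) > 0"
        using \<open>k \<ge> 1\<close> by (simp add: hnorm_cspace L2_set_def)
      moreover have "0 \<le> hnorm (cspace k) (mat_reval F w *\<^sub>v (vec k (\<lambda>i. 1)))"
        using Gc[of w] by (subst hnorm_cspace) auto
      ultimately have "0 < hnorm (cspace k) (vec k (\<lambda>i. 1 :: complex))"
        "0 \<le> ?on w * hnorm (cspace k) (vec k (\<lambda>i. 1))" by linarith+
      then show ?thesis by (simp add: zero_le_mult_iff)
    qed
    moreover have onM: "?on w \<le> M" unfolding M_def by (rule cSUP_upper[OF w bdd])
    ultimately show "M \<ge> 0" by linarith
    have "hnorm (cspace k) (mat_reval F w *\<^sub>v vec k c) \<le> ?on w * hnorm (cspace k) (vec k c)"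
      by (rule mat_op_norm_bounds(2)[OF Gc vc])
    also have "\<dots> \<le> M * hnorm (cspace k) (vec k c)"
      using onM by (intro mult_right_mono) (auto simp: hnorm_cspace)
    finally have "(hnorm (cspace k) (mat_reval F w *\<^sub>v vec k c))\<^sup>2 \<le> (M * hnorm (cspace k) (vec k c))\<^sup>2"
      using Gv by (intro power_mono) (auto simp: hnorm_cspace)
    moreover have "(mat_reval F w *\<^sub>v vec k c) $ i = (\<Sum>j<k. reval (f i j) w * c j)" if "i < k" for i
      using that Gc[of w] by (simp add: scalar_prod_def lessThan_atLeast0 Gij)
    ultimately show "(\<Sum>i<k. (cmod (\<Sum>j<k. reval (f i j) w * c j))\<^sup>2) \<le> M\<^sup>2 * (\<Sum>j<k. (cmod (c j))\<^sup>2)"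
      using Gv by (simp add: hnorm_cspace L2_set_def sum_nonneg power_mult_distrib)
  qed
  have M: "M \<ge> 0" using M0 om(2) by blast
  let ?R = "\<lambda>i j. reval_op K (f i j) (N1, N2, N3)"
  have bR: "K.bop (?R i j)" if "i < k" "j < k" for i j
    using K.Rat_calculus(1)[OF n c spN f[OF that]] K.adjD by blast
  have main: "Hk.nm (mat_reval_op H F T x) \<le> M * Hk.nm x" if x: "x \<in> carrier (hpow k H)" for x
  proof (rule power2_le_imp_le)
    have xi: "x $ i \<in> carrier H" if "i < k" for i using x that by (simp add: hpow_simps)
    define y where "y = vec k (\<lambda>j. V (x $ j))"
    have yi: "V (x $ i) \<in> carrier K" if "i < k" for i using xi[OF that] lin_op_D(1)[OF V(1)] by blast
    then have y: "y \<in> carrier (hpow k K)" by (simp add: y_def hpow_simps)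
    have ny: "Kk.nm y = Hk.nm x"
      by (rule power2_eq_imp_eq)
        (use x y xi in \<open>auto simp: K.hpow_norm_sq H.hpow_norm_sq y_def V(2) intro!: sum.cong\<close>)
    let ?z = "\<lambda>i. finsum K (\<lambda>j. ?R i j (V (x $ j))) {..<k}"
    have z: "?z i \<in> carrier K" if "i < k" for i
      using that bR yi by (auto intro!: K.finsum_closed simp: K.bop_cl)
    have comp: "mat_reval_op H F T x $ i = V' (?z i)" if i: "i < k" for i
    proof -
      have zz: "?R i j (V (x $ j)) \<in> carrier K" if "j \<in> {..<k}" for j using that i bR yi by (auto simp: K.bop_cl)
      have "mat_reval_op H F T x $ i = finsum H (\<lambda>j. reval_op H (f i j) T (x $ j)) {..<k}"
        using i Fc by (simp add: mat_reval_op_def f_def)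
      also have "\<dots> = finsum H (\<lambda>j. V' (?R i j (V (x $ j)))) {..<k}"
        using i zz by (intro H.finsum_cong') (auto simp: V'(2)[OF f] N xi lin_op_D(1)[OF bV'])
      also have "\<dots> = V' (?z i)"
        by (rule linear_finsum[OF _ _ bV', symmetric]) (use zz in \<open>auto intro: H.pre_hilbert_axioms K.pre_hilbert_axioms\<close>)
      finally show ?thesis .
    qed
    have FT: "mat_reval_op H F T x \<in> carrier (hpow k H)"
      using comp z lin_op_D(1)[OF bV'] Fc by (simp add: hpow_simps) (simp add: mat_reval_op_def)
    have "(Hk.nm (mat_reval_op H F T x))\<^sup>2 = (\<Sum>i<k. (H.nm (V' (?z i)))\<^sup>2)"
      using FT comp by (simp add: H.hpow_norm_sq)
    also have "\<dots> \<le> (\<Sum>i<k. (K.nm (?z i))\<^sup>2)"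
      using z lin_op_D(1)[OF bV'] by (intro sum_mono power_mono contr H.nm_nonneg) auto
    also have "\<dots> = (Kk.nm (K.matrix_op k ?R y))\<^sup>2"
    proof -
      have "K.matrix_op k ?R y \<in> carrier (hpow k K)" by (rule Kk.bop_cl[OF K.bop_matrix_op[OF bR] y])
      moreover have "K.matrix_op k ?R y $ i = ?z i" if "i < k" for i
        using that z bR yi by (auto simp: K.matrix_op_def y_def K.bop_cl intro!: K.finsum_cong')
      ultimately show ?thesis by (simp add: K.hpow_norm_sq)
    qed
    also have "\<dots> \<le> (M * Kk.nm y)\<^sup>2"
      using K.von_neumann_inequality[OF n c spN f M bound y] Kk.bop_cl[OF K.bop_matrix_op[OF bR] y]
      by (intro power_mono) auto
    finally show "(Hk.nm (mat_reval_op H F T x))\<^sup>2 \<le> (M * Hk.nm x)\<^sup>2" by (simp add: ny)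
  qed (use M x in simp)
  show "op_norm (hpow k H) (hpow k H) (mat_reval_op H F T) \<le> (SUP w\<in>\<Omega>. ?on w)"
    unfolding op_norm_def[of "hpow k H"] M_def[symmetric]
  proof (rule cSUP_least)
    show "{x \<in> carrier (hpow k H). Hk.nm x \<le> 1} \<noteq> {}" by (auto intro!: exI[of _ "\<zero>\<^bsub>hpow k H\<^esub>"])
    fix x assume "x \<in> {x \<in> carrier (hpow k H). Hk.nm x \<le> 1}"
    then show "Hk.nm (mat_reval_op H F T x) \<le> M"
      using main[of x] mult_left_mono[of "Hk.nm x" 1 M] M by auto
  qed
qed

section \<open>Schwarz-Pick inequalities on the tetrablock\<close>

lemma moebius_identity:
  "(cmod (1 - cnj b * a))\<^sup>2 - (cmod (a - b))\<^sup>2 = (1 - (cmod a)\<^sup>2) * (1 - (cmod b)\<^sup>2)"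
  by (simp add: cmod_power2) (simp add: power2_eq_square algebra_simps)

text \<open>
  Composing with the disc automorphism that moves \<open>f 0\<close> to \<open>0\<close> reduces this to Schwarz' lemma.
\<close>
lemma schwarz_pick_at_0:
  assumes hol: "f holomorphic_on ball 0 1" and lt: "\<And>z. cmod z < 1 \<Longrightarrow> cmod (f z) < 1"
    and D: "(f has_field_derivative D) (at 0)"
  shows "cmod D \<le> 1 - (cmod (f 0))\<^sup>2"
proof -
  define c where "c = f 0"
  have c: "cmod c < 1" using lt[of 0] by (simp add: c_def)
  have ne: "1 - cnj c * f z \<noteq> 0" if "cmod z < 1" for z
  proof
    assume "1 - cnj c * f z = 0"
    then have "cnj c * f z = 1" by simp
    then have "cmod c * cmod (f z) = 1" by (metis complex_mod_cnj norm_mult norm_one)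
    moreover have "cmod c * cmod (f z) < 1" using mult_strict_mono'[OF c lt[OF that]] by simp
    ultimately show False by simp
  qed
  define g where "g = (\<lambda>z. (f z - c) / (1 - cnj c * f z))"
  have holg: "g holomorphic_on ball 0 1"
    unfolding g_def using hol ne by (intro holomorphic_intros) auto
  have g1: "cmod (g z) < 1" if z: "cmod z < 1" for z
  proof -
    have "(1 - (cmod (f z))\<^sup>2) * (1 - (cmod c)\<^sup>2) > 0"
      using c lt[OF z] by (intro mult_pos_pos) (auto simp: power_less_one_iff)
    then have "(cmod (f z - c))\<^sup>2 < (cmod (1 - cnj c * f z))\<^sup>2" using moebius_identity[of c "f z"] by linarith
    then have "cmod (f z - c) < cmod (1 - cnj c * f z)" by (rule power2_less_imp_less) simp
    then show ?thesis using ne[OF z] by (simp add: g_def norm_divide)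
  qed
  have k: "1 - cnj c * c = complex_of_real (1 - (cmod c)\<^sup>2)"
    by (metis complex_norm_square mult.commute of_real_1 of_real_diff)
  have kp: "1 - (cmod c)\<^sup>2 > 0" using c by (simp add: power_less_one_iff)
  have "(g has_field_derivative (D * (1 - cnj c * f 0) - (f 0 - c) * (- (cnj c * D)))
      / ((1 - cnj c * f 0) * (1 - cnj c * f 0))) (at 0)"
    unfolding g_def using ne[of 0] by (auto intro!: derivative_eq_intros D)
  then have "(g has_field_derivative D / complex_of_real (1 - (cmod c)\<^sup>2)) (at 0)"
    using ne[of 0] by (simp add: c_def[symmetric] k del: of_real_diff)
  then have "deriv g 0 = D / complex_of_real (1 - (cmod c)\<^sup>2)" by (rule DERIV_imp_deriv)
  moreover have "cmod (deriv g 0) \<le> 1"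
    by (rule Schwarz_Lemma(2)[OF holg _ g1, of 0]) (auto simp: g_def c_def)
  ultimately have "cmod D / (1 - (cmod c)\<^sup>2) \<le> 1" using kp by (simp add: norm_divide del: of_real_diff)
  then show ?thesis using kp by (simp add: c_def)
qed

lemma schwarz_pick_scaled:
  assumes hol: "f holomorphic_on ball 0 1" and lt: "\<And>z. cmod z < 1 \<Longrightarrow> cmod (f z) < S"
    and D: "(f has_field_derivative D) (at 0)"
  shows "S * cmod D \<le> S\<^sup>2 - (cmod (f 0))\<^sup>2"
proof -
  have S: "S > 0" using lt[of 0] norm_ge_zero[of "f 0"] by (simp del: norm_ge_zero)
  have "cmod (D / of_real S) \<le> 1 - (cmod (f 0 / of_real S))\<^sup>2"
    by (rule schwarz_pick_at_0[of "\<lambda>z. f z / of_real S"])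
      (use S lt hol in \<open>auto intro!: holomorphic_intros derivative_eq_intros D simp: norm_divide\<close>)
  then have "cmod D / S \<le> 1 - (cmod (f 0))\<^sup>2 / S\<^sup>2" using S by (simp add: norm_divide power_divide)
  then have "S\<^sup>2 * (cmod D / S) \<le> S\<^sup>2 * (1 - (cmod (f 0))\<^sup>2 / S\<^sup>2)" by (rule mult_left_mono) simp
  then show ?thesis using S by (simp add: algebra_simps power2_eq_square)
qed

text \<open>
  For fixed \<open>w\<close> the defining condition says that \<open>1 - x\<^sub>2w - z(x\<^sub>1 - x\<^sub>3w)\<close> has no zero \<open>z\<close> in the closed disc, that
  is, \<open>\<Psi>(w) = (x\<^sub>1 - x\<^sub>3w) / (1 - x\<^sub>2w)\<close> has modulus below \<open>1\<close>. The claim is the Schwarz-Pick inequality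
  for \<open>\<Psi>\<close>.
\<close>
lemma tetrablock_schwarz_pick:
  assumes "(x1, x2, x3) \<in> tetrablock"
  shows "cmod (x3 - x1 * x2) \<le> 1 - (cmod x1)\<^sup>2"
proof -
  have nz: "1 - x1 * z - x2 * w + x3 * z * w \<noteq> 0" if "cmod z \<le> 1" "cmod w \<le> 1" for z w
    using assms that by (auto simp: tetrablock_def)
  have d: "1 - x2 * w \<noteq> 0" if "cmod w < 1" for w using nz[of 0 w] that by simp
  define \<Psi> where "\<Psi> = (\<lambda>w. (x1 - x3 * w) / (1 - x2 * w))"
  have hol: "\<Psi> holomorphic_on ball 0 1" unfolding \<Psi>_def using d by (intro holomorphic_intros) auto
  have lt: "cmod (\<Psi> w) < 1" if w: "cmod w < 1" for w
  proof (rule ccontr)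
    assume "\<not> cmod (\<Psi> w) < 1"
    then have le: "cmod (1 - x2 * w) \<le> cmod (x1 - x3 * w)"
      using d[OF w] by (simp add: \<Psi>_def norm_divide le_divide_eq not_less)
    then have n: "x1 - x3 * w \<noteq> 0" using d[OF w] by auto
    define z where "z = (1 - x2 * w) / (x1 - x3 * w)"
    have "cmod z \<le> 1" using le n by (simp add: z_def norm_divide)
    moreover have "z * (x1 - x3 * w) = 1 - x2 * w" using n by (simp add: z_def)
    then have "1 - x1 * z - x2 * w + x3 * z * w = 0" by (simp add: algebra_simps)
    ultimately show False using nz[of z w] w by simp
  qed
  have "(\<Psi> has_field_derivative (- x3 + x1 * x2)) (at 0)"
    unfolding \<Psi>_def by (auto intro!: derivative_eq_intros)
  from schwarz_pick_at_0[OF hol lt this] show ?thesis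
    by (simp add: \<Psi>_def norm_minus_commute)
qed

lemma tetrablock_swap: "(x1, x2, x3) \<in> tetrablock \<Longrightarrow> (x2, x1, x3) \<in> tetrablock"
  unfolding tetrablock_def
proof (clarify)
  fix z w
  assume "\<forall>z w. cmod z \<le> 1 \<longrightarrow> cmod w \<le> 1 \<longrightarrow> 1 - x1 * z - x2 * w + x3 * z * w \<noteq> 0"
    "cmod z \<le> 1" "cmod w \<le> 1" "1 - x2 * z - x1 * w + x3 * z * w = 0"
  moreover have "1 - x1 * w - x2 * z + x3 * w * z = 1 - x2 * z - x1 * w + x3 * z * w" by (simp add: algebra_simps)
  ultimately show False by metis
qed

text \<open>
  The two inequalities define a closed set and therefore pass from the tetrablock to its closure. They bound all
  three coordinates, which yields compactness, and they are the estimates for the witness.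
\<close>
lemma closure_tetrablock_bounds:
  assumes "(x1, x2, x3) \<in> closure tetrablock"
  shows "cmod (x3 - x1 * x2) \<le> 1 - (cmod x1)\<^sup>2" "cmod (x3 - x1 * x2) \<le> 1 - (cmod x2)\<^sup>2"
proof -
  let ?C = "{x :: point. cmod (snd (snd x) - fst x * fst (snd x)) \<le> 1 - (cmod (fst x))\<^sup>2 \<and>
     cmod (snd (snd x) - fst x * fst (snd x)) \<le> 1 - (cmod (fst (snd x)))\<^sup>2}"
  have "closed ?C" by (intro closed_Collect_conj closed_Collect_le continuous_intros)
  moreover have "tetrablock \<subseteq> ?C"
  proof
    fix x assume x: "x \<in> tetrablock"
    obtain x1 x2 x3 where e: "x = (x1, x2, x3)" by (cases x) auto
    show "x \<in> ?C" using tetrablock_schwarz_pick[of x1 x2 x3] tetrablock_schwarz_pick[OF tetrablock_swap, of x1 x2 x3] x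
      by (simp add: e mult.commute)
  qed
  ultimately have "closure tetrablock \<subseteq> ?C" by (rule closure_minimal[rotated])
  then show "cmod (x3 - x1 * x2) \<le> 1 - (cmod x1)\<^sup>2" "cmod (x3 - x1 * x2) \<le> 1 - (cmod x2)\<^sup>2" using assms by auto
qed

lemma compact_closure_tetrablock: "compact (closure tetrablock)"
proof -
  have "norm x \<le> 1 + (1 + 2)" if "x \<in> closure tetrablock" for x
  proof -
    obtain x1 x2 x3 where x: "x = (x1, x2, x3)" by (cases x) auto
    note b = closure_tetrablock_bounds[OF that[unfolded x]]
    have 1: "(cmod x1)\<^sup>2 \<le> 1" "(cmod x2)\<^sup>2 \<le> 1" "cmod (x3 - x1 * x2) \<le> 1"
      using b norm_ge_zero[of "x3 - x1 * x2"] zero_le_power2[of "cmod x1"] by linarith+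
    then have 2: "cmod x1 \<le> 1" "cmod x2 \<le> 1" by (simp_all add: power_le_one_iff abs_square_le_1)
    have "cmod (x1 * x2) \<le> 1" using 2 by (simp add: norm_mult mult_le_one)
    then have "cmod x3 \<le> 2" using 1(3) norm_triangle_sub[of x3 "x1 * x2"] by linarith
    then have "cmod x1 + (cmod x2 + cmod x3) \<le> 1 + (1 + 2)" using 2 by linarith
    moreover have "norm x \<le> cmod x1 + norm (x2, x3)" unfolding x by (rule norm_Pair_le)
    moreover have "norm (x2, x3) \<le> cmod x2 + cmod x3" by (rule norm_Pair_le)
    ultimately show ?thesis by linarith
  qed
  then have "bounded (closure tetrablock)" unfolding bounded_iff by blast
  then show ?thesis by (simp add: compact_eq_bounded_closed)
qed

lemma bidisc_in_tetrablock:
  assumes "cmod u < 1" "cmod v < 1" shows "(u, v, u * v) \<in> tetrablock"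
  unfolding tetrablock_def
proof (clarify)
  fix z w assume zw: "cmod z \<le> 1" "cmod w \<le> 1" "1 - u * z - v * w + u * v * z * w = 0"
  then have "(1 - u * z) * (1 - v * w) = 0" by (simp add: algebra_simps)
  then have "u * z = 1 \<or> v * w = 1" by auto
  moreover have "cmod (u * z) < 1" "cmod (v * w) < 1"
    using assms zw mult_left_le[of "cmod z" "cmod u"] mult_left_le[of "cmod w" "cmod v"]
    by (auto simp: norm_mult intro: le_less_trans)
  ultimately show False by auto
qed

lemma axis_disc_in_tetrablock:
  assumes "cmod l < 1" shows "(0, 0, l) \<in> tetrablock"
  unfolding tetrablock_def
proof (clarify)
  fix z w assume zw: "cmod z \<le> 1" "cmod w \<le> 1" "1 - 0 * z - 0 * w + l * z * w = 0"
  then have "- (l * z * w) = 1" by (simp add: add_eq_0_iff2)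
  then have "cmod l * (cmod z * cmod w) = 1" by (metis mult.assoc norm_minus_cancel norm_mult norm_one)
  moreover have "cmod z * cmod w \<le> 1" using zw by (simp add: mult_le_one)
  then have "cmod l * (cmod z * cmod w) \<le> cmod l" by (rule mult_left_le) simp
  ultimately show False using assms by simp
qed

lemma zero_in_tetrablock: "(0, 0, 0) \<in> tetrablock"
  using axis_disc_in_tetrablock[of 0] by simp

lemma sum_keys_delta:
  "(\<Sum>m\<in>Poly_Mapping.keys p. Poly_Mapping.lookup p m * (if m = e then a else (0::complex))) = Poly_Mapping.lookup p e * a"
proof -
  have "(\<Sum>m\<in>Poly_Mapping.keys p. Poly_Mapping.lookup p m * (if m = e then a else 0))
    = (\<Sum>m\<in>Poly_Mapping.keys p. if m = e then Poly_Mapping.lookup p e * a else 0)"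
    by (intro sum.cong) auto
  also have "\<dots> = Poly_Mapping.lookup p e * a" by (auto simp: in_keys_iff)
  finally show ?thesis .
qed

lemma peval_zero: "peval p (0, 0, 0) = Poly_Mapping.lookup p (0, 0, 0)"
proof -
  have "peval p (0, 0, 0) = (\<Sum>m\<in>Poly_Mapping.keys p. Poly_Mapping.lookup p m * (if m = (0, 0, 0) then 1 else 0))"
    unfolding peval_eq_sum by (intro sum.cong) (auto simp: power_0_left)
  then show ?thesis by (simp add: sum_keys_delta)
qed

text \<open>
  One family for both kinds of discs through the origin: \<open>(u\<lambda>, v\<lambda>, uv\<lambda>\<^sup>2)\<close> and \<open>(0, 0, \<lambda>)\<close>.
\<close>
definition curve :: "complex \<Rightarrow> complex \<Rightarrow> complex \<Rightarrow> complex \<Rightarrow> complex \<Rightarrow> point" where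
  "curve \<alpha> \<beta> \<kappa> \<delta> l = (\<alpha> * l, \<beta> * l, \<kappa> * l + \<delta> * l\<^sup>2)"

text \<open>
  The derivative of \<open>p\<close> at the origin in direction \<open>(\<alpha>, \<beta>, \<kappa>)\<close>.
\<close>
definition jet :: "cpoly3 \<Rightarrow> complex \<Rightarrow> complex \<Rightarrow> complex \<Rightarrow> complex" where
  "jet p \<alpha> \<beta> \<kappa> = Poly_Mapping.lookup p (1, 0, 0) * \<alpha> + Poly_Mapping.lookup p (0, 1, 0) * \<beta>
     + Poly_Mapping.lookup p (0, 0, 1) * \<kappa>"

lemma peval_curve_holomorphic: "(\<lambda>l. peval p (curve \<alpha> \<beta> \<kappa> \<delta> l)) holomorphic_on A"
  unfolding peval_eq_sum curve_def by (auto intro!: holomorphic_intros)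

lemma monomial_curve_derivative:
  "((\<lambda>l. (\<alpha> * l) ^ a * (\<beta> * l) ^ b * (\<kappa> * l + \<delta> * l\<^sup>2) ^ c) has_field_derivative
    ((if (a, b, c) = (1, 0, 0) then \<alpha> else 0) + (if (a, b, c) = (0, 1, 0) then \<beta> else 0)
      + (if (a, b, c) = (0, 0, 1) then \<kappa> else (0::complex)))) (at 0)"
  by (cases "a = 0"; cases "a = 1"; cases "b = 0"; cases "b = 1"; cases "c = 0"; cases "c = 1")
    (auto intro!: derivative_eq_intros simp: power_0_left)

lemma peval_curve_derivative:
  "((\<lambda>l. peval p (curve \<alpha> \<beta> \<kappa> \<delta> l)) has_field_derivative jet p \<alpha> \<beta> \<kappa>) (at 0)"
proof -
  let ?d = "\<lambda>m. (if m = (1, 0, 0) then \<alpha> else 0) + (if m = (0, 1, 0) then \<beta> else 0)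
      + (if m = (0, 0, 1) then \<kappa> else 0)"
  have "((\<lambda>l. peval p (curve \<alpha> \<beta> \<kappa> \<delta> l)) has_field_derivative
    (\<Sum>m\<in>Poly_Mapping.keys p. Poly_Mapping.lookup p m * ?d m)) (at 0)"
    unfolding peval_eq_sum curve_def fst_conv snd_conv
  proof (intro DERIV_sum DERIV_cmult)
    fix m :: "nat \<times> nat \<times> nat"
    obtain a b c where m: "m = (a, b, c)" by (cases m) auto
    show "((\<lambda>l. (\<alpha> * l) ^ fst m * (\<beta> * l) ^ fst (snd m) * (\<kappa> * l + \<delta> * l\<^sup>2) ^ snd (snd m)) has_field_derivative ?d m) (at 0)"
      using monomial_curve_derivative[of \<alpha> a \<beta> b \<kappa> \<delta> c] by (simp only: m fst_conv snd_conv)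
  qed
  also have "(\<Sum>m\<in>Poly_Mapping.keys p. Poly_Mapping.lookup p m * ?d m) = jet p \<alpha> \<beta> \<kappa>"
    by (simp only: distrib_left sum.distrib sum_keys_delta jet_def)
  finally show ?thesis .
qed

text \<open>
  The derivative of \<open>p / q\<close> at the origin, by the quotient rule.
\<close>
definition rjet :: "cratfun3 \<Rightarrow> complex \<Rightarrow> complex \<Rightarrow> complex \<Rightarrow> complex" where
  "rjet f \<alpha> \<beta> \<kappa> = (case f of (p, q) \<Rightarrow>
    (jet p \<alpha> \<beta> \<kappa> * peval q (0, 0, 0) - peval p (0, 0, 0) * jet q \<alpha> \<beta> \<kappa>) / (peval q (0, 0, 0))\<^sup>2)"

lemma rjet_linear: "rjet f \<alpha> \<beta> \<kappa> = rjet f 1 0 0 * \<alpha> + rjet f 0 1 0 * \<beta> + rjet f 0 0 1 * \<kappa>"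
  by (cases f) (simp add: rjet_def jet_def add_divide_distrib diff_divide_distrib algebra_simps)

lemma curve_schwarz_pick:
  assumes f: "f \<in> Rat \<Omega>" and in_om: "\<And>l. cmod l < 1 \<Longrightarrow> curve \<alpha> \<beta> \<kappa> \<delta> l \<in> \<Omega>"
    and S: "\<And>w. w \<in> \<Omega> \<Longrightarrow> cmod (reval f w) < S"
  shows "S * cmod (rjet f \<alpha> \<beta> \<kappa>) \<le> S\<^sup>2 - (cmod (reval f (0, 0, 0)))\<^sup>2"
proof -
  obtain p q where pq: "f = (p, q)" by (cases f)
  have q: "peval q w \<noteq> 0" if "w \<in> \<Omega>" for w using f that by (auto simp: pq Rat_def)
  have c0: "curve \<alpha> \<beta> \<kappa> \<delta> 0 = (0, 0, 0)" by (simp add: curve_def)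
  let ?g = "\<lambda>l. peval p (curve \<alpha> \<beta> \<kappa> \<delta> l) / peval q (curve \<alpha> \<beta> \<kappa> \<delta> l)"
  have q0: "peval q (0, 0, 0) \<noteq> 0" using q[OF in_om[of 0]] by (simp add: c0 del: peval.simps)
  have "S * cmod (rjet f \<alpha> \<beta> \<kappa>) \<le> S\<^sup>2 - (cmod (?g 0))\<^sup>2"
  proof (rule schwarz_pick_scaled)
    show "?g holomorphic_on ball 0 1"
      using q in_om by (intro holomorphic_on_divide peval_curve_holomorphic) (auto simp del: peval.simps)
    show "cmod (?g z) < S" if "cmod z < 1" for z
      using S[OF in_om[OF that]] by (simp add: pq del: peval.simps)
    have "(?g has_field_derivative (jet p \<alpha> \<beta> \<kappa> * peval q (curve \<alpha> \<beta> \<kappa> \<delta> 0)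
      - peval p (curve \<alpha> \<beta> \<kappa> \<delta> 0) * jet q \<alpha> \<beta> \<kappa>) / (peval q (curve \<alpha> \<beta> \<kappa> \<delta> 0) * peval q (curve \<alpha> \<beta> \<kappa> \<delta> 0))) (at 0)"
      by (rule DERIV_divide[OF peval_curve_derivative peval_curve_derivative]) (use q0 c0 in \<open>simp del: peval.simps\<close>)
    then show "(?g has_field_derivative rjet f \<alpha> \<beta> \<kappa>) (at 0)"
      by (simp add: rjet_def pq c0 power2_eq_square del: peval.simps)
  qed
  then show ?thesis by (simp add: c0 pq del: peval.simps)
qed

lemma exists_phase: "\<exists>u. cmod u = 1 \<and> x * u = complex_of_real (cmod x)"
proof (cases "x = 0")
  case False
  then show ?thesis
    by (intro exI[of _ "cnj x / complex_of_real (cmod x)"])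
      (simp add: norm_divide complex_norm_square[symmetric] power2_eq_square field_simps flip: of_real_mult)
qed (auto intro: exI[of _ 1])

text \<open>
  The phases \<open>u\<close> and \<open>v\<close> of the disc \<open>(u\<lambda>, v\<lambda>, uv\<lambda>\<^sup>2)\<close> are free, so they can be chosen to align the two
  partial derivatives.
\<close>
lemma tetrablock_derivative_bounds:
  assumes f: "f \<in> Rat (closure tetrablock)" and S: "\<And>w. w \<in> closure tetrablock \<Longrightarrow> cmod (reval f w) < S"
  shows "S * (cmod (rjet f 1 0 0) + cmod (rjet f 0 1 0)) \<le> S\<^sup>2 - (cmod (reval f (0, 0, 0)))\<^sup>2"
    "S * cmod (rjet f 0 0 1) \<le> S\<^sup>2 - (cmod (reval f (0, 0, 0)))\<^sup>2"
proof -
  have cl: "w \<in> closure tetrablock" if "w \<in> tetrablock" for w using that closure_subset by blast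
  show "S * cmod (rjet f 0 0 1) \<le> S\<^sup>2 - (cmod (reval f (0, 0, 0)))\<^sup>2"
    by (rule curve_schwarz_pick[OF f _ S, where \<delta>=0]) (auto simp: curve_def intro!: cl axis_disc_in_tetrablock)
  \<comment> \<open>The phases align both terms, so that the directional derivative is the sum of their moduli.\<close>
  obtain u v where u: "cmod u = 1" "rjet f 1 0 0 * u = complex_of_real (cmod (rjet f 1 0 0))"
    and v: "cmod v = 1" "rjet f 0 1 0 * v = complex_of_real (cmod (rjet f 0 1 0))"
    using exists_phase by metis
  have "rjet f u v 0 = complex_of_real (cmod (rjet f 1 0 0) + cmod (rjet f 0 1 0))"
    by (subst rjet_linear) (simp add: u v)
  then have "cmod (rjet f u v 0) = cmod (rjet f 1 0 0) + cmod (rjet f 0 1 0)"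
    by (simp only: norm_of_real) simp
  moreover have "S * cmod (rjet f u v 0) \<le> S\<^sup>2 - (cmod (reval f (0, 0, 0)))\<^sup>2"
  proof (rule curve_schwarz_pick[OF f _ S, where \<delta>="u * v"])
    fix l assume "cmod l < 1"
    then have "(u * l, v * l, (u * l) * (v * l)) \<in> tetrablock"
      by (intro bidisc_in_tetrablock) (simp_all add: norm_mult u v)
    then show "curve u v 0 (u * v) l \<in> closure tetrablock"
      by (intro cl) (simp add: curve_def power2_eq_square mult_ac)
  qed
  ultimately show "S * (cmod (rjet f 1 0 0) + cmod (rjet f 0 1 0)) \<le> S\<^sup>2 - (cmod (reval f (0, 0, 0)))\<^sup>2" by simp
qed

section \<open>The counterexample\<close>

text \<open>
  The operator on \<open>\<complex>\<^sup>4 = \<complex>\<^sup>2 \<oplus> \<complex>\<^sup>2\<close> with diagonal blocks \<open>c\<close> and corner \<open>l\<^sub>1 A\<^sub>1 + l\<^sub>2 A\<^sub>2 + l\<^sub>3 A\<^sub>3\<close>. These operators are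
  closed under products and inverses, and all rational functions of the example are of this form.
\<close>
definition block_op :: "complex \<Rightarrow> complex \<Rightarrow> complex \<Rightarrow> complex \<Rightarrow> cvec \<Rightarrow> cvec" where
  "block_op c l1 l2 l3 v = vec 4 (\<lambda>i. if i = 0 then c * v $ 0 + (l3 / 2 * v $ 2 + 3/4 * l1 * v $ 3)
     else if i = 1 then c * v $ 1 + (3/4 * l2 * v $ 2 + l3 / 2 * v $ 3) else c * v $ i)"

lemma less_4: "(i < (4::nat)) \<longleftrightarrow> i = 0 \<or> i = 1 \<or> i = 2 \<or> i = 3"
  by auto

lemma block_op_carrier [simp]: "block_op c l1 l2 l3 v \<in> carrier_vec 4"
  by (simp add: block_op_def)

lemma block_op_index: "block_op c l1 l2 l3 v $ 0 = c * v $ 0 + (l3 / 2 * v $ 2 + 3/4 * l1 * v $ 3)"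
  "block_op c l1 l2 l3 v $ 1 = c * v $ 1 + (3/4 * l2 * v $ 2 + l3 / 2 * v $ 3)"
  "block_op c l1 l2 l3 v $ 2 = c * v $ 2" "block_op c l1 l2 l3 v $ 3 = c * v $ 3"
  by (simp_all add: block_op_def)

lemma vec4_eqI:
  assumes "v \<in> carrier_vec 4" "w \<in> carrier_vec 4" "v $ 0 = w $ 0" "v $ 1 = w $ 1" "v $ 2 = w $ 2" "v $ 3 = w $ 3"
  shows "v = w"
  using assms by (intro eq_vecI) (auto simp: less_4)

lemma block_op_comp: "block_op c l1 l2 l3 (block_op d m1 m2 m3 v)
    = block_op (c * d) (c * m1 + l1 * d) (c * m2 + l2 * d) (c * m3 + l3 * d) v"
  by (rule vec4_eqI) (auto simp: block_op_index block_op_carrier algebra_simps add_divide_distrib simp del: One_nat_def)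

lemma block_op_id: "v \<in> carrier_vec 4 \<Longrightarrow> block_op 1 0 0 0 v = v"
  by (rule vec4_eqI) (auto simp: block_op_index simp del: One_nat_def)

lemma hnorm4_sq:
  assumes "v \<in> carrier_vec 4"
  shows "(hnorm (cspace 4) v)\<^sup>2 = (norm (v $ 0, v $ 1))\<^sup>2 + (norm (v $ 2, v $ 3))\<^sup>2"
  using assms by (simp add: hnorm_cspace L2_set_def norm_prod_def sum_nonneg eval_nat_numeral)

text \<open>
  The left-hand side is convex in \<open>(a, b)\<close>, so the extreme cases \<open>(m, 0)\<close> and \<open>(0, m)\<close> decide. There the
  difference of the two sides is \<open>(3/4) m\<^sup>2 (s - t/2)\<^sup>2\<close> or its mirror image: with the entries \<open>3/4\<close> and \<open>1/2\<close> the
  inequality is sharp.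
\<close>
lemma corner_real_bound:
  fixes s t a b m p :: real
  assumes "a \<ge> 0" "b \<ge> 0" "a + b \<le> m" "p \<ge> 0" "p \<le> m" "s \<ge> 0" "t \<ge> 0"
  shows "(p / 2 * s + 3/4 * a * t)\<^sup>2 + (3/4 * b * s + p / 2 * t)\<^sup>2 \<le> m\<^sup>2 * (s\<^sup>2 + t\<^sup>2)"
proof -
  \<comment> \<open>By monotonicity \<open>p = m\<close> and \<open>a + b = m\<close> may be assumed.\<close>
  define b' where "b' = m - a"
  have b': "b \<le> b'" "b' \<ge> 0" "a \<le> m" "b' \<le> m" using assms by (auto simp: b'_def)
  have "(p / 2 * s + 3/4 * a * t)\<^sup>2 + (3/4 * b * s + p / 2 * t)\<^sup>2
      \<le> (m / 2 * s + 3/4 * a * t)\<^sup>2 + (3/4 * b' * s + m / 2 * t)\<^sup>2"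
    using assms b' by (intro add_mono power_mono mult_right_mono) auto
  also have "\<dots> = m\<^sup>2 * (s\<^sup>2 + t\<^sup>2) / 4 + 3/4 * m * (a + b') * s * t + 9/16 * (a * a * t\<^sup>2 + b' * b' * s\<^sup>2)"
    by (simp add: power2_eq_square field_simps)
  also have "\<dots> \<le> m\<^sup>2 * (s\<^sup>2 + t\<^sup>2) / 4 + 3/4 * m * (a + b') * s * t + 9/16 * (m * a * t\<^sup>2 + m * b' * s\<^sup>2)"
    using assms b' by (intro add_mono mult_left_mono mult_right_mono) auto
  also have "\<dots> = m\<^sup>2 * (s\<^sup>2 + t\<^sup>2) - 3/4 * (m * a * (s - t / 2)\<^sup>2 + m * b' * (t - s / 2)\<^sup>2)"
    by (simp add: b'_def power2_eq_square field_simps)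
  also have "\<dots> \<le> m\<^sup>2 * (s\<^sup>2 + t\<^sup>2)"
    using assms b' by (simp add: add_nonneg_nonneg)
  finally show ?thesis .
qed

lemma corner_bound:
  assumes "cmod l1 + cmod l2 \<le> m" "cmod l3 \<le> m"
  shows "norm (l3 / 2 * x + 3/4 * l1 * y, 3/4 * l2 * x + l3 / 2 * y) \<le> m * norm (x, y)"
proof (rule power2_le_imp_le)
  have m: "m \<ge> 0" using assms norm_ge_zero[of l3] by linarith
  then show "0 \<le> m * norm (x, y)" by simp
  have 1: "cmod (l3 / 2 * x + 3/4 * l1 * y) \<le> cmod l3 / 2 * cmod x + 3/4 * cmod l1 * cmod y"
    using norm_triangle_ineq[of "l3 / 2 * x" "3/4 * l1 * y"] by (simp add: norm_mult norm_divide)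
  have 2: "cmod (3/4 * l2 * x + l3 / 2 * y) \<le> 3/4 * cmod l2 * cmod x + cmod l3 / 2 * cmod y"
    using norm_triangle_ineq[of "3/4 * l2 * x" "l3 / 2 * y"] by (simp add: norm_mult norm_divide)
  have "(norm (l3 / 2 * x + 3/4 * l1 * y, 3/4 * l2 * x + l3 / 2 * y))\<^sup>2
    = (cmod (l3 / 2 * x + 3/4 * l1 * y))\<^sup>2 + (cmod (3/4 * l2 * x + l3 / 2 * y))\<^sup>2"
    by (simp add: norm_prod_def)
  also have "\<dots> \<le> (cmod l3 / 2 * cmod x + 3/4 * cmod l1 * cmod y)\<^sup>2 + (3/4 * cmod l2 * cmod x + cmod l3 / 2 * cmod y)\<^sup>2"
    by (intro add_mono power_mono 1 2) auto
  also have "\<dots> \<le> m\<^sup>2 * ((cmod x)\<^sup>2 + (cmod y)\<^sup>2)"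
    by (rule corner_real_bound) (use assms in auto)
  also have "\<dots> = (m * norm (x, y))\<^sup>2" by (simp add: norm_prod_def power_mult_distrib)
  finally show "(norm (l3 / 2 * x + 3/4 * l1 * y, 3/4 * l2 * x + l3 / 2 * y))\<^sup>2 \<le> (m * norm (x, y))\<^sup>2" .
qed

text \<open>
  The corner has norm at most \<open>m = (S\<^sup>2 - |c|\<^sup>2) / S\<close>, and with this \<open>m\<close> the scalar matrix with rows \<open>(|c|, m)\<close> and
  \<open>(0, |c|)\<close> has norm \<open>S\<close>.
\<close>
lemma block_op_contraction:
  assumes v: "v \<in> carrier_vec 4" and S: "S > 0"
    and l: "S * (cmod l1 + cmod l2) \<le> S\<^sup>2 - (cmod c)\<^sup>2" "S * cmod l3 \<le> S\<^sup>2 - (cmod c)\<^sup>2"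
  shows "hnorm (cspace 4) (block_op c l1 l2 l3 v) \<le> S * hnorm (cspace 4) v"
proof (rule power2_le_imp_le)
  define m where "m = (S\<^sup>2 - (cmod c)\<^sup>2) / S"
  have l': "cmod l1 + cmod l2 \<le> m" "cmod l3 \<le> m"
    using l S by (auto simp: m_def le_divide_eq mult.commute)
  have m: "m \<ge> 0" using l'(2) norm_ge_zero[of l3] by linarith
  have mS: "m * S = S\<^sup>2 - (cmod c)\<^sup>2" using S by (simp add: m_def)
  let ?\<tau> = "norm (v $ 0, v $ 1)" and ?\<beta> = "norm (v $ 2, v $ 3)"
  let ?e = "l3 / 2 * v $ 2 + 3/4 * l1 * v $ 3" and ?f = "3/4 * l2 * v $ 2 + l3 / 2 * v $ 3"
  have sc: "norm (c * x, c * y) = cmod c * norm (x, y)" for x y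
    by (rule power2_eq_imp_eq) (simp_all add: norm_prod_def power_mult_distrib norm_mult distrib_left)
  have "norm (c * v $ 0 + ?e, c * v $ 1 + ?f) \<le> norm (c * v $ 0, c * v $ 1) + norm (?e, ?f)"
    using norm_triangle_ineq[of "(c * v $ 0, c * v $ 1)" "(?e, ?f)"] by simp
  also have "\<dots> \<le> cmod c * ?\<tau> + m * ?\<beta>"
    using corner_bound[OF l', of "v $ 2" "v $ 3"] by (simp add: sc)
  finally have top: "norm (c * v $ 0 + ?e, c * v $ 1 + ?f) \<le> cmod c * ?\<tau> + m * ?\<beta>" .
  have "(hnorm (cspace 4) (block_op c l1 l2 l3 v))\<^sup>2
    = (norm (c * v $ 0 + ?e, c * v $ 1 + ?f))\<^sup>2 + (norm (c * v $ 2, c * v $ 3))\<^sup>2"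
    by (simp only: hnorm4_sq[OF block_op_carrier] block_op_index)
  also have "\<dots> \<le> (cmod c * ?\<tau> + m * ?\<beta>)\<^sup>2 + (cmod c * ?\<beta>)\<^sup>2"
    using top by (intro add_mono power_mono) (auto simp: sc)
  also have "\<dots> \<le> S\<^sup>2 * (?\<tau>\<^sup>2 + ?\<beta>\<^sup>2)"
  proof -
    have "S * (S\<^sup>2 * (?\<tau>\<^sup>2 + ?\<beta>\<^sup>2) - ((cmod c * ?\<tau> + m * ?\<beta>)\<^sup>2 + (cmod c * ?\<beta>)\<^sup>2))
        = m * (S * ?\<tau> - cmod c * ?\<beta>)\<^sup>2"
    proof -
      have "S * (S\<^sup>2 * (t\<^sup>2 + b\<^sup>2) - ((g * t + m * b)\<^sup>2 + (g * b)\<^sup>2)) = m * (S * t - g * b)\<^sup>2"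
        if "m * S = S\<^sup>2 - g\<^sup>2" for t b g :: real
      proof -
        have g: "g * g = S * S - m * S" using that by (simp add: power2_eq_square)
        have "S * (S\<^sup>2 * (t\<^sup>2 + b\<^sup>2) - ((g * t + m * b)\<^sup>2 + (g * b)\<^sup>2))
          = S * (S * S * (t * t + b * b) - (g * g) * (t * t + b * b) - 2 * (g * t * m * b) - m * m * b * b)"
          by (simp add: power2_eq_square algebra_simps)
        also have "\<dots> = m * (S * S * t * t - 2 * S * t * g * b + (g * g) * b * b)"
          unfolding g by (simp add: algebra_simps)
        also have "\<dots> = m * (S * t - g * b)\<^sup>2" by (simp add: power2_eq_square algebra_simps)
        finally show ?thesis .
      qed
      from this[OF mS] show ?thesis .
    qed
    also have "\<dots> \<ge> 0" using m by simp
    finally show ?thesis using S by (simp add: zero_le_mult_iff)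
  qed
  also have "\<dots> = (S * hnorm (cspace 4) v)\<^sup>2" by (simp add: power_mult_distrib hnorm4_sq[OF v])
  finally show "(hnorm (cspace 4) (block_op c l1 l2 l3 v))\<^sup>2 \<le> (S * hnorm (cspace 4) v)\<^sup>2" .
qed (use S v in \<open>auto simp: hnorm_cspace\<close>)

interpretation C4: hilbert_space "cspace 4"
  by (rule hilbert_space_cspace)

lemma bop_block_op: "C4.bop (block_op c l1 l2 l3)"
proof -
  \<comment> \<open>A crude choice for which the hypotheses of \<open>block_op_contraction\<close> hold.\<close>
  define S where "S = cmod c + (cmod l1 + cmod l2 + cmod l3) + 1"
  have S: "S > 0" by (simp add: S_def add_nonneg_pos)
  have "S * (S - cmod c) \<le> S\<^sup>2 - (cmod c)\<^sup>2"
  proof -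
    have "S\<^sup>2 - (cmod c)\<^sup>2 = S * (S - cmod c) + cmod c * (S - cmod c)" by (simp add: power2_eq_square algebra_simps)
    moreover have "cmod c * (S - cmod c) \<ge> 0" by (simp add: S_def)
    ultimately show ?thesis by linarith
  qed
  moreover have "S * (cmod l1 + cmod l2) \<le> S * (S - cmod c)" "S * cmod l3 \<le> S * (S - cmod c)"
    using S by (auto intro!: mult_left_mono simp: S_def)
  ultimately have l: "S * (cmod l1 + cmod l2) \<le> S\<^sup>2 - (cmod c)\<^sup>2" "S * cmod l3 \<le> S\<^sup>2 - (cmod c)\<^sup>2" by linarith+
  show ?thesis
  proof (rule C4.bopI[where C=S])
    fix x y assume "x \<in> carrier (cspace 4)" "y \<in> carrier (cspace 4)"
    then show "block_op c l1 l2 l3 (x \<oplus>\<^bsub>cspace 4\<^esub> y) = block_op c l1 l2 l3 x \<oplus>\<^bsub>cspace 4\<^esub> block_op c l1 l2 l3 y"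
      unfolding cspace_simps by (intro vec4_eqI) (auto simp: block_op_index algebra_simps block_op_def simp del: One_nat_def)
  next
    fix a x assume "x \<in> carrier (cspace 4)"
    then show "block_op c l1 l2 l3 (a \<odot>\<^bsub>cspace 4\<^esub> x) = a \<odot>\<^bsub>cspace 4\<^esub> block_op c l1 l2 l3 x"
      unfolding cspace_simps by (intro vec4_eqI) (auto simp: algebra_simps block_op_def)
  qed (use block_op_contraction[OF _ S l] in \<open>auto simp: cspace_simps\<close>)
qed

definition ex_A1 :: "complex mat" where "ex_A1 = mat 2 2 (\<lambda>(i, j). if i = 0 \<and> j = 1 then 3/4 else 0)"
definition ex_A2 :: "complex mat" where "ex_A2 = mat 2 2 (\<lambda>(i, j). if i = 1 \<and> j = 0 then 3/4 else 0)"
definition ex_A3 :: "complex mat" where "ex_A3 = mat 2 2 (\<lambda>(i, j). if i = j then 1/2 else 0)"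

lemma nilpotent_op_2:
  assumes A: "A \<in> carrier_mat 2 2" and v: "v \<in> carrier_vec 4"
  shows "nilpotent_op 2 A v = vec 4 (\<lambda>i. if i < 2 then A $$ (i, 0) * v $ 2 + A $$ (i, 1) * v $ 3 else 0)"
proof (rule eq_vecI)
  fix i assume "i < dim_vec (vec 4 (\<lambda>i. if i < 2 then A $$ (i, 0) * v $ 2 + A $$ (i, 1) * v $ 3 else 0))"
  then have i: "i < 4" by simp
  have s: "{0..<4::nat} = {0, 1, 2, 3}" by auto
  show "nilpotent_op 2 A v $ i = vec 4 (\<lambda>i. if i < 2 then A $$ (i, 0) * v $ 2 + A $$ (i, 1) * v $ 3 else 0) $ i"
    using A v i unfolding nilpotent_op_def by (auto simp: scalar_prod_def s less_4 four_block_mat_def)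
qed (use A in \<open>simp add: nilpotent_op_def\<close>)

lemma ex_A_carrier: "ex_A1 \<in> carrier_mat 2 2" "ex_A2 \<in> carrier_mat 2 2" "ex_A3 \<in> carrier_mat 2 2"
  by (simp_all add: ex_A1_def ex_A2_def ex_A3_def)

lemma nilpotent_op_block_op:
  assumes "v \<in> carrier_vec 4"
  shows "nilpotent_op 2 ex_A1 v = block_op 0 1 0 0 v" "nilpotent_op 2 ex_A2 v = block_op 0 0 1 0 v" "nilpotent_op 2 ex_A3 v = block_op 0 0 0 1 v"
  unfolding nilpotent_op_2[OF ex_A_carrier(1) assms] nilpotent_op_2[OF ex_A_carrier(2) assms] nilpotent_op_2[OF ex_A_carrier(3) assms]
  by (rule eq_vecI; simp add: block_op_def ex_A1_def ex_A2_def ex_A3_def less_4; auto)+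

abbreviation ex_triple where "ex_triple \<equiv> nilpotent_triple 2 ex_A1 ex_A2 ex_A3"

lemma bop_nilpotent: "C4.bop (nilpotent_op 2 ex_A1)" "C4.bop (nilpotent_op 2 ex_A2)" "C4.bop (nilpotent_op 2 ex_A3)"
  by (rule C4.bop_cong[OF bop_block_op], simp add: cspace_simps nilpotent_op_block_op)+

lemma commuting_example: "commuting_triple (cspace 4) ex_triple"
  by (simp add: nilpotent_triple_def bop_nilpotent cspace_simps nilpotent_op_block_op block_op_comp)

lemma funpow_block_op:
  assumes X: "\<And>x. x \<in> carrier_vec 4 \<Longrightarrow> X x = block_op 0 l1 l2 l3 x" and v: "v \<in> carrier_vec 4"
  shows "(X ^^ n) v = block_op (if n = 0 then 1 else 0) (if n = 1 then l1 else 0) (if n = 1 then l2 else 0) (if n = 1 then l3 else 0) v"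
proof (induction n)
  case 0
  then show ?case using v by (simp add: block_op_id)
next
  case (Suc n)
  then show ?case using v by (cases n) (simp_all add: X block_op_comp block_op_id)
qed

text \<open>
  Products of two of the operators vanish, so only monomials of degree at most one contribute.
\<close>
lemma monomial_op_example:
  assumes v: "v \<in> carrier_vec 4"
  shows "C4.monomial_op ex_triple m v = block_op (if m = (0, 0, 0) then 1 else 0) (if m = (1, 0, 0) then 1 else 0)
    (if m = (0, 1, 0) then 1 else 0) (if m = (0, 0, 1) then 1 else 0) v"
proof -
  obtain a b c where m: "m = (a, b, c)" by (cases m) auto
  show ?thesis
    unfolding m nilpotent_triple_def C4.monomial_op_def prod.case
    by (simp only: funpow_block_op[OF nilpotent_op_block_op(3) v] funpow_block_op[OF nilpotent_op_block_op(2) block_op_carrier]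
        funpow_block_op[OF nilpotent_op_block_op(1) block_op_carrier] block_op_comp) (auto intro!: arg_cong[where f="\<lambda>x. x"])
qed

lemma finsum_cspace_index:
  assumes "finite A" "\<And>i. i \<in> A \<Longrightarrow> f i \<in> carrier_vec k" "l < k"
  shows "finsum (cspace k) f A $ l = (\<Sum>i\<in>A. f i $ l)"
proof -
  interpret pre_hilbert "cspace k" by (rule pre_hilbert_cspace)
  show ?thesis using assms(1,2)
  proof (induction A rule: finite_induct)
    case empty
    then show ?case using assms(3) by (simp add: cspace_simps)
  next
    case (insert i A)
    have c: "finsum (cspace k) f A \<in> carrier_vec k" using insert finsum_closed[of f A] by (auto simp: cspace_simps)
    have "finsum (cspace k) f (insert i A) = f i \<oplus>\<^bsub>cspace k\<^esub> finsum (cspace k) f A"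
      using insert by (intro finsum_insert) (auto simp: cspace_simps)
    then show ?case using insert c assms(3) by (simp add: cspace_simps)
  qed
qed

lemma peval_op_example:
  assumes v: "v \<in> carrier_vec 4"
  shows "peval_op (cspace 4) p ex_triple v = block_op (Poly_Mapping.lookup p (0, 0, 0)) (jet p 1 0 0) (jet p 0 1 0) (jet p 0 0 1) v"
proof -
  let ?l = "Poly_Mapping.lookup p" and ?K = "Poly_Mapping.keys p"
  have c: "C4.monomial_op ex_triple m v \<in> carrier_vec 4" for m by (simp add: monomial_op_example[OF v])
  have idx: "peval_op (cspace 4) p ex_triple v $ i = (\<Sum>m\<in>?K. ?l m * C4.monomial_op ex_triple m v $ i)" if i: "i < 4" for i
    unfolding C4.peval_op_alt using i
    by (subst finsum_cspace_index) (simp_all add: cspace_simps c carrier_vecD[OF c])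
  have cl: "peval_op (cspace 4) p ex_triple v \<in> carrier_vec 4"
    unfolding C4.peval_op_alt using C4.finsum_closed[of "\<lambda>m. ?l m \<odot>\<^bsub>cspace 4\<^esub> C4.monomial_op ex_triple m v" ?K] c
    by (auto simp: cspace_simps)
  have d: "(\<Sum>m\<in>?K. ?l m * ((if m = e then 1 else 0) * x)) = ?l e * x" for e x
    using sum_keys_delta[of p e x] by (simp add: if_distrib[of "\<lambda>z. z * x"] cong: if_cong)
  let ?D = "\<lambda>e x. (\<Sum>m\<in>?K. ?l m * ((if m = e then 1 else 0) * x))"
  have e: "(\<Sum>m\<in>?K. ?l m * C4.monomial_op ex_triple m v $ 0) = ?D (0, 0, 0) (v $ 0) + (?D (0, 0, 1) (v $ 2 / 2) + ?D (1, 0, 0) (3/4 * v $ 3))"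
    "(\<Sum>m\<in>?K. ?l m * C4.monomial_op ex_triple m v $ 1) = ?D (0, 0, 0) (v $ 1) + (?D (0, 1, 0) (3/4 * v $ 2) + ?D (0, 0, 1) (v $ 3 / 2))"
    "(\<Sum>m\<in>?K. ?l m * C4.monomial_op ex_triple m v $ 2) = ?D (0, 0, 0) (v $ 2)"
    "(\<Sum>m\<in>?K. ?l m * C4.monomial_op ex_triple m v $ 3) = ?D (0, 0, 0) (v $ 3)"
    unfolding sum.distrib[symmetric] monomial_op_example[OF v] block_op_index
    by (intro sum.cong refl; simp add: algebra_simps)+
  have idx': "peval_op (cspace 4) p ex_triple v $ 0 = ?l (0, 0, 0) * v $ 0 + (?l (0, 0, 1) * (v $ 2 / 2) + ?l (1, 0, 0) * (3/4 * v $ 3))"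
    "peval_op (cspace 4) p ex_triple v $ 1 = ?l (0, 0, 0) * v $ 1 + (?l (0, 1, 0) * (3/4 * v $ 2) + ?l (0, 0, 1) * (v $ 3 / 2))"
    "peval_op (cspace 4) p ex_triple v $ 2 = ?l (0, 0, 0) * v $ 2"
    "peval_op (cspace 4) p ex_triple v $ 3 = ?l (0, 0, 0) * v $ 3"
    using idx[of 0] idx[of 1] idx[of 2] idx[of 3] unfolding e d by simp_all
  show ?thesis
    by (rule vec4_eqI[OF cl block_op_carrier]) (simp_all add: idx' block_op_index jet_def algebra_simps del: One_nat_def)
qed

lemma inverse_block_op:
  assumes q: "q \<noteq> 0" and Q: "\<And>x. x \<in> carrier_vec 4 \<Longrightarrow> Q x = block_op q l1 l2 l3 x" and v: "v \<in> carrier_vec 4"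
  shows "inv_into (carrier_vec 4) Q v = block_op (1 / q) (- l1 / q\<^sup>2) (- l2 / q\<^sup>2) (- l3 / q\<^sup>2) v"
proof (rule inv_into_f_eq)
  show "inj_on Q (carrier_vec 4)"
  proof (rule inj_onI)
    fix x y assume xy: "x \<in> carrier_vec 4" "y \<in> carrier_vec 4" "Q x = Q y"
    have "block_op (1 / q) (- l1 / q\<^sup>2) (- l2 / q\<^sup>2) (- l3 / q\<^sup>2) (Q z) = z" if "z \<in> carrier_vec 4" for z
      using q that by (simp add: Q block_op_comp power2_eq_square block_op_id)
    then show "x = y" using xy by metis
  qed
  show "Q (block_op (1 / q) (- l1 / q\<^sup>2) (- l2 / q\<^sup>2) (- l3 / q\<^sup>2) v) = v"
    using q v by (simp add: Q block_op_comp power2_eq_square block_op_id)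
qed simp

lemma reval_op_example:
  assumes f: "f \<in> Rat \<Omega>" "(0, 0, 0) \<in> \<Omega>" and v: "v \<in> carrier_vec 4"
  shows "reval_op (cspace 4) f ex_triple v = block_op (reval f (0, 0, 0)) (rjet f 1 0 0) (rjet f 0 1 0) (rjet f 0 0 1) v"
proof -
  obtain p q where pq: "f = (p, q)" by (cases f)
  define q0 where "q0 = Poly_Mapping.lookup q (0, 0, 0)"
  have q0: "q0 \<noteq> 0" using f by (auto simp: pq Rat_def q0_def peval_zero simp del: peval.simps)
  have "reval_op (cspace 4) f ex_triple v = peval_op (cspace 4) p ex_triple (inv_into (carrier_vec 4) (peval_op (cspace 4) q ex_triple) v)"
    by (simp add: pq cspace_simps del: peval_op.simps)
  also have "\<dots> = block_op (reval f (0, 0, 0)) (rjet f 1 0 0) (rjet f 0 1 0) (rjet f 0 0 1) v"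
  proof -
    have inv: "inv_into (carrier_vec 4) (peval_op (cspace 4) q ex_triple) v
      = block_op (1 / q0) (- jet q 1 0 0 / q0\<^sup>2) (- jet q 0 1 0 / q0\<^sup>2) (- jet q 0 0 1 / q0\<^sup>2) v"
      by (rule inverse_block_op[OF q0 _ v]) (simp add: peval_op_example q0_def del: peval_op.simps)
    show ?thesis
      unfolding inv peval_op_example[OF block_op_carrier] block_op_comp pq reval.simps rjet_def prod.case peval_zero q0_def[symmetric]
      using q0 by (simp add: diff_divide_distrib power2_eq_square)
  qed
  finally show ?thesis .
qed

text \<open>
  A polynomial of the triple is a multiple of the identity plus a nilpotent operator, so its spectrum is the
  value at the origin.
\<close>
lemma joint_spectrum_example: "joint_spectrum (cspace 4) ex_triple \<subseteq> {(0, 0, 0)}"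
proof
  fix w assume w: "w \<in> joint_spectrum (cspace 4) ex_triple"
  obtain w1 w2 w3 where e: "w = (w1, w2, w3)" by (cases w) auto
  have key: "peval p w = 0" if p: "Poly_Mapping.lookup p (0, 0, 0) = 0" for p
  proof (rule ccontr)
    assume n: "peval p w \<noteq> 0"
    let ?S = "\<lambda>x. peval_op (cspace 4) p ex_triple x \<ominus>\<^bsub>cspace 4\<^esub> peval p w \<odot>\<^bsub>cspace 4\<^esub> x"
    have S: "?S x = block_op (- peval p w) (jet p 1 0 0) (jet p 0 1 0) (jet p 0 0 1) x" if x: "x \<in> carrier_vec 4" for x
    proof -
      have c: "peval p w \<cdot>\<^sub>v x \<in> carrier_vec 4" using x by simp
      have c': "?S x \<in> carrier_vec 4" using C4.minus_closed[of "peval_op (cspace 4) p ex_triple x" "peval p w \<odot>\<^bsub>cspace 4\<^esub> x"]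
        x by (simp add: cspace_simps peval_op_example del: peval.simps peval_op.simps)
      show ?thesis
        by (rule vec4_eqI[OF c' block_op_carrier])
          (use x in \<open>simp_all add: peval_op_example cspace_simps(4) cspace_minus_component[OF block_op_carrier c] block_op_index p
            del: peval.simps peval_op.simps One_nat_def\<close>)
    qed
    let ?d = "- peval p w"
    let ?R = "block_op (1 / ?d) (- jet p 1 0 0 / ?d\<^sup>2) (- jet p 0 1 0 / ?d\<^sup>2) (- jet p 0 0 1 / ?d\<^sup>2)"
    have "invertible_op (cspace 4) ?S"
      unfolding invertible_op_def
      by (rule exI[of _ ?R]) (use n bop_block_op in \<open>auto simp: S block_op_comp cspace_simps(1) block_op_id power2_eq_square simp del: peval.simps peval_op.simps\<close>)
    then show False using w by (auto simp: joint_spectrum_def op_spectrum_def simp del: peval.simps peval_op.simps)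
  qed
  have "w1 = 0" using key[of "Poly_Mapping.single (1, 0, 0) 1"] by (simp add: e lookup_single)
  moreover have "w2 = 0" using key[of "Poly_Mapping.single (0, 1, 0) 1"] by (simp add: e lookup_single)
  moreover have "w3 = 0" using key[of "Poly_Mapping.single (0, 0, 1) 1"] by (simp add: e lookup_single)
  ultimately show "w \<in> {(0, 0, 0)}" by (simp add: e)
qed

lemma spectral_set_example: "spectral_set (closure tetrablock) (cspace 4) ex_triple"
  unfolding spectral_set_def
proof (intro conjI ballI)
  have z: "(0, 0, 0) \<in> closure tetrablock" using zero_in_tetrablock closure_subset by blast
  then show "joint_spectrum (cspace 4) ex_triple \<subseteq> closure tetrablock" using joint_spectrum_example by blast
  fix f assume f: "f \<in> Rat (closure tetrablock)"
  define B where "B = (SUP w\<in>closure tetrablock. cmod (reval f w))"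
  obtain C where C: "\<And>w. w \<in> closure tetrablock \<Longrightarrow> cmod (reval f w) \<le> C"
    using bounded_reval[OF compact_closure_tetrablock f] by blast
  have le: "cmod (reval f w) \<le> B" if "w \<in> closure tetrablock" for w
    unfolding B_def by (rule cSUP_upper[OF that bdd_aboveI2[OF C]])
  have "op_norm (cspace 4) (cspace 4) (reval_op (cspace 4) f ex_triple) \<le> S" if SB: "S > B" for S
  proof -
    have lt: "cmod (reval f w) < S" if "w \<in> closure tetrablock" for w using le[OF that] SB by linarith
    have S: "S > 0" using lt[OF z] norm_ge_zero by (rule le_less_trans[rotated])
    note b = tetrablock_derivative_bounds[OF f lt]
    show ?thesis
      by (rule op_norm_bounds(1)[OF pre_hilbert_cspace pre_hilbert_cspace])
        (use S block_op_contraction[OF _ S b] C4.bop_smult[OF bop_block_op] in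
          \<open>auto simp: reval_op_example[OF f z] C4.smc[unfolded cspace_simps(1)] cspace_simps(1) simp del: reval_op.simps\<close>)
  qed
  then show "op_norm (cspace 4) (cspace 4) (reval_op (cspace 4) f ex_triple) \<le> (SUP w\<in>closure tetrablock. cmod (reval f w))"
    unfolding B_def[symmetric] by (rule dense_ge)
qed

definition one_poly :: cpoly3 where "one_poly = Poly_Mapping.single (0, 0, 0) 1"

text \<open>
  The matrix function with rows \<open>(x\<^sub>1, x\<^sub>3 - x\<^sub>1x\<^sub>2)\<close> and \<open>(0, x\<^sub>2)\<close>. The term \<open>x\<^sub>1x\<^sub>2\<close> makes it contractive on the
  tetrablock but does not affect its value at the example.
\<close>
definition ex_fun :: "cratfun3 mat" where
  "ex_fun = mat 2 2 (\<lambda>(i, j).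
     (if i = 0 \<and> j = 0 then Poly_Mapping.single (1, 0, 0) 1
      else if i = 0 then Poly_Mapping.single (0, 0, 1) 1 - Poly_Mapping.single (1, 1, 0) 1
      else if j = 0 then 0 else Poly_Mapping.single (0, 1, 0) 1, one_poly))"

lemma peval_superset:
  assumes "finite A" "Poly_Mapping.keys p \<subseteq> A"
  shows "peval p w = (\<Sum>m\<in>A. Poly_Mapping.lookup p m *
    (fst w ^ fst m * fst (snd w) ^ fst (snd m) * snd (snd w) ^ snd (snd m)))"
  unfolding peval_eq_sum using assms by (intro sum.mono_neutral_left) (auto simp: in_keys_iff)

lemma peval_off_diagonal:
  "peval (Poly_Mapping.single (0, 0, 1) 1 - Poly_Mapping.single (1, 1, 0) 1) (x1, x2, x3) = x3 - x1 * x2"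
proof -
  have "Poly_Mapping.keys (Poly_Mapping.single (0, 0, 1) 1 - Poly_Mapping.single (1, 1, 0) (1::complex)) \<subseteq> {(0, 0, 1), (1, 1, 0)}"
    by (auto simp: in_keys_iff lookup_minus lookup_single when_def split: if_splits)
  from peval_superset[OF _ this] show ?thesis
    by (simp add: lookup_minus lookup_single del: peval.simps One_nat_def)
qed

lemma ex_fun_Rat: "ex_fun \<in> Rat_mat 2 \<Omega>"
  by (auto simp: Rat_mat_def ex_fun_def Rat_def one_poly_def)

lemma peval_monomial: "peval (Poly_Mapping.single (a, b, c) 1) (x1, x2, x3) = x1 ^ a * x2 ^ b * x3 ^ c"
  by simp

lemma peval_0: "peval 0 w = 0"
  by (cases w) simp

lemma mat_reval_ex_fun:
  "mat_reval ex_fun (x1, x2, x3) = mat 2 2 (\<lambda>(i, j). if i = 0 \<and> j = 0 then x1 else if i = 0 then x3 - x1 * x2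
     else if j = 0 then 0 else x2)"
  by (rule eq_matI)
    (auto simp: mat_reval_def ex_fun_def one_poly_def peval_off_diagonal peval_monomial peval_0
      simp del: peval.simps One_nat_def)

text \<open>
  After inserting \<open>1 - r\<^sub>1\<^sup>2 \<ge> g\<close> and \<open>1 - r\<^sub>2\<^sup>2 \<ge> g\<close>, the difference of the two sides is at least
  \<open>g (s - r\<^sub>1 t)\<^sup>2\<close>.
\<close>
lemma upper_triangular_real_bound:
  fixes s t r1 r2 g :: real
  assumes "r1 \<ge> 0" "g \<ge> 0" "g \<le> 1 - r1\<^sup>2" "g \<le> 1 - r2\<^sup>2"
  shows "(r1 * s + g * t)\<^sup>2 + (r2 * t)\<^sup>2 \<le> s\<^sup>2 + t\<^sup>2"
proof -
  have 1: "g * s\<^sup>2 \<le> (1 - r1\<^sup>2) * s\<^sup>2" using assms by (intro mult_right_mono) auto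
  have 2: "g * t\<^sup>2 \<le> (1 - r2\<^sup>2) * t\<^sup>2" using assms by (intro mult_right_mono) auto
  have 3: "(g * g) * t\<^sup>2 \<le> (g * (1 - r1\<^sup>2)) * t\<^sup>2" using assms by (intro mult_right_mono mult_left_mono) auto
  have "g * (s - r1 * t)\<^sup>2 \<ge> 0" using assms by simp
  then have "2 * r1 * g * s * t \<le> g * s\<^sup>2 + g * r1\<^sup>2 * t\<^sup>2" by (simp add: power2_eq_square algebra_simps)
  moreover have "(r1 * s + g * t)\<^sup>2 + (r2 * t)\<^sup>2
    = r1\<^sup>2 * s\<^sup>2 + 2 * r1 * g * s * t + (g * g) * t\<^sup>2 + r2\<^sup>2 * t\<^sup>2"
    by (simp add: power2_eq_square algebra_simps)
  ultimately show ?thesis using 1 2 3 by (simp add: algebra_simps)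
qed

lemma ex_fun_contractive:
  assumes w: "w \<in> closure tetrablock"
  shows "op_norm (cspace 2) (cspace 2) (\<lambda>v. mat_reval ex_fun w *\<^sub>v v) \<le> 1"
proof (rule op_norm_bounds(1)[OF pre_hilbert_cspace pre_hilbert_cspace])
  obtain x1 x2 x3 where e: "w = (x1, x2, x3)" by (cases w) auto
  define G where "G = mat_reval ex_fun w"
  have G: "G \<in> carrier_mat 2 2" by (simp add: G_def e mat_reval_ex_fun)
  fix v assume "v \<in> carrier (cspace 2)"
  then have v: "v \<in> carrier_vec 2" by (simp add: cspace_simps)
  then have Gv: "G *\<^sub>v v \<in> carrier_vec 2" using G by simp
  then show "mat_reval ex_fun w *\<^sub>v v \<in> carrier (cspace 2)" by (simp add: cspace_simps G_def)
  show "mat_reval ex_fun w *\<^sub>v (c \<odot>\<^bsub>cspace 2\<^esub> v) = c \<odot>\<^bsub>cspace 2\<^esub> (mat_reval ex_fun w *\<^sub>v v)" for c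
    using G v by (simp add: cspace_simps G_def mult_mat_vec)
  have s: "{0..<2::nat} = {0, 1}" "{..<2::nat} = {0, 1}" by auto
  have idx: "(G *\<^sub>v v) $ 0 = x1 * v $ 0 + (x3 - x1 * x2) * v $ 1" "(G *\<^sub>v v) $ 1 = x2 * v $ 1"
    using v by (simp_all add: G_def e mat_reval_ex_fun scalar_prod_def s)
  show "hnorm (cspace 2) (mat_reval ex_fun w *\<^sub>v v) \<le> 1 * hnorm (cspace 2) v"
  proof (rule power2_le_imp_le)
    have "(hnorm (cspace 2) (mat_reval ex_fun w *\<^sub>v v))\<^sup>2
      = (cmod (x1 * v $ 0 + (x3 - x1 * x2) * v $ 1))\<^sup>2 + (cmod (x2 * v $ 1))\<^sup>2"
      unfolding G_def[symmetric] hnorm_cspace[OF Gv] using idx by (simp add: L2_set_def s)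
    also have "\<dots> \<le> (cmod x1 * cmod (v $ 0) + cmod (x3 - x1 * x2) * cmod (v $ 1))\<^sup>2 + (cmod x2 * cmod (v $ 1))\<^sup>2"
      using norm_triangle_ineq[of "x1 * v $ 0" "(x3 - x1 * x2) * v $ 1"]
      by (intro add_mono power_mono) (auto simp: norm_mult)
    also have "\<dots> \<le> (cmod (v $ 0))\<^sup>2 + (cmod (v $ 1))\<^sup>2"
      using closure_tetrablock_bounds[of x1 x2 x3] w e by (intro upper_triangular_real_bound) auto
    also have "\<dots> = (1 * hnorm (cspace 2) v)\<^sup>2" by (simp add: hnorm_cspace[OF v] L2_set_def s)
    finally show "(hnorm (cspace 2) (mat_reval ex_fun w *\<^sub>v v))\<^sup>2 \<le> (1 * hnorm (cspace 2) v)\<^sup>2" .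
  qed (use v in \<open>simp add: hnorm_cspace\<close>)
qed simp

text \<open>
  At the example the matrix function has the entries \<open>T\<^sub>1, T\<^sub>3\<close> in its first row and \<open>0, T\<^sub>2\<close> in its second. On
  the span of suitable basis vectors it acts as the matrix with rows \<open>(3/4, 1/2)\<close> and \<open>(0, 3/4)\<close>, of norm greater
  than \<open>1\<close>; the vector \<open>(3/5, 4/5)\<close> shows this.
\<close>
lemma not_complete_spectral_set_example: "\<not> complete_spectral_set (closure tetrablock) (cspace 4) ex_triple"
proof
  assume "complete_spectral_set (closure tetrablock) (cspace 4) ex_triple"
  then have "op_norm (hpow 2 (cspace 4)) (hpow 2 (cspace 4)) (mat_reval_op (cspace 4) ex_fun ex_triple)
      \<le> (SUP w\<in>closure tetrablock. op_norm (cspace 2) (cspace 2) (\<lambda>v. mat_reval ex_fun w *\<^sub>v v))"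
    unfolding complete_spectral_set_def using ex_fun_Rat[of "closure tetrablock"] by simp
  also have "\<dots> \<le> 1"
    by (rule cSUP_least) (use zero_in_tetrablock closure_subset ex_fun_contractive in auto)
  finally have on: "op_norm (hpow 2 (cspace 4)) (hpow 2 (cspace 4)) (mat_reval_op (cspace 4) ex_fun ex_triple) \<le> 1" .
  interpret P: pre_hilbert "hpow 2 (cspace 4)" by (rule C4.pre_hilbert_hpow)
  define X where "X = (\<lambda>i j. reval_op (cspace 4) (ex_fun $$ (i, j)) ex_triple)"
  have FT: "mat_reval_op (cspace 4) ex_fun ex_triple = C4.matrix_op 2 X"
    by (rule ext) (simp add: mat_reval_op_def C4.matrix_op_def X_def ex_fun_def del: reval_op.simps)
  have Rat: "ex_fun $$ (i, j) \<in> Rat {(0, 0, 0)}" if "i < 2" "j < 2" for i j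
    using ex_fun_Rat[of "{(0, 0, 0)}"] that by (simp add: Rat_mat_def)
  have Xb: "X i j v = block_op (reval (ex_fun $$ (i, j)) (0, 0, 0)) (rjet (ex_fun $$ (i, j)) 1 0 0) (rjet (ex_fun $$ (i, j)) 0 1 0) (rjet (ex_fun $$ (i, j)) 0 0 1) v"
    if "i < 2" "j < 2" "v \<in> carrier_vec 4" for i j v
    unfolding X_def by (rule reval_op_example[OF Rat _ that(3)]) (use that in auto)
  have bX: "C4.bop (X i j)" if "i < 2" "j < 2" for i j
    by (rule C4.bop_cong[OF bop_block_op]) (simp add: Xb[OF that] cspace_simps)
  have bS: "P.bop (C4.matrix_op 2 X)" by (rule C4.bop_matrix_op[OF bX])
  have l: "rjet (p, one_poly) a b c = jet p a b c" "reval (p, one_poly) (0, 0, 0) = Poly_Mapping.lookup p (0, 0, 0)" for p a b c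
    by (simp_all add: rjet_def peval_zero one_poly_def jet_def lookup_single del: peval.simps)
  have X': "X 0 0 v = block_op 0 1 0 0 v" "X 0 1 v = block_op 0 0 0 1 v" "X 1 0 v = block_op 0 0 0 0 v" "X 1 1 v = block_op 0 0 1 0 v"
    if "v \<in> carrier_vec 4" for v
    using that by (simp_all add: Xb ex_fun_def l jet_def lookup_single lookup_minus del: reval.simps)
  \<comment> \<open>Only the lower halves matter: \<open>(0, 3/5)\<close> is mapped by the corner \<open>A\<^sub>1\<close>, and \<open>(4/5, 0)\<close> by \<open>A\<^sub>3\<close> and \<open>A\<^sub>2\<close>.\<close>
  define y where "y = vec 2 (\<lambda>i. if i = 0 then vec 4 (\<lambda>j. if j = 3 then 3/5 else (0::complex))
    else vec 4 (\<lambda>j. if j = 2 then 4/5 else 0))"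
  have y: "y \<in> carrier (hpow 2 (cspace 4))" by (simp add: y_def hpow_simps cspace_simps)
  have s: "{..<2::nat} = {0, 1}" "{..<4::nat} = {0, 1, 2, 3}" by auto
  have ny: "P.nm y = 1"
  proof (rule power2_eq_imp_eq)
    show "(P.nm y)\<^sup>2 = 1\<^sup>2"
      using y by (simp add: C4.hpow_norm_sq s y_def hnorm4_sq norm_prod_def norm_divide power_divide)
  qed (use y in auto)
  have My: "C4.matrix_op 2 X y \<in> carrier (hpow 2 (cspace 4))" by (rule P.bop_cl[OF bS y])
  have yc: "y $ 0 \<in> carrier_vec 4" "y $ 1 \<in> carrier_vec 4" by (simp_all add: y_def)
  have mc: "C4.matrix_op 2 X y $ i $ l = X i 0 (y $ 0) $ l + X i 1 (y $ 1) $ l" if "i < 2" "l < 4" for i l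
  proof -
    have "finsum (cspace 4) (\<lambda>j. X i j (y $ j)) {..<2} $ l = (\<Sum>j<2. X i j (y $ j) $ l)"
      using that yc by (intro finsum_cspace_index) (auto simp: s Xb)
    then show ?thesis using that by (simp add: C4.matrix_op_def s)
  qed
  have mcl: "C4.matrix_op 2 X y $ 0 \<in> carrier_vec 4" "C4.matrix_op 2 X y $ 1 \<in> carrier_vec 4"
    using My by (simp_all add: hpow_simps cspace_simps)
  have v0: "C4.matrix_op 2 X y $ 0 $ 0 = 17/20" using mc[of 0 0] yc by (simp add: X' block_op_index y_def del: One_nat_def)
  have v1: "C4.matrix_op 2 X y $ 1 $ 1 = 3/5" using mc[of 1 1] yc by (simp add: X' block_op_index y_def del: One_nat_def)
  have "(17/20)\<^sup>2 + (3/5)\<^sup>2 \<le> (cmod (C4.matrix_op 2 X y $ 0 $ 0))\<^sup>2 + (cmod (C4.matrix_op 2 X y $ 1 $ 1))\<^sup>2"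
    unfolding v0 v1 by (simp add: norm_divide)
  also have "\<dots> \<le> (P.nm (C4.matrix_op 2 X y))\<^sup>2"
    using My by (simp add: C4.hpow_norm_sq s hnorm4_sq[OF mcl(1)] hnorm4_sq[OF mcl(2), simplified] norm_prod_def)
  finally have big: "1 < (P.nm (C4.matrix_op 2 X y))\<^sup>2" by (simp add: power2_eq_square)
  obtain C where C: "C > 0" "\<And>x. x \<in> carrier (hpow 2 (cspace 4)) \<Longrightarrow> P.nm (C4.matrix_op 2 X x) \<le> C * P.nm x"
    using P.bop_bound[OF bS] by blast
  have "P.nm (C4.matrix_op 2 X y) \<le> op_norm (hpow 2 (cspace 4)) (hpow 2 (cspace 4)) (C4.matrix_op 2 X) * P.nm y"
    by (rule op_norm_bounds(2)[OF P.pre_hilbert_axioms P.pre_hilbert_axioms, where C=C])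
      (use C y bS in \<open>auto simp: P.bop_cl P.bop_smult\<close>)
  then have "P.nm (C4.matrix_op 2 X y) \<le> 1" using on by (simp add: FT ny)
  then have "(P.nm (C4.matrix_op 2 X y))\<^sup>2 \<le> 1\<^sup>2" using My by (intro power_mono) auto
  then show False using big by simp
qed

section \<open>Failure of rational dilation\<close>

theorem theorem0p1:
  shows
  "(\<exists>n\<ge>1. \<exists>A1\<in>carrier_mat n n. \<exists>A2\<in>carrier_mat n n. \<exists>A3\<in>carrier_mat n n.
      commuting_triple (cspace (2 * n)) (nilpotent_triple n A1 A2 A3) \<and>
      spectral_set (closure tetrablock) (cspace (2 * n)) (nilpotent_triple n A1 A2 A3) \<and>
      \<not> complete_spectral_set (closure tetrablock) (cspace (2 * n)) (nilpotent_triple n A1 A2 A3)) \<and>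
   (\<forall>n\<ge>1. \<forall>A1\<in>carrier_mat n n. \<forall>A2\<in>carrier_mat n n. \<forall>A3\<in>carrier_mat n n.
      spectral_set (closure tetrablock) (cspace (2 * n)) (nilpotent_triple n A1 A2 A3) \<and>
      \<not> complete_spectral_set (closure tetrablock) (cspace (2 * n)) (nilpotent_triple n A1 A2 A3) \<longrightarrow>
      \<not> (\<exists>(K :: 'k hilbert) V N.
            rational_dilation (closure tetrablock) (cspace (2 * n)) (nilpotent_triple n A1 A2 A3) K V N)) \<and>
   (\<exists>(H :: cvec hilbert) T.
      hilbert_space H \<and> commuting_triple H T \<and> spectral_set (closure tetrablock) H T \<and>
      \<not> (\<exists>(K :: 'k hilbert) V N. rational_dilation (closure tetrablock) H T K V N))"
proof (intro conjI)
  let ?E = "closure tetrablock"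
  have dim: "cspace (2 * 2) = cspace 4" by simp
  have nonempty: "?E \<noteq> {}" using zero_in_tetrablock closure_subset by blast
  have no_dilation: "\<not> (\<exists>(K :: 'k hilbert) V N. rational_dilation ?E H T K V N)"
    if "hilbert_space H" "spectral_set ?E H T" "\<not> complete_spectral_set ?E H T" for H :: "cvec hilbert" and T
  proof -
    interpret hilbert_space H by fact
    show ?thesis
      using rational_dilation_imp_complete_spectral_set[OF pre_hilbert_axioms compact_closure_tetrablock nonempty]
        that(2,3) unfolding spectral_set_def by blast
  qed
  show "\<exists>n\<ge>1. \<exists>A1\<in>carrier_mat n n. \<exists>A2\<in>carrier_mat n n. \<exists>A3\<in>carrier_mat n n.
      commuting_triple (cspace (2 * n)) (nilpotent_triple n A1 A2 A3) \<and>
      spectral_set ?E (cspace (2 * n)) (nilpotent_triple n A1 A2 A3) \<and>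
      \<not> complete_spectral_set ?E (cspace (2 * n)) (nilpotent_triple n A1 A2 A3)"
    by (rule exI[of _ 2], intro conjI bexI[of _ ex_A1] bexI[of _ ex_A2] bexI[of _ ex_A3])
      (simp_all only: dim ex_A_carrier commuting_example spectral_set_example not_complete_spectral_set_example, simp_all)
  show "\<forall>n\<ge>1. \<forall>A1\<in>carrier_mat n n. \<forall>A2\<in>carrier_mat n n. \<forall>A3\<in>carrier_mat n n.
      spectral_set ?E (cspace (2 * n)) (nilpotent_triple n A1 A2 A3) \<and>
      \<not> complete_spectral_set ?E (cspace (2 * n)) (nilpotent_triple n A1 A2 A3) \<longrightarrow>
      \<not> (\<exists>(K :: 'k hilbert) V N.
            rational_dilation ?E (cspace (2 * n)) (nilpotent_triple n A1 A2 A3) K V N)"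
    using no_dilation[OF hilbert_space_cspace] by blast
  show "\<exists>(H :: cvec hilbert) T.
      hilbert_space H \<and> commuting_triple H T \<and> spectral_set ?E H T \<and>
      \<not> (\<exists>(K :: 'k hilbert) V N. rational_dilation ?E H T K V N)"
    using hilbert_space_cspace commuting_example spectral_set_example
      no_dilation[OF hilbert_space_cspace spectral_set_example not_complete_spectral_set_example] by blast
qed

end
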